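(* Let $V:\mathbb{H}^2\to \mathrm{T}\mathbb{H}^2$ be a smooth vector field on $\mathbb{H}^2$. The following are equivalent: (1) There exists a smooth function $u:\mathbb{H}^2\to\mathbb{R}$ such that $S=\mathrm{gr}(u)$ is a mean surface in Half-Pipe space $\mathbb{HP}^3$ and $V$ is the vector field associated with the surface $S$, that is $V=V_S$. (2) $V$ is harmonic Lagrangian. (3) The unique self-adjoint $(1,1)$-tensor $\mathrm{b}:\mathrm{T}\mathbb{H}^2\to \mathrm{T}\mathbb{H}^2$ such that $\mathcal{L}_V g=g(\mathrm{b}\,\cdot,\cdot)$ satisfies $\mathrm{tr}(\mathrm{b})=0$ and $\mathrm{d}^{\nabla}\mathrm{b}=0$.
   Context: Minkowski space $\mathbb{R}^{1,2}$ is $\mathbb{R}^3$ with $\langle x,y\rangle_{1,2}=-x_0y_0+x_1y_1+x_2y_2$. The hyperbolic plane is $\mathbb{H}^2=\{x\in\mathbb{R}^{1,2}: \langle x,x\rangle_{1,2}=-1,\ x_0>0\}$ with the induced Riemannian metric $g$ and Levi-Civita connection $\nabla$. For $x,y\in\mathbb{R}^{1,2}$, $x\boxtimes y$ is the unique vector with $\langle x\boxtimes y,v\rangle_{1,2}=\det(x,y,v)$ for all $v$. The complex structure on $\mathbb{H}^2$ is $\mathrm{J}_p(v)=p\boxtimes v$. $\mathcal{L}_Vg$ is the Lie derivative, and for a $(1,1)$-tensor $\mathrm{b}$, $\mathrm{d}^\nabla \mathrm{b}(X,Y)=\nabla_X(\mathrm{b}(Y))-\nabla_Y(\mathrm{b}(X))-\mathrm{b}([X,Y])$.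 Surfaces in Half-Pipe space. Let $\mathbb{D}^2\subset\mathbb{R}^2$ be the open unit disk and $\Pi:\mathbb{H}^2\to\mathbb{D}^2$, $\Pi(x_0,x_1,x_2)=(x_1/x_0,x_2/x_0)$. Half-Pipe space $\mathbb{HP}^3$ is identified with $\mathbb{H}^2\times\mathbb{R}$, and its Klein model is $\mathbb{D}^2\times\mathbb{R}$; the graph $\mathrm{gr}(u)$ of $u:\mathbb{H}^2\to\mathbb{R}$ corresponds in the Klein model to the graph of $\overline{u}(\eta)=\sqrt{1-|\eta|^2}\,u(\Pi^{-1}(\eta))$, $\eta\in\mathbb{D}^2$. For $\sigma\in\mathbb{R}^{1,2}$ let $\mathrm{P}_\sigma=\{(\eta,t)\in\mathbb{D}^2\times\mathbb{R}: \langle(1,\eta),\sigma\rangle_{1,2}=t\}$; every non-vertical plane is $\mathrm{P}_\sigma$ for a unique $\sigma$. For smooth $u$ and $S=\mathrm{gr}(u)$, the associated vector field is $V_S(p)=p\boxtimes\sigma_p$, where $\mathrm{P}_{\sigma_p}$ is the tangent plane of $\mathrm{gr}(\overline{u})$ at $(\Pi(p),\overline{u}(\Pi(p)))$. The shape operator of $\mathrm{gr}(u)$ in $\mathbb{HP}^3$ is the $(1,1)$-tensor $\mathrm{B}=\mathrm{Hess}\,u-u\,\mathbb{1}$ on $\mathbb{H}^2$, where $\mathrm{Hess}\,u(v)=\nabla_v\,\mathrm{grad}\,u$; $\mathrm{gr}(u)$ is a mean surface if $\mathrm{tr}(\mathrm{B})=0$, i.e. $\Delta u-2u=0$ with $\Delta=\mathrm{tr}\,\mathrm{Hess}$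 the Laplace-Beltrami operator of $\mathbb{H}^2$. Geometry of $\mathrm{T}\mathbb{H}^2$. For $(x,v)\in \mathrm{T}\mathbb{H}^2$, identify $\mathrm{T}_x\mathbb{H}^2\times \mathrm{T}_x\mathbb{H}^2\cong \mathrm{T}_{(x,v)}\mathrm{T}\mathbb{H}^2$ by $(w_1,w_2)\mapsto w_1^{\mathcal{H}}+w_2^{\mathcal{V}}$ (horizontal lift of $w_1$ with respect to $\nabla$ plus vertical lift of $w_2$). Define the pseudo-Riemannian metric $\mathbb{G}((X_1,X_2),(Y_1,Y_2))=g(X_1,Y_2)+g(X_2,Y_1)$ of signature $(2,2)$ and the symplectic form $\Omega((X_1,X_2),(Y_1,Y_2))=g(\mathrm{J}X_1,Y_2)-g(X_2,\mathrm{J}Y_1)$. A vector field $V$ is harmonic Lagrangian if $V:(\mathbb{H}^2,g)\to(\mathrm{T}\mathbb{H}^2,\mathbb{G})$ is a harmonic map (its tension field $\mathrm{tr}_g(\nabla^2V)$, with $\nabla^2V(X,Y)=\nabla^{\mathbb{G}}_{\mathrm{d}V(X)}\mathrm{d}V(Y)-\mathrm{d}V(\nabla_XY)$, vanishes) and $V(\mathbb{H}^2)$ is Lagrangian for $\Omega$ ($V^*\Omega=0$). *)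

theory Defs
  imports "HOL-Analysis.Analysis"
begin

section \<open>Smooth calculus on embedded submanifolds of a Euclidean space\<close>

text \<open>
  A submanifold is given by its underlying set \<open>M\<close>. Maps and fields on \<open>M\<close> are
  total functions on the ambient space of which only the values on \<open>M\<close> matter.
\<close>

primrec Ck_on :: "nat \<Rightarrow> 'a::euclidean_space set \<Rightarrow> ('a \<Rightarrow> 'b::euclidean_space) \<Rightarrow> bool" where
  "Ck_on 0 U f \<longleftrightarrow> continuous_on U f"
| "Ck_on (Suc k) U f \<longleftrightarrow>
     (\<forall>x\<in>U. f differentiable (at x)) \<and> (\<forall>v. Ck_on k U (\<lambda>x. frechet_derivative f (at x) v))"

text \<open>\<open>C\<^sup>\<infinity>\<close> on an open set.\<close>

definition smooth_on :: "'a::euclidean_space set \<Rightarrow> ('a \<Rightarrow> 'b::euclidean_space) \<Rightarrow> bool" where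
  "smooth_on U f \<longleftrightarrow> (\<forall>k. Ck_on k U f)"

definition smooth_map :: "'a::euclidean_space set \<Rightarrow> ('a \<Rightarrow> 'b::euclidean_space) \<Rightarrow> bool" where
  "smooth_map M f \<longleftrightarrow>
     (\<forall>p\<in>M. \<exists>U F. open U \<and> p \<in> U \<and> smooth_on U F \<and> (\<forall>x\<in>M \<inter> U. F x = f x))"

definition tangent_space :: "'a::euclidean_space set \<Rightarrow> 'a \<Rightarrow> 'a set" where
  "tangent_space M p =
     {v. \<exists>\<gamma>::real \<Rightarrow> 'a. (\<forall>t. \<gamma> t \<in> M) \<and> \<gamma> 0 = p \<and> (\<gamma> has_vector_derivative v) (at 0)}"

text \<open>
  The differential \<open>df\<^sub>p(v)\<close>. The Frechet derivative within \<open>M\<close> is not unique in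
  directions transversal to \<open>M\<close>, but its values on \<open>tangent_space M p\<close> are; it is only
  ever applied to those.
\<close>

definition mderiv :: "'a::euclidean_space set \<Rightarrow> ('a \<Rightarrow> 'b::euclidean_space) \<Rightarrow> 'a \<Rightarrow> 'a \<Rightarrow> 'b" where
  "mderiv M f p v = frechet_derivative f (at p within M) v"

definition section_along ::
  "'a::euclidean_space set \<Rightarrow> 'b::euclidean_space set \<Rightarrow> ('a \<Rightarrow> 'b) \<Rightarrow> ('a \<Rightarrow> 'b) \<Rightarrow> bool" where
  "section_along M N F W \<longleftrightarrow> smooth_map M W \<and> (\<forall>p\<in>M. W p \<in> tangent_space N (F p))"

definition vector_field :: "'a::euclidean_space set \<Rightarrow> ('a \<Rightarrow> 'a) \<Rightarrow> bool" where
  "vector_field M X \<longleftrightarrow> section_along M M (\<lambda>p. p) X"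

text \<open>
  The bracket of two fields tangent to \<open>M\<close>: the commutator of the derivations \<open>X\<close>, \<open>Y\<close>
  applied to the ambient coordinate functions.
\<close>

definition lie_bracket ::
  "'a::euclidean_space set \<Rightarrow> ('a \<Rightarrow> 'a) \<Rightarrow> ('a \<Rightarrow> 'a) \<Rightarrow> 'a \<Rightarrow> 'a" where
  "lie_bracket M X Y p = mderiv M Y p (X p) - mderiv M X p (Y p)"


section \<open>Metrics, connections, harmonic maps\<close>

text \<open>A (pseudo-Riemannian) metric \<open>g\<close> on \<open>M\<close>: \<open>g p v w\<close> for \<open>v\<close>, \<open>w\<close> tangent at \<open>p\<close>.\<close>

type_synonym 'a metric = "'a \<Rightarrow> 'a \<Rightarrow> 'a \<Rightarrow> real"

text \<open>
  \<open>D p v W\<close> is the covariant derivative at \<open>p\<close>, in the direction \<open>v\<close>, of the section \<open>W\<close>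
  of the pulled-back tangent bundle \<open>F\<^sup>*TN\<close>. For \<open>M = N\<close> and \<open>F\<close> the identity these are the
  affine connections on \<open>M\<close>.
\<close>

definition connection_along ::
  "'a::euclidean_space set \<Rightarrow> 'b::euclidean_space set \<Rightarrow> ('a \<Rightarrow> 'b)
     \<Rightarrow> ('a \<Rightarrow> 'a \<Rightarrow> ('a \<Rightarrow> 'b) \<Rightarrow> 'b) \<Rightarrow> bool" where
  "connection_along M N F D \<longleftrightarrow>
     (\<forall>X W. vector_field M X \<longrightarrow> section_along M N F W \<longrightarrow> section_along M N F (\<lambda>p. D p (X p) W)) \<and>
     (\<forall>W. section_along M N F W \<longrightarrow> (\<forall>p\<in>M. \<forall>v\<in>tangent_space M p. \<forall>w\<in>tangent_space M p. \<forall>a b.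
        D p (a *\<^sub>R v + b *\<^sub>R w) W = a *\<^sub>R D p v W + b *\<^sub>R D p w W)) \<and>
     (\<forall>W W'. section_along M N F W \<longrightarrow> section_along M N F W' \<longrightarrow>
        (\<forall>p\<in>M. \<forall>v\<in>tangent_space M p. D p v (\<lambda>q. W q + W' q) = D p v W + D p v W')) \<and>
     (\<forall>f W. smooth_map M f \<longrightarrow> section_along M N F W \<longrightarrow>
        (\<forall>p\<in>M. \<forall>v\<in>tangent_space M p.
           D p v (\<lambda>q. f q *\<^sub>R W q) = mderiv M f p v *\<^sub>R W p + f p *\<^sub>R D p v W))"

definition is_levi_civita ::
  "'a::euclidean_space set \<Rightarrow> 'a metric \<Rightarrow> ('a \<Rightarrow> 'a \<Rightarrow> ('a \<Rightarrow> 'a) \<Rightarrow> 'a) \<Rightarrow> bool" where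
  "is_levi_civita M g D \<longleftrightarrow>
     connection_along M M (\<lambda>p. p) D \<and>
     (\<forall>Y Z. vector_field M Y \<longrightarrow> vector_field M Z \<longrightarrow>
        (\<forall>p\<in>M. \<forall>v\<in>tangent_space M p.
           mderiv M (\<lambda>q. g q (Y q) (Z q)) p v = g p (D p v Y) (Z p) + g p (Y p) (D p v Z))) \<and>
     (\<forall>X Y. vector_field M X \<longrightarrow> vector_field M Y \<longrightarrow>
        (\<forall>p\<in>M. D p (X p) Y - D p (Y p) X = lie_bracket M X Y p))"

definition levi_civita ::
  "'a::euclidean_space set \<Rightarrow> 'a metric \<Rightarrow> 'a \<Rightarrow> 'a \<Rightarrow> ('a \<Rightarrow> 'a) \<Rightarrow> 'a" where
  "levi_civita M g = (SOME D. is_levi_civita M g D)"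

text \<open>
  The connection on \<open>F\<^sup>*TN\<close> pulled back from the Levi-Civita connection of \<open>(N, h)\<close>; for
  tangent \<open>v\<close> its value on \<open>W\<close> is what is usually written \<open>\<nabla>\<^sup>h\<close> of \<open>W\<close> in the direction
  \<open>dF(v)\<close>.
\<close>

definition is_pullback_connection ::
  "'a::euclidean_space set \<Rightarrow> 'b::euclidean_space set \<Rightarrow> 'b metric \<Rightarrow> ('a \<Rightarrow> 'b)
     \<Rightarrow> ('a \<Rightarrow> 'a \<Rightarrow> ('a \<Rightarrow> 'b) \<Rightarrow> 'b) \<Rightarrow> bool" where
  "is_pullback_connection M N h F P \<longleftrightarrow>
     connection_along M N F P \<and>
     (\<forall>Z. vector_field N Z \<longrightarrow> (\<forall>p\<in>M. \<forall>v\<in>tangent_space M p.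
        P p v (\<lambda>q. Z (F q)) = levi_civita N h (F p) (mderiv M F p v) Z))"

definition pullback_connection ::
  "'a::euclidean_space set \<Rightarrow> 'b::euclidean_space set \<Rightarrow> 'b metric \<Rightarrow> ('a \<Rightarrow> 'b)
     \<Rightarrow> 'a \<Rightarrow> 'a \<Rightarrow> ('a \<Rightarrow> 'b) \<Rightarrow> 'b" where
  "pullback_connection M N h F = (SOME P. is_pullback_connection M N h F P)"

definition orthonormal_basis :: "'a::euclidean_space set \<Rightarrow> 'a metric \<Rightarrow> 'a \<Rightarrow> 'a set \<Rightarrow> bool" where
  "orthonormal_basis M g p B \<longleftrightarrow>
     finite B \<and> B \<subseteq> tangent_space M p \<and> span B = tangent_space M p \<and>
     (\<forall>e\<in>B. \<forall>e'\<in>B. g p e e' = (if e = e' then 1 else 0))"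

text \<open>
  Traces at \<open>p\<close> with respect to a Riemannian metric \<open>g\<close>: of a vector-valued bilinear form,
  and of an endomorphism of the tangent space.
\<close>

definition metric_trace ::
  "'a::euclidean_space set \<Rightarrow> 'a metric \<Rightarrow> 'a \<Rightarrow> ('a \<Rightarrow> 'a \<Rightarrow> 'b::real_vector) \<Rightarrow> 'b" where
  "metric_trace M g p h = (\<Sum>e\<in>(SOME B. orthonormal_basis M g p B). h e e)"

definition endo_trace :: "'a::euclidean_space set \<Rightarrow> 'a metric \<Rightarrow> 'a \<Rightarrow> ('a \<Rightarrow> 'a) \<Rightarrow> real" where
  "endo_trace M g p A = metric_trace M g p (\<lambda>v w. g p (A v) w)"

text \<open>
  \<open>(\<nabla>\<^sup>2F)\<^sub>p(v, w)\<close>. The expression is tensorial in \<open>Y\<close>, so any field \<open>Y\<close> extending \<open>w\<close>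
  gives the same value.
\<close>

definition second_derivative ::
  "'a::euclidean_space set \<Rightarrow> 'a metric \<Rightarrow> 'b::euclidean_space set \<Rightarrow> 'b metric \<Rightarrow> ('a \<Rightarrow> 'b)
     \<Rightarrow> 'a \<Rightarrow> 'a \<Rightarrow> 'a \<Rightarrow> 'b" where
  "second_derivative M g N h F p v w =
     (let Y = (SOME Y. vector_field M Y \<and> Y p = w)
      in pullback_connection M N h F p v (\<lambda>q. mderiv M F q (Y q))
         - mderiv M F p (levi_civita M g p v Y))"

definition tension_field ::
  "'a::euclidean_space set \<Rightarrow> 'a metric \<Rightarrow> 'b::euclidean_space set \<Rightarrow> 'b metric \<Rightarrow> ('a \<Rightarrow> 'b)
     \<Rightarrow> 'a \<Rightarrow> 'b" where
  "tension_field M g N h F p = metric_trace M g p (second_derivative M g N h F p)"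

definition harmonic_map ::
  "'a::euclidean_space set \<Rightarrow> 'a metric \<Rightarrow> 'b::euclidean_space set \<Rightarrow> 'b metric \<Rightarrow> ('a \<Rightarrow> 'b) \<Rightarrow> bool" where
  "harmonic_map M g N h F \<longleftrightarrow> (\<forall>p\<in>M. tension_field M g N h F p = 0)"

definition gradient ::
  "'a::euclidean_space set \<Rightarrow> 'a metric \<Rightarrow> ('a \<Rightarrow> real) \<Rightarrow> 'a \<Rightarrow> 'a" where
  "gradient M g u p =
     (THE w. w \<in> tangent_space M p \<and> (\<forall>v\<in>tangent_space M p. g p w v = mderiv M u p v))"

definition hessian ::
  "'a::euclidean_space set \<Rightarrow> 'a metric \<Rightarrow> ('a \<Rightarrow> real) \<Rightarrow> 'a \<Rightarrow> 'a \<Rightarrow> 'a" where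
  "hessian M g u p v = levi_civita M g p v (gradient M g u)"

definition lie_derivative_metric ::
  "'a::euclidean_space set \<Rightarrow> 'a metric \<Rightarrow> ('a \<Rightarrow> 'a) \<Rightarrow> ('a \<Rightarrow> 'a) \<Rightarrow> ('a \<Rightarrow> 'a) \<Rightarrow> 'a \<Rightarrow> real" where
  "lie_derivative_metric M g V X Y p =
     mderiv M (\<lambda>q. g q (X q) (Y q)) p (V p)
     - g p (lie_bracket M V X p) (Y p) - g p (X p) (lie_bracket M V Y p)"

text \<open>
  \<open>(1,1)\<close>-tensor fields. They are extended by \<open>0\<close> outside the tangent bundle, so that equal
  tensors are equal functions.
\<close>

definition tensor11 :: "'a::euclidean_space set \<Rightarrow> ('a \<Rightarrow> 'a \<Rightarrow> 'a) \<Rightarrow> bool" where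
  "tensor11 M b \<longleftrightarrow>
     (\<forall>p\<in>M. \<forall>v\<in>tangent_space M p. \<forall>w\<in>tangent_space M p. \<forall>c d.
        b p (c *\<^sub>R v + d *\<^sub>R w) = c *\<^sub>R b p v + d *\<^sub>R b p w) \<and>
     (\<forall>X. vector_field M X \<longrightarrow> vector_field M (\<lambda>p. b p (X p))) \<and>
     (\<forall>p v. \<not> (p \<in> M \<and> v \<in> tangent_space M p) \<longrightarrow> b p v = 0)"

definition self_adjoint :: "'a::euclidean_space set \<Rightarrow> 'a metric \<Rightarrow> ('a \<Rightarrow> 'a \<Rightarrow> 'a) \<Rightarrow> bool" where
  "self_adjoint M g b \<longleftrightarrow>
     (\<forall>p\<in>M. \<forall>v\<in>tangent_space M p. \<forall>w\<in>tangent_space M p. g p (b p v) w = g p v (b p w))"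

text \<open>The self-adjoint tensor \<open>b\<close> with \<open>L\<^sub>V g = g(b \<cdot>, \<cdot>)\<close>.\<close>

definition lie_derivative_tensor ::
  "'a::euclidean_space set \<Rightarrow> 'a metric \<Rightarrow> ('a \<Rightarrow> 'a) \<Rightarrow> 'a \<Rightarrow> 'a \<Rightarrow> 'a" where
  "lie_derivative_tensor M g V =
     (THE b. tensor11 M b \<and> self_adjoint M g b \<and>
        (\<forall>X Y. vector_field M X \<longrightarrow> vector_field M Y \<longrightarrow>
           (\<forall>p\<in>M. lie_derivative_metric M g V X Y p = g p (b p (X p)) (Y p))))"

definition ext_cov_deriv ::
  "'a::euclidean_space set \<Rightarrow> 'a metric \<Rightarrow> ('a \<Rightarrow> 'a \<Rightarrow> 'a) \<Rightarrow> ('a \<Rightarrow> 'a) \<Rightarrow> ('a \<Rightarrow> 'a) \<Rightarrow> 'a \<Rightarrow> 'a" where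
  "ext_cov_deriv M g b X Y p =
     levi_civita M g p (X p) (\<lambda>q. b q (Y q)) - levi_civita M g p (Y p) (\<lambda>q. b q (X q))
     - b p (lie_bracket M X Y p)"


section \<open>The hyperbolic plane in Minkowski space\<close>

text \<open>The components \<open>x $ 1\<close>, \<open>x $ 2\<close>, \<open>x $ 3\<close> are the coordinates \<open>x\<^sub>0\<close> (timelike), \<open>x\<^sub>1\<close>, \<open>x\<^sub>2\<close>.\<close>

definition mink :: "real^3 \<Rightarrow> real^3 \<Rightarrow> real" where
  "mink x y = - (x $ 1 * y $ 1) + x $ 2 * y $ 2 + x $ 3 * y $ 3"

definition hyp :: "(real^3) set" where
  "hyp = {x. mink x x = -1 \<and> x $ 1 > 0}"

definition hyp_metric :: "(real^3) metric" where
  "hyp_metric p v w = mink v w"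

definition mcross :: "real^3 \<Rightarrow> real^3 \<Rightarrow> real^3"  (infixl "\<boxtimes>" 70) where
  "x \<boxtimes> y = (THE w. \<forall>v. mink w v = det (vector [x, y, v] :: real^3^3))"

definition hyp_J :: "real^3 \<Rightarrow> real^3 \<Rightarrow> real^3" where
  "hyp_J p v = p \<boxtimes> v"

abbreviation hyp_nabla :: "real^3 \<Rightarrow> real^3 \<Rightarrow> (real^3 \<Rightarrow> real^3) \<Rightarrow> real^3" where
  "hyp_nabla \<equiv> levi_civita hyp hyp_metric"


section \<open>Surfaces in Half-Pipe space\<close>

definition klein :: "real^3 \<Rightarrow> real^2" where
  "klein x = vector [x $ 2 / x $ 1, x $ 3 / x $ 1]"

abbreviation unit_disk :: "(real^2) set" where
  "unit_disk \<equiv> ball 0 1"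

definition klein_function :: "(real^3 \<Rightarrow> real) \<Rightarrow> real^2 \<Rightarrow> real" where
  "klein_function u \<eta> = sqrt (1 - (norm \<eta>)\<^sup>2) * u (inv_into hyp klein \<eta>)"

text \<open>The graph of \<open>u\<close> seen in the Klein model.\<close>

definition klein_graph :: "(real^3 \<Rightarrow> real) \<Rightarrow> ((real^2) \<times> real) set" where
  "klein_graph u = {(\<eta>, klein_function u \<eta>) | \<eta>. \<eta> \<in> unit_disk}"

definition plane :: "real^3 \<Rightarrow> ((real^2) \<times> real) set" where
  "plane \<sigma> = {(\<eta>, t). \<eta> \<in> unit_disk \<and> mink (vector [1, \<eta> $ 1, \<eta> $ 2]) \<sigma> = t}"

definition tangent_plane :: "((real^2) \<times> real) set \<Rightarrow> (real^2) \<times> real \<Rightarrow> ((real^2) \<times> real) set" where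
  "tangent_plane S q = {q + w | w. w \<in> tangent_space S q} \<inter> (unit_disk \<times> UNIV)"

definition associated_field :: "(real^3 \<Rightarrow> real) \<Rightarrow> real^3 \<Rightarrow> real^3" where
  "associated_field u p =
     p \<boxtimes> (THE \<sigma>. plane \<sigma> = tangent_plane (klein_graph u) (klein p, klein_function u (klein p)))"

definition shape_operator :: "(real^3 \<Rightarrow> real) \<Rightarrow> real^3 \<Rightarrow> real^3 \<Rightarrow> real^3" where
  "shape_operator u p v = hessian hyp hyp_metric u p v - u p *\<^sub>R v"

definition mean_surface :: "(real^3 \<Rightarrow> real) \<Rightarrow> bool" where
  "mean_surface u \<longleftrightarrow> (\<forall>p\<in>hyp. endo_trace hyp hyp_metric p (shape_operator u p) = 0)"


section \<open>Geometry of the tangent bundle of the hyperbolic plane\<close>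

definition hyp_TB :: "((real^3) \<times> (real^3)) set" where
  "hyp_TB = {(x, v). x \<in> hyp \<and> v \<in> tangent_space hyp x}"

definition vertical_lift :: "(real^3) \<times> (real^3) \<Rightarrow> real^3 \<Rightarrow> (real^3) \<times> (real^3)" where
  "vertical_lift q w = (0, w)"

text \<open>
  The horizontal lift of \<open>w\<close> at \<open>(x, v)\<close> is the image of \<open>w\<close> under the differential of a
  section \<open>q \<mapsto> (q, X q)\<close> with \<open>X x = v\<close> that is parallel at \<open>x\<close> in the direction \<open>w\<close>.
\<close>

definition horizontal_lift :: "(real^3) \<times> (real^3) \<Rightarrow> real^3 \<Rightarrow> (real^3) \<times> (real^3)" where
  "horizontal_lift q w =
     (let X = (SOME X. vector_field hyp X \<and> X (fst q) = snd q \<and> hyp_nabla (fst q) w X = 0)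
      in (w, mderiv hyp X (fst q) w))"

text \<open>The pair \<open>(w\<^sub>1, w\<^sub>2)\<close> that the identification of the tangent space of the bundle assigns to \<open>z\<close>.\<close>

definition hv_components :: "(real^3) \<times> (real^3) \<Rightarrow> (real^3) \<times> (real^3) \<Rightarrow> (real^3) \<times> (real^3)" where
  "hv_components q z =
     (THE w. fst w \<in> tangent_space hyp (fst q) \<and> snd w \<in> tangent_space hyp (fst q) \<and>
        z = horizontal_lift q (fst w) + vertical_lift q (snd w))"

definition TB_metric :: "((real^3) \<times> (real^3)) metric" where
  "TB_metric q z z' =
     (let (X1, X2) = hv_components q z; (Y1, Y2) = hv_components q z'
      in hyp_metric (fst q) X1 Y2 + hyp_metric (fst q) X2 Y1)"

definition TB_symplectic :: "(real^3) \<times> (real^3) \<Rightarrow> (real^3) \<times> (real^3) \<Rightarrow> (real^3) \<times> (real^3) \<Rightarrow> real" where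
  "TB_symplectic q z z' =
     (let (X1, X2) = hv_components q z; (Y1, Y2) = hv_components q z'
      in hyp_metric (fst q) (hyp_J (fst q) X1) Y2 - hyp_metric (fst q) X2 (hyp_J (fst q) Y1))"

text \<open>The vector field \<open>V\<close> as a map into the tangent bundle.\<close>

definition section_map :: "(real^3 \<Rightarrow> real^3) \<Rightarrow> real^3 \<Rightarrow> (real^3) \<times> (real^3)" where
  "section_map V p = (p, V p)"

definition lagrangian_field :: "(real^3 \<Rightarrow> real^3) \<Rightarrow> bool" where
  "lagrangian_field V \<longleftrightarrow>
     (\<forall>p\<in>hyp. \<forall>v\<in>tangent_space hyp p. \<forall>w\<in>tangent_space hyp p.
        TB_symplectic (section_map V p)
          (mderiv hyp (section_map V) p v) (mderiv hyp (section_map V) p w) = 0)"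

definition harmonic_lagrangian :: "(real^3 \<Rightarrow> real^3) \<Rightarrow> bool" where
  "harmonic_lagrangian V \<longleftrightarrow>
     harmonic_map hyp hyp_metric hyp_TB TB_metric (section_map V) \<and> lagrangian_field V"

end

theory Submission
  imports Defs
begin

text \<open>
  All three conditions become identities of flat vector calculus once functions and fields on
  the hyperbolic plane are extended to the future cone homogeneously of degree one
  (\<open>homog_ext\<close>). Write \<open>U\<close> and \<open>F\<close> for the extensions of \<open>u\<close> and \<open>V\<close>, \<open>\<langle>\<cdot>, \<cdot>\<rangle>\<close> for the
  Minkowski form, and \<open>grad\<close>, \<open>Box\<close>, \<open>div\<close>, \<open>curl\<close> for the operators it defines. In degree one,
  second derivatives annihilate the position vector, so restricting them to a tangent plane
  of the hyperbolic plane loses nothing.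

  \<^item> The tangent plane to the graph of \<open>u\<close> over \<open>p\<close> is \<open>P\<^sub>\<sigma>\<close> with \<open>\<sigma> = grad U(p)\<close>, and the shape
    operator is the derivative of \<open>grad U\<close>. Hence \<open>V = V\<^sub>S\<close> for a mean surface \<open>S\<close> means
    \<open>F(x) = x \<boxtimes> grad U(x)\<close> with \<open>Box U = 0\<close> (\<open>associated_field_eq\<close>, \<open>mean_surface_iff\<close>).
  \<^item> The metric \<open>\<G>\<close> on the tangent bundle is induced by the constant form
    \<open>\<langle>a, d\<rangle> + \<langle>b, c\<rangle>\<close> of pairs \<open>(a, b)\<close>, \<open>(c, d)\<close>. Its Levi-Civita connection is therefore
    the projected ambient derivative, and the tension field of \<open>V\<close> is the vertical lift of the
    tangential part of \<open>Box F\<close>. The pullback of the symplectic form is \<open>div F\<close> times the area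
    form (\<open>tension_field_section_map\<close>, \<open>TB_symplectic_section_map\<close>).
  \<^item> The tensor \<open>b\<close> is \<open>DF + (DF)\<^sup>*\<close>. Its trace is \<open>2 div F\<close>, and as second derivatives
    commute, \<open>d\<^sup>\<nabla>b\<close> only sees the derivative of the antisymmetric part of \<open>DF\<close>. It vanishes
    iff the derivative of \<open>curl F\<close> is tangent to the hyperbolic plane (\<open>codazzi_iff\<close>).

  The last property, \<open>\<langle>x, D\<^sub>z(curl F)\<rangle> = 0\<close> for all \<open>z\<close>, is the common ground. For \<open>div F = 0\<close> the
  identity \<open>curl curl = grad div - Box\<close> makes it equivalent to the vanishing of the tangential
  part of \<open>Box F\<close>. If \<open>F = x \<boxtimes> grad U\<close> and \<open>Box U = 0\<close>, then \<open>curl F = -2 grad U\<close>, whose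
  derivative is tangent. Conversely no integration is needed to recover \<open>U\<close> from \<open>F\<close>: Euler's
  identity forces \<open>U(x) = \<langle>x, grad U\<rangle> = -\<langle>x, curl F(x)\<rangle> / 2\<close>, and with this definition the
  property gives \<open>grad U = -curl F / 2\<close>, hence \<open>x \<boxtimes> grad U = F\<close> and \<open>Box U = 0\<close>.
\<close>

section \<open>Calculus of smooth functions on open sets\<close>

abbreviation dird :: "('a::euclidean_space \<Rightarrow> 'b::euclidean_space) \<Rightarrow> 'a \<Rightarrow> 'a \<Rightarrow> 'b" where
  "dird f x v \<equiv> frechet_derivative f (at x) v"

lemma dird_eq:
  "(f has_derivative f') (at x) \<Longrightarrow> frechet_derivative f (at x) = f'"
  using frechet_derivative_at by metis

lemma has_derivative_dird:
  "f differentiable (at x) \<Longrightarrow> (f has_derivative (\<lambda>v. dird f x v)) (at x)"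
  by (simp add: frechet_derivative_works)

lemma dird_cong:
  assumes "open U" "x \<in> U" "f differentiable (at x)" "\<And>y. y \<in> U \<Longrightarrow> f y = g y"
  shows "g differentiable (at x)" "frechet_derivative g (at x) = frechet_derivative f (at x)"
proof -
  have "(f has_derivative frechet_derivative f (at x)) (at x)"
    using assms(3) frechet_derivative_works by blast
  then have "(g has_derivative frechet_derivative f (at x)) (at x)"
    by (rule has_derivative_transform_within_open[OF _ assms(1,2,4)])
  then show "g differentiable (at x)" "frechet_derivative g (at x) = frechet_derivative f (at x)"
    by (auto simp: differentiable_def dest: frechet_derivative_at)
qed

lemma Ck_on_cong:
  assumes "open U" "Ck_on k U f" "\<And>y. y \<in> U \<Longrightarrow> f y = g y"
  shows "Ck_on k U g"
  using assms(2,3)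
proof (induction k arbitrary: f g)
  case 0
  then show ?case using continuous_on_cong[of U U f g] by simp
next
  case (Suc k)
  have d: "f differentiable (at x)" if "x \<in> U" for x using Suc.prems that by simp
  have e: "g differentiable (at x) \<and> frechet_derivative g (at x) = frechet_derivative f (at x)"
    if "x \<in> U" for x
    using dird_cong[OF assms(1) that d[OF that], of g] Suc.prems(2) by blast
  have "Ck_on k U (\<lambda>x. dird g x v)" for v
    by (rule Suc.IH[of "\<lambda>x. dird f x v"]) (use Suc.prems(1) e in auto)
  then show ?case using e by simp
qed

lemma Ck_on_subset: "Ck_on k U f \<Longrightarrow> V \<subseteq> U \<Longrightarrow> Ck_on k V f"
proof (induction k arbitrary: f)
  case 0
  then show ?case unfolding Ck_on.simps by (rule continuous_on_subset)
next
  case (Suc k)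
  have "Ck_on k V (\<lambda>x. dird f x v)" for v
    by (rule Suc.IH) (use Suc.prems in simp_all)
  then show ?case using Suc.prems by auto
qed

text \<open>
  Smoothness is local; this is what turns local extensions into an extension to the whole cone.
\<close>

lemma Ck_on_local:
  assumes "\<And>x. x \<in> U \<Longrightarrow> \<exists>V. open V \<and> x \<in> V \<and> Ck_on k V f"
  shows "Ck_on k U f"
  using assms
proof (induction k arbitrary: f)
  case 0
  show ?case unfolding Ck_on.simps
  proof (rule continuous_at_imp_continuous_on, rule ballI)
    fix x assume "x \<in> U"
    then obtain V where "open V" "x \<in> V" "Ck_on 0 V f" using 0 by blast
    then have "open V" "x \<in> V" "continuous_on V f" by simp_all
    then show "isCont f x" using continuous_on_eq_continuous_at by blast
  qed
next
  case (Suc k)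
  show ?case unfolding Ck_on.simps
  proof (intro conjI ballI allI)
    fix x assume "x \<in> U"
    then obtain V where "x \<in> V" "Ck_on (Suc k) V f" using Suc.prems by blast
    then show "f differentiable (at x)" by simp
  next
    fix v show "Ck_on k U (\<lambda>x. dird f x v)"
    proof (rule Suc.IH)
      fix x assume "x \<in> U"
      then obtain V where "open V" "x \<in> V" "Ck_on (Suc k) V f" using Suc.prems by blast
      then show "\<exists>V. open V \<and> x \<in> V \<and> Ck_on k V (\<lambda>x. dird f x v)" by auto
    qed
  qed
qed

lemma Ck_on_differentiable_continuous: "Ck_on (Suc k) U f \<Longrightarrow> continuous_on U f"
  by (simp add: continuous_at_imp_continuous_on differentiable_imp_continuous_within)

lemma Ck_on_Suc_imp: "Ck_on (Suc k) U f \<Longrightarrow> Ck_on k U f"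
proof (induction k arbitrary: f)
  case 0
  show ?case unfolding Ck_on.simps(1) by (rule Ck_on_differentiable_continuous[OF 0])
next
  case (Suc k)
  have d: "Ck_on k U (\<lambda>x. dird f x v)" for v
  proof (rule Suc.IH)
    show "Ck_on (Suc k) U (\<lambda>x. dird f x v)"
      using Suc.prems unfolding Ck_on.simps(2)[of "Suc k"] by blast
  qed
  have "\<forall>x\<in>U. f differentiable (at x)"
    using Suc.prems unfolding Ck_on.simps(2)[of "Suc k"] by blast
  with d show ?case unfolding Ck_on.simps(2) by blast
qed

lemma Ck_on_linear_comp:
  assumes "bounded_linear L" "open U" "Ck_on k U f"
  shows "Ck_on k U (\<lambda>x. L (f x))"
  using assms(3)
proof (induction k arbitrary: f)
  case 0
  then show ?case using bounded_linear.continuous_on[OF assms(1)] by simp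
next
  case (Suc k)
  have d: "((\<lambda>x. L (f x)) has_derivative (\<lambda>v. L (dird f x v))) (at x)" if "x \<in> U" for x
    by (rule bounded_linear.has_derivative[OF assms(1)])
      (use Suc.prems that in \<open>auto intro!: has_derivative_dird\<close>)
  have "Ck_on k U (\<lambda>x. dird (\<lambda>x. L (f x)) x v)" for v
    by (rule Ck_on_cong[OF assms(2) Suc.IH[of "\<lambda>x. dird f x v"]])
      (use Suc.prems in \<open>auto simp: dird_eq[OF d]\<close>)
  then show ?case using d by (auto simp: differentiable_def)
qed

lemma Ck_on_const: "Ck_on k U (\<lambda>x. c)"
  by (induction k arbitrary: c) (auto simp: frechet_derivative_const)

lemma Ck_on_id: "Ck_on k U (\<lambda>x. x)"
  by (cases k) (auto simp: Ck_on_const continuous_on_id)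

lemma Ck_on_add:
  assumes "open U" "Ck_on k U f" "Ck_on k U g"
  shows "Ck_on k U (\<lambda>x. f x + g x)"
  using assms(2,3)
proof (induction k arbitrary: f g)
  case 0
  then show ?case by (simp add: continuous_on_add)
next
  case (Suc k)
  have d: "((\<lambda>x. f x + g x) has_derivative (\<lambda>v. dird f x v + dird g x v)) (at x)" if "x \<in> U" for x
    by (rule has_derivative_add) (use Suc.prems that in \<open>auto intro!: has_derivative_dird\<close>)
  have "Ck_on k U (\<lambda>x. dird (\<lambda>x. f x + g x) x v)" for v
    by (rule Ck_on_cong[OF assms(1) Suc.IH[of "\<lambda>x. dird f x v" "\<lambda>x. dird g x v"]])
      (use Suc.prems in \<open>auto simp: dird_eq[OF d]\<close>)
  then show ?case using d by (auto simp: differentiable_def)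
qed

lemma Ck_on_bilinear:
  assumes "bounded_bilinear b" "open U" "Ck_on k U f" "Ck_on k U g"
  shows "Ck_on k U (\<lambda>x. b (f x) (g x))"
  using assms(3,4)
proof (induction k arbitrary: f g)
  case 0
  then show ?case using bounded_bilinear.continuous_on[OF assms(1)] by auto
next
  case (Suc k)
  have d: "((\<lambda>x. b (f x) (g x)) has_derivative (\<lambda>v. b (f x) (dird g x v) + b (dird f x v) (g x))) (at x)"
    if "x \<in> U" for x
    by (rule bounded_bilinear.FDERIV[OF assms(1)]) (use Suc.prems that in \<open>auto intro!: has_derivative_dird\<close>)
  have "Ck_on k U (\<lambda>x. dird (\<lambda>x. b (f x) (g x)) x v)" for v
    by (rule Ck_on_cong[OF assms(2) Ck_on_add[OF assms(2) Suc.IH Suc.IH,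
          of f "\<lambda>x. dird g x v" "\<lambda>x. dird f x v" g]])
      (use Suc.prems Ck_on_Suc_imp[OF Suc.prems(1)] Ck_on_Suc_imp[OF Suc.prems(2)] in \<open>auto simp: dird_eq[OF d]\<close>)
  then show ?case using d by (auto simp: differentiable_def)
qed

lemma Ck_on_sum:
  assumes "open U" "\<And>i. i \<in> I \<Longrightarrow> Ck_on k U (f i)"
  shows "Ck_on k U (\<lambda>x. \<Sum>i\<in>I. f i x)"
  using assms(2)
  by (induction I rule: infinite_finite_induct) (auto intro: Ck_on_const Ck_on_add assms(1))

lemma linear_sum_Basis:
  fixes L :: "'a::euclidean_space \<Rightarrow> 'b::real_vector"
  assumes "linear L"
  shows "L v = (\<Sum>i\<in>Basis. (v \<bullet> i) *\<^sub>R L i)"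
proof -
  have "L v = L (\<Sum>i\<in>Basis. (v \<bullet> i) *\<^sub>R i)" by (simp add: euclidean_representation)
  also have "\<dots> = (\<Sum>i\<in>Basis. (v \<bullet> i) *\<^sub>R L i)"
    using assms by (simp add: linear_sum linear_scale)
  finally show ?thesis .
qed

text \<open>
  A directional derivative of fixed order is \<open>C\<^sup>k\<close> for fixed directions only; a direction that
  varies is expanded in the standard basis. This is what makes the chain rule iterate.
\<close>

lemma Ck_on_compose:
  assumes "open U" "open W" "\<And>x. x \<in> U \<Longrightarrow> f x \<in> W" "Ck_on k U f" "Ck_on k W g"
  shows "Ck_on k U (\<lambda>x. g (f x))"
  using assms(4,5)
proof (induction k arbitrary: g)
  case 0
  have "f ` U \<subseteq> W" using assms(3) by blast
  then show ?case using continuous_on_compose2[of W g U f] 0 by simp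
next
  case (Suc k)
  have df: "f differentiable (at x)" if "x \<in> U" for x using Suc.prems that by simp
  have dg: "g differentiable (at (f x))" if "x \<in> U" for x using Suc.prems assms(3) that by simp
  have d: "((\<lambda>x. g (f x)) has_derivative (\<lambda>v. dird g (f x) (dird f x v))) (at x)" if "x \<in> U" for x
    using diff_chain_at[OF has_derivative_dird[OF df[OF that]] has_derivative_dird[OF dg[OF that]]]
    by (simp add: comp_def)
  have eq: "dird (\<lambda>x. g (f x)) x v = (\<Sum>i\<in>Basis. (dird f x v \<bullet> i) *\<^sub>R dird g (f x) i)"
    if "x \<in> U" for x v
    unfolding dird_eq[OF d[OF that]]
    by (rule linear_sum_Basis[OF linear_frechet_derivative[OF dg[OF that]]])
  have "Ck_on k U (\<lambda>x. dird (\<lambda>x. g (f x)) x v)" for v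
  proof (rule Ck_on_cong[OF assms(1)])
    show "Ck_on k U (\<lambda>x. \<Sum>i\<in>Basis. (dird f x v \<bullet> i) *\<^sub>R dird g (f x) i)"
      using Suc.prems Ck_on_Suc_imp[OF Suc.prems(1)]
      by (intro Ck_on_sum Ck_on_bilinear[OF bounded_bilinear_scaleR] assms(1)
          Ck_on_linear_comp[OF bounded_linear_inner_left] Suc.IH) auto
  qed (simp add: eq)
  then show ?case using d by (auto simp: differentiable_def)
qed

lemma Ck_on_powr: "Ck_on k {0<..} (\<lambda>x::real. c * x powr a)"
proof (induction k arbitrary: a c)
  case 0
  show ?case by (auto intro!: continuous_intros)
next
  case (Suc k)
  have d: "((\<lambda>x. c * x powr a) has_derivative (\<lambda>v. v * (c * (a * x powr (a - 1))))) (at x)" if "x > 0" for x :: real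
    using that by (auto intro!: derivative_eq_intros simp: has_field_derivative_def[symmetric] powr_diff field_simps)
  have "Ck_on k {0<..} (\<lambda>x. dird (\<lambda>x. c * x powr a) x v)" for v
    by (rule Ck_on_cong[OF open_greaterThan Suc.IH[of "v * c * a" "a - 1"]])
      (auto simp: dird_eq[OF d] mult_ac)
  then show ?case using d by (auto simp: differentiable_def)
qed

lemma smooth_on_cong:
  "open U \<Longrightarrow> smooth_on U f \<Longrightarrow> (\<And>y. y \<in> U \<Longrightarrow> f y = g y) \<Longrightarrow> smooth_on U g"
  unfolding smooth_on_def by (blast intro: Ck_on_cong)

lemma smooth_on_subset: "smooth_on U f \<Longrightarrow> V \<subseteq> U \<Longrightarrow> smooth_on V f"
  unfolding smooth_on_def by (blast intro: Ck_on_subset)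

lemma smooth_on_local:
  assumes "\<And>x. x \<in> U \<Longrightarrow> \<exists>V. open V \<and> x \<in> V \<and> smooth_on V f"
  shows "smooth_on U f"
  unfolding smooth_on_def
proof (intro allI Ck_on_local)
  fix k x assume "x \<in> U"
  then show "\<exists>V. open V \<and> x \<in> V \<and> Ck_on k V f" using assms unfolding smooth_on_def by blast
qed

lemma smooth_on_const: "smooth_on U (\<lambda>x. c)"
  unfolding smooth_on_def by (simp add: Ck_on_const)

lemma smooth_on_id: "smooth_on U (\<lambda>x. x)"
  unfolding smooth_on_def by (simp add: Ck_on_id)

lemma smooth_on_linear_comp:
  "bounded_linear L \<Longrightarrow> open U \<Longrightarrow> smooth_on U f \<Longrightarrow> smooth_on U (\<lambda>x. L (f x))"
  unfolding smooth_on_def by (simp add: Ck_on_linear_comp)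

lemma smooth_on_add:
  "open U \<Longrightarrow> smooth_on U f \<Longrightarrow> smooth_on U g \<Longrightarrow> smooth_on U (\<lambda>x. f x + g x)"
  unfolding smooth_on_def by (simp add: Ck_on_add)

lemma smooth_on_sum:
  "open U \<Longrightarrow> (\<And>i. i \<in> I \<Longrightarrow> smooth_on U (f i)) \<Longrightarrow> smooth_on U (\<lambda>x. \<Sum>i\<in>I. f i x)"
  unfolding smooth_on_def by (simp add: Ck_on_sum)

lemma smooth_on_bilinear:
  "bounded_bilinear b \<Longrightarrow> open U \<Longrightarrow> smooth_on U f \<Longrightarrow> smooth_on U g \<Longrightarrow> smooth_on U (\<lambda>x. b (f x) (g x))"
  unfolding smooth_on_def by (simp add: Ck_on_bilinear)

lemma smooth_on_compose:
  assumes "open U" "open W" "\<And>x. x \<in> U \<Longrightarrow> f x \<in> W" "smooth_on U f" "smooth_on W g"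
  shows "smooth_on U (\<lambda>x. g (f x))"
  using Ck_on_compose[OF assms(1,2), of f _ g] assms(3,4,5) unfolding smooth_on_def by blast

lemma smooth_on_dird: "smooth_on U f \<Longrightarrow> smooth_on U (\<lambda>x. dird f x v)"
  unfolding smooth_on_def by (metis Ck_on.simps(2))

lemma smooth_on_differentiable: "smooth_on U f \<Longrightarrow> x \<in> U \<Longrightarrow> f differentiable (at x)"
  unfolding smooth_on_def by (metis Ck_on.simps(2))

lemma smooth_on_has_derivative:
  "smooth_on U f \<Longrightarrow> x \<in> U \<Longrightarrow> (f has_derivative (\<lambda>v. dird f x v)) (at x)"
  using smooth_on_differentiable frechet_derivative_works by blast

lemma smooth_on_continuous: "smooth_on U f \<Longrightarrow> continuous_on U f"
  unfolding smooth_on_def by (metis Ck_on.simps(1))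

lemma smooth_on_dird_field:
  assumes "open U" "smooth_on U f" "smooth_on U X"
  shows "smooth_on U (\<lambda>x. dird f x (X x))"
proof (rule smooth_on_cong[OF assms(1)])
  show "smooth_on U (\<lambda>x. \<Sum>i\<in>Basis. (X x \<bullet> i) *\<^sub>R dird f x i)"
    by (intro smooth_on_sum smooth_on_bilinear[OF bounded_bilinear_scaleR] assms(1)
          smooth_on_linear_comp[OF bounded_linear_inner_left] smooth_on_dird assms)
qed (rule linear_sum_Basis[OF linear_frechet_derivative[OF smooth_on_differentiable[OF assms(2)]], symmetric])

lemma smooth_on_powr: "smooth_on {0<..} (\<lambda>x::real. x powr a)"
  using Ck_on_powr[of _ 1 a] unfolding smooth_on_def by simp

text \<open>
  The second difference is symmetric in \<open>a\<close> and \<open>b\<close>. Applying the mean value theorem first along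
  \<open>a\<close> and then along \<open>b\<close>, or in the other order, evaluates it by the two mixed derivatives at
  nearby points, so by continuity these agree.
\<close>

lemma second_difference_mean_value:
  fixes f :: "'a::euclidean_space \<Rightarrow> real"
  assumes f: "smooth_on U f" and h: "h > 0"
    and seg: "\<And>s t. 0 \<le> s \<Longrightarrow> s \<le> h \<Longrightarrow> 0 \<le> t \<Longrightarrow> t \<le> h \<Longrightarrow> x + s *\<^sub>R a + t *\<^sub>R b \<in> U"
  shows "\<exists>s t. 0 < s \<and> s < h \<and> 0 < t \<and> t < h \<and>
    f (x + h *\<^sub>R a + h *\<^sub>R b) - f (x + h *\<^sub>R a) - f (x + h *\<^sub>R b) + f x
      = h * h * dird (\<lambda>y. dird f y a) (x + s *\<^sub>R a + t *\<^sub>R b) b"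
proof -
  let ?g = "\<lambda>s. f (x + s *\<^sub>R a + h *\<^sub>R b) - f (x + s *\<^sub>R a)"
  have chain: "((\<lambda>s. F (c + s *\<^sub>R w)) has_real_derivative dird F (c + s *\<^sub>R w) w) (at s)"
    if "smooth_on U F" "c + s *\<^sub>R w \<in> U" for F :: "'a \<Rightarrow> real" and c w s
  proof -
    have "((\<lambda>s. c + s *\<^sub>R w) has_derivative (\<lambda>t. t *\<^sub>R w)) (at s)"
      by (auto intro!: derivative_eq_intros)
    from diff_chain_at[OF this smooth_on_has_derivative[OF that]]
    have "((\<lambda>s. F (c + s *\<^sub>R w)) has_derivative (\<lambda>t. dird F (c + s *\<^sub>R w) (t *\<^sub>R w))) (at s)"
      by (simp add: comp_def)
    moreover have "(\<lambda>t. dird F (c + s *\<^sub>R w) (t *\<^sub>R w)) = (*) (dird F (c + s *\<^sub>R w) w)"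
      by (rule ext) (simp add: linear_scale[OF linear_frechet_derivative[OF smooth_on_differentiable[OF that]]])
    ultimately show ?thesis by (simp add: has_field_derivative_def)
  qed
  have d1: "(?g has_real_derivative (dird f (x + s *\<^sub>R a + h *\<^sub>R b) a - dird f (x + s *\<^sub>R a) a)) (at s)"
    if "0 \<le> s" "s \<le> h" for s
  proof (rule DERIV_diff)
    show "((\<lambda>s. f (x + s *\<^sub>R a)) has_real_derivative dird f (x + s *\<^sub>R a) a) (at s)"
      using chain[OF f, of x s a] seg[of s 0] that h by simp
    have comm: "x + h *\<^sub>R b + t *\<^sub>R a = x + t *\<^sub>R a + h *\<^sub>R b" for t by simp
    show "((\<lambda>s. f (x + s *\<^sub>R a + h *\<^sub>R b)) has_real_derivative
        dird f (x + s *\<^sub>R a + h *\<^sub>R b) a) (at s)"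
      by (rule chain[OF f, of "x + h *\<^sub>R b" s a, unfolded comm]) (use seg[of s h] that h in simp)
  qed
  obtain s where s: "0 < s" "s < h" and e1: "?g h - ?g 0 = h * (dird f (x + s *\<^sub>R a + h *\<^sub>R b) a - dird f (x + s *\<^sub>R a) a)"
    using MVT2[OF h d1] by auto
  let ?k = "\<lambda>t. dird f (x + s *\<^sub>R a + t *\<^sub>R b) a"
  have d2: "(?k has_real_derivative dird (\<lambda>y. dird f y a) (x + s *\<^sub>R a + t *\<^sub>R b) b) (at t)"
    if "0 \<le> t" "t \<le> h" for t
    using seg[of s t] that s chain[OF smooth_on_dird[OF f, of a], of "x + s *\<^sub>R a" t b] by simp
  obtain t where t: "0 < t" "t < h" and "?k h - ?k 0 = h * dird (\<lambda>y. dird f y a) (x + s *\<^sub>R a + t *\<^sub>R b) b"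
    using MVT2[OF h d2] by auto
  with e1 s show ?thesis by (intro exI[of _ s] exI[of _ t]) simp
qed

lemma dird_commute:
  fixes f :: "'a::euclidean_space \<Rightarrow> real"
  assumes U: "open U" "x \<in> U" and f: "smooth_on U f"
  shows "dird (\<lambda>y. dird f y a) x b = dird (\<lambda>y. dird f y b) x a"
proof (rule ccontr)
  let ?F = "\<lambda>a b z. dird (\<lambda>y. dird f y a) z b"
  assume ne: "?F a b x \<noteq> ?F b a x"
  define e where "e = \<bar>?F a b x - ?F b a x\<bar> / 2"
  have e: "e > 0" using ne by (simp add: e_def)
  have "isCont (?F c d) x" for c d
    using smooth_on_continuous[OF smooth_on_dird[OF smooth_on_dird[OF f]]] U
    by (simp add: continuous_on_eq_continuous_at)
  then have "\<exists>\<delta>>0. \<forall>z. dist z x < \<delta> \<longrightarrow> dist (?F c d z) (?F c d x) < e" for c d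
    using e by (simp add: continuous_at_eps_delta)
  from this[of a b] this[of b a] obtain r1 r2 where r: "r1 > 0" "r2 > 0"
    "\<And>z. dist z x < r1 \<Longrightarrow> dist (?F a b z) (?F a b x) < e"
    "\<And>z. dist z x < r2 \<Longrightarrow> dist (?F b a z) (?F b a x) < e" by blast
  obtain r0 where r0: "r0 > 0" "ball x r0 \<subseteq> U" using U openE by blast
  define R where "R = min r0 (min r1 r2)"
  define h where "h = R / (norm a + norm b + 1)"
  have R: "R > 0" using r r0 by (simp add: R_def)
  have pos: "norm a + norm b + 1 > 0" by (smt (verit) norm_ge_zero)
  have h: "h > 0" using R pos by (simp add: h_def)
  have near: "dist (x + s *\<^sub>R a + t *\<^sub>R b) x < R" if "0 \<le> s" "s \<le> h" "0 \<le> t" "t \<le> h" for s t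
  proof -
    have "dist (x + s *\<^sub>R a + t *\<^sub>R b) x \<le> s * norm a + t * norm b"
      using that by (simp add: dist_norm norm_triangle_le add.assoc)
    also have "\<dots> \<le> h * norm a + h * norm b"
      using that by (intro add_mono mult_right_mono) auto
    also have "\<dots> < h * (norm a + norm b + 1)" using h by (simp add: algebra_simps)
    also have "\<dots> = R" using pos by (simp add: h_def)
    finally show ?thesis .
  qed
  then have inU: "x + s *\<^sub>R a + t *\<^sub>R b \<in> U" if "0 \<le> s" "s \<le> h" "0 \<le> t" "t \<le> h" for s t
    using that r0 by (metis R_def dist_commute mem_ball min_less_iff_conj subset_eq)
  have inU': "x + s *\<^sub>R b + t *\<^sub>R a \<in> U" if "0 \<le> s" "s \<le> h" "0 \<le> t" "t \<le> h" for s t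
    using inU[of t s] that by (simp add: algebra_simps)
  obtain s t where st: "0 < s" "s < h" "0 < t" "t < h"
    "f (x + h *\<^sub>R a + h *\<^sub>R b) - f (x + h *\<^sub>R a) - f (x + h *\<^sub>R b) + f x = h * h * ?F a b (x + s *\<^sub>R a + t *\<^sub>R b)"
    using second_difference_mean_value[OF f h inU] by blast
  obtain s' t' where st': "0 < s'" "s' < h" "0 < t'" "t' < h"
    "f (x + h *\<^sub>R b + h *\<^sub>R a) - f (x + h *\<^sub>R b) - f (x + h *\<^sub>R a) + f x = h * h * ?F b a (x + s' *\<^sub>R b + t' *\<^sub>R a)"
    using second_difference_mean_value[OF f h inU'] by blast
  have "h * h * ?F a b (x + s *\<^sub>R a + t *\<^sub>R b) = h * h * ?F b a (x + t' *\<^sub>R a + s' *\<^sub>R b)"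
    using st(5) st'(5) by (simp add: algebra_simps)
  then have "?F a b (x + s *\<^sub>R a + t *\<^sub>R b) = ?F b a (x + t' *\<^sub>R a + s' *\<^sub>R b)" using h by simp
  moreover have "dist (?F a b (x + s *\<^sub>R a + t *\<^sub>R b)) (?F a b x) < e"
    using near[of s t] st r(3) by (simp add: R_def)
  moreover have "dist (?F b a (x + t' *\<^sub>R a + s' *\<^sub>R b)) (?F b a x) < e"
    using near[of t' s'] st' r(4) by (simp add: R_def)
  ultimately have "dist (?F a b x) (?F b a x) < e + e"
    using dist_triangle_lt[OF add_strict_mono, of "?F a b x" _ e "?F b a x" e]
    by (metis dist_commute)
  then show False by (simp add: e_def dist_real_def)
qed


section \<open>Smooth maps and differentials on a subset of a Euclidean space\<close>

lemma tangent_spaceI: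
  fixes \<gamma> :: "real \<Rightarrow> 'a::euclidean_space"
  assumes "\<And>t. \<gamma> t \<in> M" "\<gamma> 0 = p" "(\<gamma> has_vector_derivative v) (at 0)"
  shows "v \<in> tangent_space M p"
  unfolding tangent_space_def using assms by (intro CollectI exI[of _ \<gamma>] conjI allI)

text \<open>
  The differential at a point is pinned down on tangent vectors by differentiating along
  curves, so the rules that compute it are stated for tangent vectors.
\<close>

lemma has_derivative_tangent_unique:
  assumes "(f has_derivative f') (at p within M)" "(f has_derivative f'') (at p within M)"
    and "v \<in> tangent_space M p"
  shows "f' v = f'' v"
proof -
  obtain \<gamma> :: "real \<Rightarrow> 'a" where \<gamma>: "\<And>t. \<gamma> t \<in> M" "\<gamma> 0 = p" "(\<gamma> has_vector_derivative v) (at 0)"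
    using assms(3) unfolding tangent_space_def by blast
  have *: "((\<lambda>t. f (\<gamma> t)) has_vector_derivative g v) (at 0)"
    if g: "(f has_derivative g) (at p within M)" for g
  proof -
    have "range \<gamma> \<subseteq> M" using \<gamma>(1) by blast
    then have "(f has_derivative g) (at (\<gamma> 0) within range \<gamma>)"
      using g \<gamma>(2) has_derivative_subset by blast
    from diff_chain_within[OF \<gamma>(3)[unfolded has_vector_derivative_def] this]
    have "((\<lambda>t. f (\<gamma> t)) has_derivative (\<lambda>t. g (t *\<^sub>R v))) (at 0)" by (simp add: comp_def)
    then show ?thesis
      by (simp add: has_vector_derivative_def linear_scale[OF has_derivative_linear[OF g]])
  qed
  show ?thesis using vector_derivative_unique_at[OF *[OF assms(1)] *[OF assms(2)]] .
qed

lemma mderiv_eq: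
  assumes "(f has_derivative f') (at p within M)" "v \<in> tangent_space M p"
  shows "mderiv M f p v = f' v"
proof -
  have "(f has_derivative frechet_derivative f (at p within M)) (at p within M)"
    using assms(1) frechet_derivative_works differentiable_def by blast
  from has_derivative_tangent_unique[OF this assms] show ?thesis by (simp add: mderiv_def)
qed

lemma mderiv_cong:
  assumes "p \<in> M" "\<And>x. x \<in> M \<Longrightarrow> f x = g x"
  shows "mderiv M f p v = mderiv M g p v"
proof -
  have "(f has_derivative f') (at p within M) \<longleftrightarrow> (g has_derivative f') (at p within M)" for f'
    using assms by (metis has_derivative_transform)
  then show ?thesis by (simp add: mderiv_def frechet_derivative_def)
qed

lemma smooth_mapI:
  "open U \<Longrightarrow> M \<subseteq> U \<Longrightarrow> smooth_on U F \<Longrightarrow> (\<And>x. x \<in> M \<Longrightarrow> F x = f x) \<Longrightarrow> smooth_map M f"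
  unfolding smooth_map_def by blast

lemma smooth_mapE:
  assumes "smooth_map M f" "p \<in> M"
  obtains U F where "open U" "p \<in> U" "smooth_on U F" "\<And>x. x \<in> M \<inter> U \<Longrightarrow> F x = f x"
  using assms unfolding smooth_map_def by metis

lemma smooth_map_cong: "smooth_map M f \<Longrightarrow> (\<And>x. x \<in> M \<Longrightarrow> f x = g x) \<Longrightarrow> smooth_map M g"
  unfolding smooth_map_def by (metis IntD1)

lemma local_extension_has_derivative:
  assumes "open U" "p \<in> U" "p \<in> M" "smooth_on U F" "\<And>x. x \<in> M \<inter> U \<Longrightarrow> F x = f x"
  shows "(f has_derivative (\<lambda>v. dird F p v)) (at p within M)"
proof -
  have "(F has_derivative (\<lambda>v. dird F p v)) (at p within M)"
    using smooth_on_has_derivative[OF assms(4,2)] has_derivative_at_withinI by blast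
  moreover obtain d where "d > 0" "ball p d \<subseteq> U" using assms(1,2) openE by blast
  ultimately show ?thesis
    using assms(3,5) by (elim has_derivative_transform_within[where d=d]) (auto simp: dist_commute subset_iff)
qed

lemma smooth_map_has_derivative:
  assumes "smooth_map M f" "p \<in> M"
  shows "(f has_derivative mderiv M f p) (at p within M)"
proof -
  obtain U F where "open U" "p \<in> U" "smooth_on U F" "\<And>x. x \<in> M \<inter> U \<Longrightarrow> F x = f x"
    using smooth_mapE[OF assms] by blast
  from local_extension_has_derivative[OF this(1,2) assms(2) this(3,4)]
  have "f differentiable (at p within M)" by (auto simp: differentiable_def)
  then show ?thesis unfolding mderiv_def using frechet_derivative_works by blast
qed

lemma mderiv_linear: "smooth_map M f \<Longrightarrow> p \<in> M \<Longrightarrow> linear (mderiv M f p)"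
  using smooth_map_has_derivative has_derivative_linear by blast

lemma mderiv_local_extension:
  assumes "open U" "p \<in> U" "p \<in> M" "smooth_on U F" "\<And>x. x \<in> M \<inter> U \<Longrightarrow> F x = f x"
    and "v \<in> tangent_space M p"
  shows "mderiv M f p v = dird F p v"
  using mderiv_eq[OF local_extension_has_derivative[OF assms(1-5)] assms(6)] .

lemma smooth_map_const: "smooth_map M (\<lambda>x. c)"
  by (rule smooth_mapI[of UNIV _ "\<lambda>x. c"]) (auto simp: smooth_on_const)

lemma smooth_map_id: "smooth_map M (\<lambda>x. x)"
  by (rule smooth_mapI[of UNIV _ "\<lambda>x. x"]) (auto simp: smooth_on_id)

lemma smooth_map_linear:
  assumes "bounded_linear L" "smooth_map M f"
  shows "smooth_map M (\<lambda>x. L (f x))"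
  unfolding smooth_map_def
proof
  fix p assume "p \<in> M"
  from smooth_mapE[OF assms(2) this] obtain U F where
    "open U" "p \<in> U" "smooth_on U F" "\<And>x. x \<in> M \<inter> U \<Longrightarrow> F x = f x" by blast
  then show "\<exists>U F. open U \<and> p \<in> U \<and> smooth_on U F \<and> (\<forall>x\<in>M \<inter> U. F x = L (f x))"
    by (intro exI[of _ U] exI[of _ "\<lambda>x. L (F x)"]) (auto intro: smooth_on_linear_comp assms)
qed

lemma smooth_map_pair_extension:
  assumes "smooth_map M f" "smooth_map M g" "p \<in> M"
  obtains U F G where "open U" "p \<in> U" "smooth_on U F" "smooth_on U G"
    "\<And>x. x \<in> M \<inter> U \<Longrightarrow> F x = f x" "\<And>x. x \<in> M \<inter> U \<Longrightarrow> G x = g x"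
proof -
  obtain U F where U: "open U" "p \<in> U" "smooth_on U F" "\<And>x. x \<in> M \<inter> U \<Longrightarrow> F x = f x"
    using smooth_mapE[OF assms(1,3)] by blast
  obtain V G where V: "open V" "p \<in> V" "smooth_on V G" "\<And>x. x \<in> M \<inter> V \<Longrightarrow> G x = g x"
    using smooth_mapE[OF assms(2,3)] by blast
  show thesis
    by (rule that[of "U \<inter> V" F G]) (use U V in \<open>auto intro: smooth_on_subset\<close>)
qed

lemma smooth_map_bilinear:
  assumes "bounded_bilinear b" "smooth_map M f" "smooth_map M g"
  shows "smooth_map M (\<lambda>x. b (f x) (g x))"
  unfolding smooth_map_def
proof
  fix p assume "p \<in> M"
  from smooth_map_pair_extension[OF assms(2,3) this] obtain U F G where
    "open U" "p \<in> U" "smooth_on U F" "smooth_on U G"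
    "\<And>x. x \<in> M \<inter> U \<Longrightarrow> F x = f x" "\<And>x. x \<in> M \<inter> U \<Longrightarrow> G x = g x" by blast
  then show "\<exists>U F. open U \<and> p \<in> U \<and> smooth_on U F \<and> (\<forall>x\<in>M \<inter> U. F x = b (f x) (g x))"
    by (intro exI[of _ U] exI[of _ "\<lambda>x. b (F x) (G x)"]) (auto intro: smooth_on_bilinear assms)
qed

lemma smooth_map_add:
  assumes "smooth_map M f" "smooth_map M g"
  shows "smooth_map M (\<lambda>x. f x + g x)"
  unfolding smooth_map_def
proof
  fix p assume "p \<in> M"
  from smooth_map_pair_extension[OF assms this] obtain U F G where
    "open U" "p \<in> U" "smooth_on U F" "smooth_on U G"
    "\<And>x. x \<in> M \<inter> U \<Longrightarrow> F x = f x" "\<And>x. x \<in> M \<inter> U \<Longrightarrow> G x = g x" by blast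
  then show "\<exists>U F. open U \<and> p \<in> U \<and> smooth_on U F \<and> (\<forall>x\<in>M \<inter> U. F x = f x + g x)"
    by (intro exI[of _ U] exI[of _ "\<lambda>x. F x + G x"]) (auto intro: smooth_on_add)
qed

lemma smooth_map_sum:
  assumes "\<And>i. i \<in> I \<Longrightarrow> smooth_map M (f i)"
  shows "smooth_map M (\<lambda>x. \<Sum>i\<in>I. f i x)"
  using assms
  by (induction I rule: infinite_finite_induct) (auto intro: smooth_map_const smooth_map_add)

lemma smooth_map_scaleR:
  "smooth_map M f \<Longrightarrow> smooth_map M g \<Longrightarrow> smooth_map M (\<lambda>x. f x *\<^sub>R g x)"
  by (rule smooth_map_bilinear[OF bounded_bilinear_scaleR])

lemma smooth_map_diff:
  assumes "smooth_map M f" "smooth_map M g"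
  shows "smooth_map M (\<lambda>x. f x - g x)"
  using smooth_map_add[OF assms(1) smooth_map_linear[OF bounded_linear_minus[OF bounded_linear_ident] assms(2)]]
  by simp

lemma smooth_map_Pair:
  assumes "smooth_map M f" "smooth_map M g"
  shows "smooth_map M (\<lambda>x. (f x, g x))"
proof -
  have "bounded_linear (\<lambda>a::'b. (a, 0::'c))" "bounded_linear (\<lambda>b::'c. (0::'b, b))"
    by (auto intro!: bounded_linear_Pair bounded_linear_ident bounded_linear_zero)
  from smooth_map_add[OF smooth_map_linear[OF this(1) assms(1)] smooth_map_linear[OF this(2) assms(2)]]
  show ?thesis by simp
qed

lemma smooth_map_compose:
  assumes "smooth_map M f" "smooth_map N g" "\<And>x. x \<in> M \<Longrightarrow> f x \<in> N"
  shows "smooth_map M (\<lambda>x. g (f x))"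
  unfolding smooth_map_def
proof
  fix p assume p: "p \<in> M"
  from smooth_mapE[OF assms(1) p] obtain U F where
    U: "open U" "p \<in> U" "smooth_on U F" "\<And>x. x \<in> M \<inter> U \<Longrightarrow> F x = f x" by blast
  from smooth_mapE[OF assms(2) assms(3)[OF p]] obtain W G where
    W: "open W" "f p \<in> W" "smooth_on W G" "\<And>y. y \<in> N \<inter> W \<Longrightarrow> G y = g y" by blast
  define U' where "U' = U \<inter> F -` W"
  have "open U'"
    unfolding U'_def using continuous_open_preimage[OF smooth_on_continuous[OF U(3)] U(1) W(1)] .
  moreover have "p \<in> U'" using U W p by (auto simp: U'_def)
  moreover have "smooth_on U' (\<lambda>x. G (F x))"
    by (rule smooth_on_compose[OF \<open>open U'\<close> W(1) _ smooth_on_subset[OF U(3)] W(3)]) (auto simp: U'_def)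
  moreover have "G (F x) = g (f x)" if "x \<in> M \<inter> U'" for x
    using that U(4)[of x] W(4)[of "f x"] assms(3) by (auto simp: U'_def)
  ultimately show "\<exists>U F. open U \<and> p \<in> U \<and> smooth_on U F \<and> (\<forall>x\<in>M \<inter> U. F x = g (f x))"
    by blast
qed

lemma mderiv_const: "p \<in> M \<Longrightarrow> v \<in> tangent_space M p \<Longrightarrow> mderiv M (\<lambda>x. c) p v = 0"
  using mderiv_eq[OF has_derivative_const] .

lemma mderiv_id: "v \<in> tangent_space M p \<Longrightarrow> mderiv M (\<lambda>x. x) p v = v"
  using mderiv_eq[OF has_derivative_ident] .

lemma mderiv_linear_comp:
  assumes "bounded_linear L" "smooth_map M f" "p \<in> M" "v \<in> tangent_space M p"
  shows "mderiv M (\<lambda>x. L (f x)) p v = L (mderiv M f p v)"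
  using mderiv_eq[OF bounded_linear.has_derivative[OF assms(1) smooth_map_has_derivative[OF assms(2,3)]] assms(4)] .

lemma mderiv_bilinear:
  assumes "bounded_bilinear b" "smooth_map M f" "smooth_map M g" "p \<in> M" "v \<in> tangent_space M p"
  shows "mderiv M (\<lambda>x. b (f x) (g x)) p v = b (f p) (mderiv M g p v) + b (mderiv M f p v) (g p)"
  using mderiv_eq[OF bounded_bilinear.FDERIV[OF assms(1) smooth_map_has_derivative[OF assms(2,4)]
        smooth_map_has_derivative[OF assms(3,4)]] assms(5)] .

lemma mderiv_add:
  assumes "smooth_map M f" "smooth_map M g" "p \<in> M" "v \<in> tangent_space M p"
  shows "mderiv M (\<lambda>x. f x + g x) p v = mderiv M f p v + mderiv M g p v"
  using mderiv_eq[OF has_derivative_add[OF smooth_map_has_derivative[OF assms(1,3)]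
        smooth_map_has_derivative[OF assms(2,3)]] assms(4)] .

lemma mderiv_scaleR:
  assumes "smooth_map M f" "smooth_map M g" "p \<in> M" "v \<in> tangent_space M p"
  shows "mderiv M (\<lambda>x. f x *\<^sub>R g x) p v = f p *\<^sub>R mderiv M g p v + mderiv M f p v *\<^sub>R g p"
  by (rule mderiv_bilinear[OF bounded_bilinear_scaleR assms])

lemma mderiv_Pair:
  assumes "smooth_map M f" "smooth_map M g" "p \<in> M" "v \<in> tangent_space M p"
  shows "mderiv M (\<lambda>x. (f x, g x)) p v = (mderiv M f p v, mderiv M g p v)"
  using mderiv_eq[OF has_derivative_Pair[OF smooth_map_has_derivative[OF assms(1,3)]
        smooth_map_has_derivative[OF assms(2,3)]] assms(4)] .

lemma mderiv_tangent:
  assumes "smooth_map M f" "\<And>x. x \<in> M \<Longrightarrow> f x \<in> N" "p \<in> M" "v \<in> tangent_space M p"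
  shows "mderiv M f p v \<in> tangent_space N (f p)"
proof -
  obtain \<gamma> :: "real \<Rightarrow> 'a" where \<gamma>: "\<And>t. \<gamma> t \<in> M" "\<gamma> 0 = p" "(\<gamma> has_vector_derivative v) (at 0)"
    using assms(4) unfolding tangent_space_def by blast
  have "range \<gamma> \<subseteq> M" using \<gamma>(1) by blast
  then have "(f has_derivative mderiv M f p) (at (\<gamma> 0) within range \<gamma>)"
    using smooth_map_has_derivative[OF assms(1,3)] \<gamma>(2) has_derivative_subset by blast
  from diff_chain_within[OF \<gamma>(3)[unfolded has_vector_derivative_def] this]
  have "((\<lambda>t. f (\<gamma> t)) has_derivative (\<lambda>t. mderiv M f p (t *\<^sub>R v))) (at 0)" by (simp add: comp_def)
  then have "((\<lambda>t. f (\<gamma> t)) has_vector_derivative mderiv M f p v) (at 0)"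
    by (simp add: has_vector_derivative_def linear_scale[OF mderiv_linear[OF assms(1,3)]])
  then show ?thesis using \<gamma> assms(2) by (intro tangent_spaceI[of "\<lambda>t. f (\<gamma> t)"]) auto
qed

lemma mderiv_compose:
  assumes "smooth_map M f" "smooth_map N g" "\<And>x. x \<in> M \<Longrightarrow> f x \<in> N" "p \<in> M" "v \<in> tangent_space M p"
  shows "mderiv M (\<lambda>x. g (f x)) p v = mderiv N g (f p) (mderiv M f p v)"
proof -
  have "(g has_derivative mderiv N g (f p)) (at (f p) within f ` M)"
    using smooth_map_has_derivative[OF assms(2) assms(3)[OF assms(4)]] assms(3)
    by (auto intro: has_derivative_subset)
  from diff_chain_within[OF smooth_map_has_derivative[OF assms(1,4)] this]
  have "((\<lambda>x. g (f x)) has_derivative (\<lambda>v. mderiv N g (f p) (mderiv M f p v))) (at p within M)"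
    by (simp add: comp_def)
  from mderiv_eq[OF this assms(5)] show ?thesis .
qed

lemma smooth_map_mderiv:
  assumes "smooth_map M f" "vector_field M X"
  shows "smooth_map M (\<lambda>p. mderiv M f p (X p))"
  unfolding smooth_map_def
proof
  fix p assume p: "p \<in> M"
  have X: "smooth_map M X" "\<And>q. q \<in> M \<Longrightarrow> X q \<in> tangent_space M q"
    using assms(2) by (auto simp: vector_field_def section_along_def)
  from smooth_map_pair_extension[OF assms(1) X(1) p] obtain U F Y where
    U: "open U" "p \<in> U" "smooth_on U F" "smooth_on U Y"
    "\<And>x. x \<in> M \<inter> U \<Longrightarrow> F x = f x" "\<And>x. x \<in> M \<inter> U \<Longrightarrow> Y x = X x" by blast
  have "dird F x (Y x) = mderiv M f x (X x)" if "x \<in> M \<inter> U" for x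
    using mderiv_local_extension[OF U(1) _ _ U(3,5)] X(2) U(6) that by auto
  then show "\<exists>U F. open U \<and> p \<in> U \<and> smooth_on U F \<and> (\<forall>x\<in>M \<inter> U. F x = mderiv M f x (X x))"
    using U smooth_on_dird_field[OF U(1,3,4)] by blast
qed


section \<open>Submanifolds of a space with a constant indefinite metric\<close>

text \<open>
  The hyperbolic plane and its tangent bundle both carry the metric induced by a constant
  nondegenerate form on the ambient space. For such submanifolds the Levi-Civita connection
  is differentiation in the ambient space followed by the orthogonal projection onto the
  tangent space. That brackets of fields are tangent is a hypothesis here; for submanifolds
  given by equations it follows by differentiating these.
\<close>

locale metric_submanifold =
  fixes M :: "'a::euclidean_space set" and B :: "'a \<Rightarrow> 'a \<Rightarrow> real"
    and prj :: "'a \<Rightarrow> 'a \<Rightarrow> 'a" and g :: "'a metric"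
  assumes bilinear_form: "bounded_bilinear B"
    and form_sym: "B v w = B w v"
    and form_nondegenerate: "(\<And>w. B v w = 0) \<Longrightarrow> v = 0"
    and prj_linear: "p \<in> M \<Longrightarrow> linear (prj p)"
    and prj_smooth: "smooth_map M (\<lambda>p. prj p e)"
    and prj_tangent: "p \<in> M \<Longrightarrow> prj p e \<in> tangent_space M p"
    and prj_id: "p \<in> M \<Longrightarrow> v \<in> tangent_space M p \<Longrightarrow> prj p v = v"
    and prj_orthogonal: "p \<in> M \<Longrightarrow> w \<in> tangent_space M p \<Longrightarrow> B (prj p e) w = B e w"
    and metric_eq: "p \<in> M \<Longrightarrow> v \<in> tangent_space M p \<Longrightarrow> w \<in> tangent_space M p \<Longrightarrow> g p v w = B v w"
    and bracket_tangent:
      "vector_field M X \<Longrightarrow> vector_field M Y \<Longrightarrow> p \<in> M \<Longrightarrow> lie_bracket M X Y p \<in> tangent_space M p"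
begin

lemma form_diff: "B (a - b) c = B a c - B b c"
  by (simp add: bounded_bilinear.diff_left bilinear_form)

lemma tangent_space_eq: "p \<in> M \<Longrightarrow> tangent_space M p = range (prj p)"
  using prj_tangent prj_id by (metis (no_types, opaque_lifting) image_eqI image_subsetI iso_tuple_UNIV_I subsetI subset_antisym)

lemma subspace_tangent: "p \<in> M \<Longrightarrow> subspace (tangent_space M p)"
  by (simp add: tangent_space_eq prj_linear linear_subspace_image)

lemma tangent_nondegenerate:
  assumes "p \<in> M" "v \<in> tangent_space M p" "\<And>w. w \<in> tangent_space M p \<Longrightarrow> B v w = 0"
  shows "v = 0"
proof (rule form_nondegenerate)
  fix w
  have "B v w = B w v" by (rule form_sym)
  also have "\<dots> = B (prj p w) v" using prj_orthogonal[OF assms(1,2)] by simp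
  also have "\<dots> = 0" using assms(3)[OF prj_tangent[OF assms(1)]] form_sym by metis
  finally show "B v w = 0" .
qed

lemma prj_expand: "p \<in> M \<Longrightarrow> prj p w = (\<Sum>i\<in>Basis. (w \<bullet> i) *\<^sub>R prj p i)"
  by (rule linear_sum_Basis[OF prj_linear])

text \<open>
  Smoothness in the base point and in the projected vector follows jointly from smoothness of
  the fields \<open>q \<mapsto> prj q e\<close>, by expansion in the standard basis.
\<close>

lemma prj_section:
  assumes "smooth_map L F" "\<And>x. x \<in> L \<Longrightarrow> F x \<in> M" "smooth_map L W"
  shows "section_along L M F (\<lambda>q. prj (F q) (W q))"
  unfolding section_along_def
proof (intro conjI ballI)
  have "smooth_map L (\<lambda>q. \<Sum>i\<in>Basis. (W q \<bullet> i) *\<^sub>R prj (F q) i)"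
    by (intro smooth_map_sum smooth_map_scaleR smooth_map_linear[OF bounded_linear_inner_left] assms
        smooth_map_compose[OF assms(1) prj_smooth])
  then show "smooth_map L (\<lambda>q. prj (F q) (W q))"
    by (rule smooth_map_cong) (rule prj_expand[symmetric, OF assms(2)])
qed (use assms(2) prj_tangent in auto)

lemma vector_field_prj: "vector_field M (\<lambda>q. prj q e)"
  unfolding vector_field_def by (rule prj_section[OF smooth_map_id _ smooth_map_const]) simp

text \<open>
  Stated along an arbitrary map: the identity gives the Levi-Civita connection, and a general
  map the pullback connection.
\<close>

lemma connection_along_prj:
  assumes F: "smooth_map L F" "\<And>x. x \<in> L \<Longrightarrow> F x \<in> M"
    and L: "\<And>p. p \<in> L \<Longrightarrow> subspace (tangent_space L p)"
  shows "connection_along L M F (\<lambda>p v W. prj (F p) (mderiv L W p v))"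
  unfolding connection_along_def
proof (intro conjI allI impI ballI)
  fix X :: "'b \<Rightarrow> 'b" and W assume "vector_field L X" "section_along L M F W"
  then show "section_along L M F (\<lambda>p. prj (F p) (mderiv L W p (X p)))"
    by (intro prj_section F smooth_map_mderiv) (auto simp: section_along_def)
next
  fix W p v w a b
  assume "section_along L M F W" "p \<in> L" "v \<in> tangent_space L p" "w \<in> tangent_space L p"
  then show "prj (F p) (mderiv L W p (a *\<^sub>R v + b *\<^sub>R w)) =
      a *\<^sub>R prj (F p) (mderiv L W p v) + b *\<^sub>R prj (F p) (mderiv L W p w)"
    using mderiv_linear[of L W p] prj_linear[OF F(2), of p]
    by (simp add: section_along_def linear_add linear_scale)
next
  fix W W' p v
  assume "section_along L M F W" "section_along L M F W'" "p \<in> L" "v \<in> tangent_space L p"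
  then show "prj (F p) (mderiv L (\<lambda>q. W q + W' q) p v) =
      prj (F p) (mderiv L W p v) + prj (F p) (mderiv L W' p v)"
    using prj_linear[OF F(2), of p] by (simp add: section_along_def mderiv_add linear_add)
next
  fix f :: "_ \<Rightarrow> real" and W p v
  assume "smooth_map L f" "section_along L M F W" "p \<in> L" "v \<in> tangent_space L p"
  then show "prj (F p) (mderiv L (\<lambda>q. f q *\<^sub>R W q) p v) =
      mderiv L f p v *\<^sub>R W p + f p *\<^sub>R prj (F p) (mderiv L W p v)"
    using prj_linear[OF F(2), of p] prj_id[OF F(2), of p "W p"]
    by (simp add: section_along_def mderiv_scaleR linear_add linear_scale)
qed

text \<open>
  Projecting does not change the pairing with tangent vectors, so the product rule for the
  constant form gives compatibility with the metric. The connection is torsion-free because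
  the bracket of two fields is its own projection.
\<close>

lemma is_levi_civita_prj: "is_levi_civita M g (\<lambda>p v W. prj p (mderiv M W p v))"
  unfolding is_levi_civita_def
proof (intro conjI allI impI ballI)
  show "connection_along M M (\<lambda>p. p) (\<lambda>p v W. prj p (mderiv M W p v))"
    by (rule connection_along_prj[OF smooth_map_id]) (auto intro: subspace_tangent)
next
  fix Y Z p v
  assume YZ: "vector_field M Y" "vector_field M Z" and p: "p \<in> M" "v \<in> tangent_space M p"
  have Y: "smooth_map M Y" "\<And>q. q \<in> M \<Longrightarrow> Y q \<in> tangent_space M q"
    and Z: "smooth_map M Z" "\<And>q. q \<in> M \<Longrightarrow> Z q \<in> tangent_space M q"
    using YZ by (auto simp: vector_field_def section_along_def)
  have "mderiv M (\<lambda>q. g q (Y q) (Z q)) p v = mderiv M (\<lambda>q. B (Y q) (Z q)) p v"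
    by (rule mderiv_cong) (use p Y Z metric_eq in auto)
  also have "\<dots> = B (Y p) (mderiv M Z p v) + B (mderiv M Y p v) (Z p)"
    by (rule mderiv_bilinear[OF bilinear_form Y(1) Z(1) p])
  also have "\<dots> = B (Y p) (prj p (mderiv M Z p v)) + B (prj p (mderiv M Y p v)) (Z p)"
    using prj_orthogonal[OF p(1)] Y(2) Z(2) p form_sym[of "Y p"] by simp
  finally show "mderiv M (\<lambda>q. g q (Y q) (Z q)) p v =
      g p (prj p (mderiv M Y p v)) (Z p) + g p (Y p) (prj p (mderiv M Z p v))"
    using metric_eq prj_tangent Y(2) Z(2) p by simp
next
  fix X Y p assume XY: "vector_field M X" "vector_field M Y" and p: "p \<in> M"
  have "prj p (mderiv M Y p (X p)) - prj p (mderiv M X p (Y p)) = prj p (lie_bracket M X Y p)"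
    using prj_linear[OF p] by (simp add: lie_bracket_def linear_diff)
  then show "prj p (mderiv M Y p (X p)) - prj p (mderiv M X p (Y p)) = lie_bracket M X Y p"
    using prj_id[OF p bracket_tangent[OF XY p]] by simp
qed

text \<open>
  The difference of two metric torsion-free connections is symmetric in its first two
  arguments and, paired with a third field, skew in the last two; a trilinear expression with
  both symmetries vanishes.
\<close>

lemma levi_civita_unique:
  assumes D: "is_levi_civita M g D" and D': "is_levi_civita M g D'"
    and W: "vector_field M W" and p: "p \<in> M" and v: "v \<in> tangent_space M p"
  shows "D p v W = D' p v W"
proof -
  define A where "A X Y = D p (X p) Y - D' p (X p) Y" for X Y
  have tan: "E p (X p) Y \<in> tangent_space M p"
    if "is_levi_civita M g E" "vector_field M X" "vector_field M Y" for E X Y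
    using that p unfolding is_levi_civita_def connection_along_def vector_field_def
    by (simp add: section_along_def)
  have fieldT: "X p \<in> tangent_space M p" if "vector_field M X" for X
    using that p unfolding vector_field_def section_along_def by blast
  have tanA: "A X Y \<in> tangent_space M p" if "vector_field M X" "vector_field M Y" for X Y
    unfolding A_def using tan[OF D that] tan[OF D' that] subspace_tangent[OF p] subspace_diff by blast
  have sym: "A X Y = A Y X" if XY: "vector_field M X" "vector_field M Y" for X Y
  proof -
    have "E p (X p) Y - E p (Y p) X = lie_bracket M X Y p" if "is_levi_civita M g E" for E
      using that XY p unfolding is_levi_civita_def by blast
    from this[OF D] this[OF D'] show ?thesis unfolding A_def by (simp add: algebra_simps)
  qed
  have skew: "B (A X Y) (Z p) = - B (A X Z) (Y p)"
    if XYZ: "vector_field M X" "vector_field M Y" "vector_field M Z" for X Y Z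
  proof -
    have "mderiv M (\<lambda>q. g q (Y q) (Z q)) p (X p) = B (E p (X p) Y) (Z p) + B (E p (X p) Z) (Y p)"
      if E: "is_levi_civita M g E" for E
    proof -
      have "mderiv M (\<lambda>q. g q (Y q) (Z q)) p (X p) = g p (E p (X p) Y) (Z p) + g p (Y p) (E p (X p) Z)"
        using E XYZ p fieldT unfolding is_levi_civita_def by blast
      then show ?thesis
        using metric_eq[OF p tan[OF E XYZ(1,2)] fieldT[OF XYZ(3)]]
          metric_eq[OF p fieldT[OF XYZ(2)] tan[OF E XYZ(1,3)]] form_sym[of "Y p"] by simp
    qed
    from this[OF D] this[OF D'] show ?thesis unfolding A_def by (simp add: form_diff)
  qed
  \<comment> \<open>Alternating the two symmetries runs through all permutations and returns with a minus sign.\<close>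
  have zero: "B (A X Y) (Z p) = 0"
    if XYZ: "vector_field M X" "vector_field M Y" "vector_field M Z" for X Y Z
  proof -
    have "B (A X Y) (Z p) = - B (A Y Z) (X p)" using sym skew XYZ by metis
    also have "\<dots> = B (A Z X) (Y p)" using sym skew XYZ by (metis minus_minus)
    also have "\<dots> = - B (A X Y) (Z p)" using sym skew XYZ by metis
    finally show ?thesis by simp
  qed
  define X where "X = (\<lambda>q. prj q v)"
  have X: "vector_field M X" "X p = v" unfolding X_def using vector_field_prj prj_id p v by auto
  have "A X W = 0"
  proof (rule tangent_nondegenerate[OF p tanA[OF X(1) W]])
    fix z assume "z \<in> tangent_space M p"
    then show "B (A X W) z = 0"
      using zero[OF X(1) W vector_field_prj, of z] prj_id[OF p] by simp
  qed
  then show ?thesis using X(2) by (simp add: A_def)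
qed

lemma is_levi_civita_levi_civita: "is_levi_civita M g (levi_civita M g)"
  unfolding levi_civita_def using someI[of "is_levi_civita M g", OF is_levi_civita_prj] .

lemma levi_civita_eq:
  assumes "vector_field M W" "p \<in> M" "v \<in> tangent_space M p"
  shows "levi_civita M g p v W = prj p (mderiv M W p v)"
  by (rule levi_civita_unique[OF is_levi_civita_levi_civita is_levi_civita_prj assms])

text \<open>
  A section along \<open>F\<close> is a combination of the fields \<open>prj (F q) e\<close>, for \<open>e\<close> in the standard
  basis, which are restrictions of fields on \<open>M\<close>. Multiplying by the indicator function of
  the domain shows that values off the domain do not influence a connection.
\<close>

lemma pullback_connection_unique:
  assumes F: "smooth_map L F" "\<And>x. x \<in> L \<Longrightarrow> F x \<in> M"
    and P: "is_pullback_connection L M g F P" and P': "is_pullback_connection L M g F P'"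
    and W: "section_along L M F W" and p: "p \<in> L" and v: "v \<in> tangent_space L p"
  shows "P p v W = P' p v W"
proof -
  define ind where "ind = (\<lambda>q. if q \<in> L then 1 else 0 :: real)"
  define W' where "W' = (\<lambda>q. \<Sum>i\<in>Basis. (W q \<bullet> i) *\<^sub>R prj (F q) i)"
  have ind: "smooth_map L ind" "mderiv L ind p v = 0" "ind p = 1"
    using smooth_map_cong[OF smooth_map_const[of L "1::real"], of ind]
      mderiv_cong[OF p, of ind "\<lambda>_. 1"] mderiv_const[OF p v, of "1::real"] p
    by (auto simp: ind_def)
  have basic: "section_along L M F (\<lambda>q. prj (F q) i)" for i
    by (rule prj_section[OF F smooth_map_const])
  have coef: "smooth_map L (\<lambda>q. W q \<bullet> i)" for i
    using W smooth_map_linear[OF bounded_linear_inner_left] by (auto simp: section_along_def)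
  have summand: "section_along L M F (\<lambda>q. (W q \<bullet> i) *\<^sub>R prj (F q) i)" for i
    using basic[of i] coef[of i] smooth_map_scaleR subspace_scale[OF subspace_tangent[OF F(2)]]
    by (auto simp: section_along_def)
  have partial: "section_along L M F (\<lambda>q. \<Sum>i\<in>I. (W q \<bullet> i) *\<^sub>R prj (F q) i)" for I
    using summand unfolding section_along_def
    by (intro conjI smooth_map_sum ballI subspace_sum[OF subspace_tangent[OF F(2)]]) auto
  have WW': "(\<lambda>q. ind q *\<^sub>R W q) = (\<lambda>q. ind q *\<^sub>R W' q)"
    using W by (auto simp: ind_def W'_def fun_eq_iff section_along_def prj_id F(2) simp flip: prj_expand)
  have expand: "Q p v W = (\<Sum>i\<in>Basis. mderiv L (\<lambda>q. W q \<bullet> i) p v *\<^sub>R prj (F p) i +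
      (W p \<bullet> i) *\<^sub>R levi_civita M g (F p) (mderiv L F p v) (\<lambda>q. prj q i))"
    if Q: "is_pullback_connection L M g F Q" for Q
  proof -
    have scale: "Q p v (\<lambda>q. f q *\<^sub>R Y q) = mderiv L f p v *\<^sub>R Y p + f p *\<^sub>R Q p v Y"
      if "smooth_map L f" "section_along L M F Y" for f Y
      using Q that p v unfolding is_pullback_connection_def connection_along_def by blast
    have add: "Q p v (\<lambda>q. Y q + Y' q) = Q p v Y + Q p v Y'"
      if "section_along L M F Y" "section_along L M F Y'" for Y Y'
      using Q that p v unfolding is_pullback_connection_def connection_along_def by blast
    have sum: "Q p v (\<lambda>q. \<Sum>i\<in>I. (W q \<bullet> i) *\<^sub>R prj (F q) i)
        = (\<Sum>i\<in>I. Q p v (\<lambda>q. (W q \<bullet> i) *\<^sub>R prj (F q) i))" if "finite I" for I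
      using that
    proof induction
      case empty
      show ?case using scale[OF smooth_map_const[of L 0] W] mderiv_const[OF p v, of "0::real"] by simp
    next
      case (insert i I)
      then show ?case using add[OF summand[of i] partial[of I]] by simp
    qed
    have "Q p v W = Q p v (\<lambda>q. ind q *\<^sub>R W q)" using scale[OF ind(1) W] ind by simp
    also have "\<dots> = Q p v W'"
      unfolding WW' using scale[OF ind(1) partial[of Basis]] ind by (simp add: W'_def)
    also have "\<dots> = (\<Sum>i\<in>Basis. Q p v (\<lambda>q. (W q \<bullet> i) *\<^sub>R prj (F q) i))"
      unfolding W'_def by (rule sum) simp
    also have "\<dots> = (\<Sum>i\<in>Basis. mderiv L (\<lambda>q. W q \<bullet> i) p v *\<^sub>R prj (F p) i +
        (W p \<bullet> i) *\<^sub>R levi_civita M g (F p) (mderiv L F p v) (\<lambda>q. prj q i))"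
    proof (rule sum.cong[OF refl])
      fix i :: 'a
      have "Q p v (\<lambda>q. prj (F q) i) = levi_civita M g (F p) (mderiv L F p v) (\<lambda>q. prj q i)"
        using Q vector_field_prj[of i] p v unfolding is_pullback_connection_def by blast
      then show "Q p v (\<lambda>q. (W q \<bullet> i) *\<^sub>R prj (F q) i) = mderiv L (\<lambda>q. W q \<bullet> i) p v *\<^sub>R prj (F p) i +
          (W p \<bullet> i) *\<^sub>R levi_civita M g (F p) (mderiv L F p v) (\<lambda>q. prj q i)"
        using scale[OF coef basic] by simp
    qed
    finally show ?thesis .
  qed
  show ?thesis using expand[OF P] expand[OF P'] by simp
qed

lemma pullback_connection_eq:
  assumes F: "smooth_map L F" "\<And>x. x \<in> L \<Longrightarrow> F x \<in> M"
    and L: "\<And>p. p \<in> L \<Longrightarrow> subspace (tangent_space L p)"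
    and W: "section_along L M F W" and p: "p \<in> L" and v: "v \<in> tangent_space L p"
  shows "pullback_connection L M g F p v W = prj (F p) (mderiv L W p v)"
proof -
  have prj: "is_pullback_connection L M g F (\<lambda>p v W. prj (F p) (mderiv L W p v))"
    unfolding is_pullback_connection_def
  proof (intro conjI allI impI ballI)
    show "connection_along L M F (\<lambda>p v W. prj (F p) (mderiv L W p v))"
      by (rule connection_along_prj[OF F L])
    fix Z p v assume Z: "vector_field M Z" and p: "p \<in> L" "v \<in> tangent_space L p"
    have "smooth_map M Z" using Z by (simp add: vector_field_def section_along_def)
    from mderiv_compose[OF F(1) this F(2) p]
    show "prj (F p) (mderiv L (\<lambda>q. Z (F q)) p v) = levi_civita M g (F p) (mderiv L F p v) Z"
      using levi_civita_eq[OF Z F(2)[OF p(1)] mderiv_tangent[OF F p]] by simp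
  qed
  have "is_pullback_connection L M g F (pullback_connection L M g F)"
    unfolding pullback_connection_def
    using someI[of "is_pullback_connection L M g F", OF prj] .
  from pullback_connection_unique[OF F this prj W p v] show ?thesis .
qed

end


section \<open>The hyperbolic plane as a submanifold of Minkowski space\<close>

lemma bounded_bilinear_mink: "bounded_bilinear mink"
  unfolding bilinear_conv_bounded_bilinear[symmetric] bilinear_def
  by (auto intro!: linearI simp: mink_def algebra_simps)

lemmas mink_algebra =
  bounded_bilinear.add_left[OF bounded_bilinear_mink] bounded_bilinear.add_right[OF bounded_bilinear_mink]
  bounded_bilinear.diff_left[OF bounded_bilinear_mink] bounded_bilinear.diff_right[OF bounded_bilinear_mink]
  bounded_bilinear.minus_left[OF bounded_bilinear_mink] bounded_bilinear.minus_right[OF bounded_bilinear_mink]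
  bounded_bilinear.scaleR_left[OF bounded_bilinear_mink] bounded_bilinear.scaleR_right[OF bounded_bilinear_mink]
  bounded_bilinear.zero_left[OF bounded_bilinear_mink] bounded_bilinear.zero_right[OF bounded_bilinear_mink]

lemma mink_sym: "mink x y = mink y x"
  by (simp add: mink_def)

lemma mink_axis: "mink v (axis 1 1) = - v $ 1" "mink v (axis 2 1) = v $ 2" "mink v (axis 3 1) = v $ 3"
  by (simp_all add: mink_def axis_def)

lemma mink_nondegenerate:
  assumes "\<And>w. mink v w = 0" shows "v = 0"
  using assms[of "axis 1 1"] assms[of "axis 2 1"] assms[of "axis 3 1"]
  by (simp add: mink_axis vec_eq_iff forall_3)

lemma mcross_eq:
  "x \<boxtimes> y = vector [x $ 3 * y $ 2 - x $ 2 * y $ 3, x $ 3 * y $ 1 - x $ 1 * y $ 3, x $ 1 * y $ 2 - x $ 2 * y $ 1]"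
  (is "_ = ?w")
  unfolding mcross_def
proof (rule the_equality)
  show *: "\<forall>v. mink ?w v = det (vector [x, y, v] :: real^3^3)"
    by (simp add: mink_def det_3 vector_3 algebra_simps)
  fix w assume w: "\<forall>v. mink w v = det (vector [x, y, v] :: real^3^3)"
  have "w - ?w = 0" by (rule mink_nondegenerate) (use * w in \<open>simp add: mink_algebra\<close>)
  then show "w = ?w" by simp
qed

lemma mcross_nth:
  "(x \<boxtimes> y) $ 1 = x $ 3 * y $ 2 - x $ 2 * y $ 3"
  "(x \<boxtimes> y) $ 2 = x $ 3 * y $ 1 - x $ 1 * y $ 3"
  "(x \<boxtimes> y) $ 3 = x $ 1 * y $ 2 - x $ 2 * y $ 1"
  by (simp_all add: mcross_eq vector_3)

definition future_cone :: "(real^3) set" where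
  "future_cone = {x. mink x x < 0 \<and> x $ 1 > 0}"

lemma open_future_cone: "open future_cone"
  unfolding future_cone_def mink_def by (intro open_Collect_conj open_Collect_less continuous_intros)

lemma hyp_subset_cone: "hyp \<subseteq> future_cone"
  by (auto simp: hyp_def future_cone_def)

text \<open>
  The reversed Cauchy-Schwarz inequality for timelike vectors.
\<close>

lemma mink_future_neg:
  assumes "x \<in> future_cone" "y \<in> future_cone"
  shows "mink x y < 0"
proof -
  have x: "(x $ 2)\<^sup>2 + (x $ 3)\<^sup>2 < (x $ 1)\<^sup>2" "x $ 1 > 0"
    and y: "(y $ 2)\<^sup>2 + (y $ 3)\<^sup>2 < (y $ 1)\<^sup>2" "y $ 1 > 0"
    using assms by (auto simp: future_cone_def mink_def power2_eq_square)
  have "((x $ 2)\<^sup>2 + (x $ 3)\<^sup>2) * ((y $ 2)\<^sup>2 + (y $ 3)\<^sup>2) - (x $ 2 * y $ 2 + x $ 3 * y $ 3)\<^sup>2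
      = (x $ 2 * y $ 3 - x $ 3 * y $ 2)\<^sup>2"
    by (simp add: power2_eq_square algebra_simps)
  then have "(x $ 2 * y $ 2 + x $ 3 * y $ 3)\<^sup>2 \<le> ((x $ 2)\<^sup>2 + (x $ 3)\<^sup>2) * ((y $ 2)\<^sup>2 + (y $ 3)\<^sup>2)"
    using zero_le_power2[of "x $ 2 * y $ 3 - x $ 3 * y $ 2"] by linarith
  also have "\<dots> < (x $ 1)\<^sup>2 * (y $ 1)\<^sup>2"
    using x(1) y(1) by (intro mult_strict_mono') auto
  finally have "(x $ 2 * y $ 2 + x $ 3 * y $ 3)\<^sup>2 < (x $ 1 * y $ 1)\<^sup>2"
    by (simp add: power_mult_distrib)
  then have "x $ 2 * y $ 2 + x $ 3 * y $ 3 < x $ 1 * y $ 1"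
    using power2_less_imp_less x(2) y(2) by (metis less_imp_le mult_pos_pos)
  then show ?thesis by (simp add: mink_def)
qed

text \<open>
  Used to show that a curve on the two-sheeted hyperboloid stays on the sheet of its starting point.
\<close>

lemma future_coneI:
  assumes "mink x x < 0" "mink x y < 0" "y \<in> future_cone"
  shows "x \<in> future_cone"
proof (rule ccontr)
  assume "x \<notin> future_cone"
  then have "x $ 1 \<le> 0" using assms(1) by (auto simp: future_cone_def)
  moreover have "x $ 1 \<noteq> 0"
  proof
    assume "x $ 1 = 0"
    then have "mink x x = (x $ 2)\<^sup>2 + (x $ 3)\<^sup>2" by (simp add: mink_def power2_eq_square)
    then show False using assms(1) by (smt (verit) zero_le_power2)
  qed
  ultimately have "- x \<in> future_cone" using assms(1) by (simp add: future_cone_def mink_algebra)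
  from mink_future_neg[OF this assms(3)] show False using assms(2) by (simp add: mink_algebra)
qed

lemma mink_orthogonal_nonneg:
  assumes "p \<in> hyp" "mink p v = 0"
  shows "mink v v \<ge> 0"
proof -
  have p: "(p $ 1)\<^sup>2 = 1 + (p $ 2)\<^sup>2 + (p $ 3)\<^sup>2" "p $ 1 > 0"
    using assms(1) by (auto simp: hyp_def mink_def power2_eq_square)
  have v: "p $ 1 * v $ 1 = p $ 2 * v $ 2 + p $ 3 * v $ 3" using assms(2) by (simp add: mink_def)
  have "(p $ 1)\<^sup>2 * mink v v = (p $ 1)\<^sup>2 * ((v $ 2)\<^sup>2 + (v $ 3)\<^sup>2) - (p $ 1 * v $ 1)\<^sup>2"
    by (simp add: mink_def power2_eq_square algebra_simps)
  also have "\<dots> = (v $ 2)\<^sup>2 + (v $ 3)\<^sup>2 + (p $ 2 * v $ 3 - p $ 3 * v $ 2)\<^sup>2"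
    unfolding v p(1) by (simp add: power2_eq_square algebra_simps)
  finally have "(p $ 1)\<^sup>2 * mink v v \<ge> 0" by simp
  then show ?thesis using p(2) by (simp add: zero_le_mult_iff)
qed

text \<open>
  The coefficient of \<open>p\<close> is forced by the equation of the hyperboloid. Tangent vectors are
  spacelike, so the curve is defined for all times.
\<close>

lemma hyp_tangent_curve:
  assumes p: "p \<in> hyp" and v: "mink p v = 0"
  defines "\<gamma> \<equiv> \<lambda>t. sqrt (1 + t\<^sup>2 * mink v v) *\<^sub>R p + t *\<^sub>R v"
  shows "\<gamma> t \<in> hyp" "\<gamma> 0 = p" "(\<gamma> has_vector_derivative v) (at 0)"
proof -
  have pos: "1 + t\<^sup>2 * mink v v > 0" for t :: real
    using mink_orthogonal_nonneg[OF p v] by (smt (verit) zero_le_mult_iff zero_le_power2)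
  have pp: "mink p p = -1" using p by (simp add: hyp_def)
  have "mink (\<gamma> t) (\<gamma> t) = - (sqrt (1 + t\<^sup>2 * mink v v))\<^sup>2 + t\<^sup>2 * mink v v"
    by (simp add: \<gamma>_def mink_algebra pp v mink_sym[of v p] power2_eq_square)
  also have "\<dots> = -1" using pos[of t] by simp
  finally have eq: "mink (\<gamma> t) (\<gamma> t) = -1" .
  moreover have "mink (\<gamma> t) p < 0" using pos[of t] by (simp add: \<gamma>_def mink_algebra pp v mink_sym[of v p])
  ultimately have "\<gamma> t \<in> future_cone" using future_coneI[of "\<gamma> t" p] p hyp_subset_cone by auto
  then show "\<gamma> t \<in> hyp" using eq by (simp add: hyp_def future_cone_def)
  show "\<gamma> 0 = p" by (simp add: \<gamma>_def)
  have "((\<lambda>t. sqrt (1 + t\<^sup>2 * mink v v)) has_real_derivative 0) (at 0)"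
    by (auto intro!: derivative_eq_intros)
  then show "(\<gamma> has_vector_derivative v) (at 0)"
    unfolding \<gamma>_def
    by (auto intro!: derivative_eq_intros simp: has_real_derivative_iff_has_vector_derivative)
qed

lemma mink_tangent_derivative:
  assumes "(a has_vector_derivative a') (at t)" "(b has_vector_derivative b') (at t)"
    and "\<And>t. mink (a t) (b t) = c"
  shows "mink (a t) b' + mink a' (b t) = 0"
proof -
  have "((\<lambda>t. mink (a t) (b t)) has_vector_derivative (mink (a t) b' + mink a' (b t))) (at t)"
    by (rule bounded_bilinear.has_vector_derivative[OF bounded_bilinear_mink assms(1,2)])
  moreover have "((\<lambda>t. mink (a t) (b t)) has_vector_derivative 0) (at t)"
    using assms(3) by simp
  ultimately show ?thesis by (rule vector_derivative_unique_at)
qed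

lemma tangent_space_hyp:
  assumes "p \<in> hyp"
  shows "tangent_space hyp p = {v. mink p v = 0}"
proof (intro equalityI subsetI CollectI)
  fix v assume "v \<in> tangent_space hyp p"
  then obtain \<gamma> :: "real \<Rightarrow> real^3" where \<gamma>: "\<And>t. \<gamma> t \<in> hyp" "\<gamma> 0 = p" "(\<gamma> has_vector_derivative v) (at 0)"
    unfolding tangent_space_def by blast
  have "mink (\<gamma> 0) v + mink v (\<gamma> 0) = 0"
    by (rule mink_tangent_derivative[OF \<gamma>(3,3), of "-1"]) (use \<gamma>(1) in \<open>auto simp: hyp_def\<close>)
  then show "mink p v = 0" using \<gamma>(2) mink_sym[of v p] by simp
next
  fix v assume "v \<in> {v. mink p v = 0}"
  then have "mink p v = 0" by simp
  from hyp_tangent_curve[OF assms this] show "v \<in> tangent_space hyp p" by (rule tangent_spaceI)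
qed

lemma smooth_map_mink: "smooth_map M f \<Longrightarrow> smooth_map M g \<Longrightarrow> smooth_map M (\<lambda>x. mink (f x) (g x))"
  by (rule smooth_map_bilinear[OF bounded_bilinear_mink])

definition hyp_proj :: "real^3 \<Rightarrow> real^3 \<Rightarrow> real^3" where
  "hyp_proj p v = v + mink p v *\<^sub>R p"

lemma vector_fieldD:
  assumes "vector_field M X"
  shows "smooth_map M X" "p \<in> M \<Longrightarrow> X p \<in> tangent_space M p"
  using assms by (auto simp: vector_field_def section_along_def)

lemma hyp_mink_self: "p \<in> hyp \<Longrightarrow> mink p p = -1"
  by (simp add: hyp_def)

lemma mderiv_mink:
  assumes "smooth_map M X" "smooth_map M Y" "p \<in> M" "v \<in> tangent_space M p" "\<And>q. q \<in> M \<Longrightarrow> mink (X q) (Y q) = c"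
  shows "mink (X p) (mderiv M Y p v) + mink (mderiv M X p v) (Y p) = 0"
  using mderiv_bilinear[OF bounded_bilinear_mink assms(1-4)]
    mderiv_cong[OF assms(3,5), where v = v] mderiv_const[OF assms(3,4), where c = c] by simp

lemma hyp_field_normal_derivative:
  assumes "vector_field hyp Y" "p \<in> hyp" "v \<in> tangent_space hyp p"
  shows "mink p (mderiv hyp Y p v) = - mink v (Y p)"
  using mderiv_mink[OF smooth_map_id vector_fieldD(1)[OF assms(1)] assms(2,3), where c = 0]
    vector_fieldD(2)[OF assms(1)] tangent_space_hyp mderiv_id[OF assms(3)] by simp

interpretation hyp: metric_submanifold hyp mink hyp_proj hyp_metric
proof (rule metric_submanifold.intro)
  show "bounded_bilinear mink" by (rule bounded_bilinear_mink)
  show "smooth_map hyp (\<lambda>p. hyp_proj p e)" for e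
    unfolding hyp_proj_def
    by (intro smooth_map_add smooth_map_scaleR smooth_map_mink smooth_map_id smooth_map_const)
  fix X Y p assume X: "vector_field hyp X" and Y: "vector_field hyp Y" and p: "p \<in> hyp"
  have "X p \<in> tangent_space hyp p" "Y p \<in> tangent_space hyp p" using vector_fieldD(2)[OF X p] vector_fieldD(2)[OF Y p] .
  then show "lie_bracket hyp X Y p \<in> tangent_space hyp p"
    using hyp_field_normal_derivative[OF Y p] hyp_field_normal_derivative[OF X p] p mink_sym[of "X p"]
    by (simp add: tangent_space_hyp lie_bracket_def mink_algebra)
qed (auto simp: mink_sym mink_nondegenerate hyp_proj_def tangent_space_hyp
    hyp_metric_def mink_algebra hyp_mink_self algebra_simps intro!: linearI)

lemma hyp_nabla_eq:
  assumes "vector_field hyp W" "p \<in> hyp" "v \<in> tangent_space hyp p"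
  shows "hyp_nabla p v W = mderiv hyp W p v - mink v (W p) *\<^sub>R p"
  using hyp.levi_civita_eq[OF assms] hyp_field_normal_derivative[OF assms] by (simp add: hyp_proj_def)


subsection \<open>Traces\<close>

lemma minkowski_expand: "v = (- mink v (axis 1 1)) *\<^sub>R axis 1 1 + mink v (axis 2 1) *\<^sub>R axis 2 1 + mink v (axis 3 1) *\<^sub>R axis 3 1"
  unfolding mink_axis by (simp add: vec_eq_iff forall_3 axis_def)

definition mink_trace :: "(real^3 \<Rightarrow> real^3 \<Rightarrow> 'b::real_vector) \<Rightarrow> 'b" where
  "mink_trace h = h (axis 2 1) (axis 2 1) + h (axis 3 1) (axis 3 1) - h (axis 1 1) (axis 1 1)"

text \<open>The frame is the image of the last two basis vectors under the boost that takes the first to \<open>p\<close>.\<close>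

lemma orthonormal_basis_hyp_exists:
  assumes p: "p \<in> hyp"
  shows "\<exists>B. orthonormal_basis hyp hyp_metric p B"
proof -
  define k where "k = 1 / (1 + p $ 1)"
  define e :: "real^3" where "e = vector [p $ 2, 1 + k * p $ 2 * p $ 2, k * p $ 2 * p $ 3]"
  define f :: "real^3" where "f = vector [p $ 3, k * p $ 2 * p $ 3, 1 + k * p $ 3 * p $ 3]"
  have pp: "p $ 1 * p $ 1 = 1 + p $ 2 * p $ 2 + p $ 3 * p $ 3" and "p $ 1 > 0"
    using p by (auto simp: hyp_def mink_def)
  then have k: "k * (1 + p $ 1) = 1" by (simp add: k_def)
  have ef: "mink e e = 1" "mink f f = 1" "mink e f = 0" "mink p e = 0" "mink p f = 0"
    unfolding mink_def e_def f_def vector_3 using pp k by algebra+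
  have expand: "v = mink v e *\<^sub>R e + mink v f *\<^sub>R f" if "mink p v = 0" for v
    using that pp k unfolding vec_eq_iff forall_3 mink_def e_def f_def
    by (simp only: vector_3 vector_add_component vector_scaleR_component real_scaleR_def) (intro conjI; algebra)
  have ne: "e \<noteq> f" using ef by auto
  have "span {e, f} = {v. mink p v = 0}"
  proof
    show "span {e, f} \<subseteq> {v. mink p v = 0}"
      by (rule span_minimal) (use ef in \<open>auto simp: subspace_def mink_algebra\<close>)
    show "{v. mink p v = 0} \<subseteq> span {e, f}"
    proof
      fix v assume "v \<in> {v. mink p v = 0}"
      then have "v = mink v e *\<^sub>R e + mink v f *\<^sub>R f" using expand by simp
      moreover have "mink v e *\<^sub>R e + mink v f *\<^sub>R f \<in> span {e, f}"
        by (intro span_add span_scale span_base) auto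
      ultimately show "v \<in> span {e, f}" by simp
    qed
  qed
  then have "orthonormal_basis hyp hyp_metric p {e, f}"
    using ef ne mink_sym[of f e] by (auto simp: orthonormal_basis_def tangent_space_hyp[OF p] hyp_metric_def)
  then show ?thesis by blast
qed

text \<open>
  An orthonormal basis of the tangent space together with \<open>p\<close>, of square \<open>-1\<close>, is an orthonormal
  basis of Minkowski space. The trace over the tangent space is thus the full Minkowski trace
  corrected by the value at \<open>p\<close>; in particular it does not depend on the basis.
\<close>

lemma metric_trace_hyp:
  fixes h h' :: "real^3 \<Rightarrow> real^3 \<Rightarrow> 'b::real_vector"
  assumes p: "p \<in> hyp" and l1: "\<And>w. linear (\<lambda>v. h v w)" and l2: "\<And>v. linear (h v)"
    and agree: "\<And>v w. v \<in> tangent_space hyp p \<Longrightarrow> w \<in> tangent_space hyp p \<Longrightarrow> h' v w = h v w"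
  shows "metric_trace hyp hyp_metric p h' = mink_trace h + h p p"
proof -
  define B where "B = (SOME B. orthonormal_basis hyp hyp_metric p B)"
  have B: "orthonormal_basis hyp hyp_metric p B"
    unfolding B_def using someI_ex[OF orthonormal_basis_hyp_exists[OF p]] .
  then have fin: "finite B" and BT: "B \<subseteq> tangent_space hyp p" and sp: "span B = tangent_space hyp p"
    and on: "\<And>e e'. e \<in> B \<Longrightarrow> e' \<in> B \<Longrightarrow> mink e e' = (if e = e' then 1 else 0)"
    by (auto simp: orthonormal_basis_def hyp_metric_def)
  have expand: "v = (\<Sum>e\<in>B. mink v e *\<^sub>R e)" if "v \<in> tangent_space hyp p" for v
  proof -
    have "v \<in> range (\<lambda>c. \<Sum>e\<in>B. c e *\<^sub>R e)" using that unfolding sp[symmetric] span_finite[OF fin] .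
    then obtain c where c: "v = (\<Sum>e\<in>B. c e *\<^sub>R e)" by blast
    have "mink v e = c e" if "e \<in> B" for e
    proof -
      have "mink v e = (\<Sum>e'\<in>B. c e' * mink e' e)"
        unfolding c by (simp add: bounded_bilinear.sum_left[OF bounded_bilinear_mink] mink_algebra)
      also have "\<dots> = c e" using fin that by (simp add: on if_distrib cong: if_cong sum.cong)
      finally show ?thesis .
    qed
    then show ?thesis by (subst c) simp
  qed
  have frame: "(\<Sum>e\<in>B. mink a e *\<^sub>R e) = a + mink p a *\<^sub>R p" for a
    using expand[OF hyp.prj_tangent[OF p, of a]] hyp.prj_orthogonal[OF p] BT
    by (simp add: hyp_proj_def subset_iff cong: sum.cong)
  have half: "h v w = mink v (axis 2 1) *\<^sub>R h (axis 2 1) w + mink v (axis 3 1) *\<^sub>R h (axis 3 1) w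
      - mink v (axis 1 1) *\<^sub>R h (axis 1 1) w" for v w
    by (subst minkowski_expand[of v]) (simp add: linear_add[OF l1] linear_scale[OF l1] linear_diff[OF l1] linear_neg[OF l1])
  have col: "(\<Sum>e\<in>B. mink e a *\<^sub>R h a e) = h a a + mink p a *\<^sub>R h a p" for a
  proof -
    have "(\<Sum>e\<in>B. mink e a *\<^sub>R h a e) = h a (\<Sum>e\<in>B. mink a e *\<^sub>R e)"
      by (simp add: linear_sum[OF l2] linear_scale[OF l2] mink_sym)
    then show ?thesis by (simp add: frame linear_add[OF l2] linear_scale[OF l2])
  qed
  have "metric_trace hyp hyp_metric p h' = (\<Sum>e\<in>B. h e e)"
    unfolding metric_trace_def B_def[symmetric] using BT agree by (intro sum.cong) auto
  also have "\<dots> = (\<Sum>e\<in>B. mink e (axis 2 1) *\<^sub>R h (axis 2 1) e)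
      + (\<Sum>e\<in>B. mink e (axis 3 1) *\<^sub>R h (axis 3 1) e) - (\<Sum>e\<in>B. mink e (axis 1 1) *\<^sub>R h (axis 1 1) e)"
    by (subst half) (simp add: sum.distrib sum_subtractf)
  also have "\<dots> = mink_trace h + h p p"
    unfolding col half[of p p] mink_trace_def by simp
  finally show ?thesis .
qed


section \<open>Homogeneous functions on the future cone\<close>

lemma dird_linear: "smooth_on U F \<Longrightarrow> x \<in> U \<Longrightarrow> linear (dird F x)"
  by (rule linear_frechet_derivative) (rule smooth_on_differentiable)

lemma dird_linear_comp:
  "bounded_linear L \<Longrightarrow> smooth_on U F \<Longrightarrow> x \<in> U \<Longrightarrow> dird (\<lambda>y. L (F y)) x v = L (dird F x v)"
  by (rule fun_cong[OF dird_eq[OF bounded_linear.has_derivative[OF _ smooth_on_has_derivative]]])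

lemma dird_bilinear:
  assumes "bounded_bilinear b" "smooth_on U F" "smooth_on U G" "x \<in> U"
  shows "dird (\<lambda>y. b (F y) (G y)) x v = b (F x) (dird G x v) + b (dird F x v) (G x)"
  using dird_eq[OF bounded_bilinear.FDERIV[OF assms(1) smooth_on_has_derivative[OF assms(2,4)]
        smooth_on_has_derivative[OF assms(3,4)]]] by simp

lemma dird_transform:
  assumes "open U" "smooth_on U F" "x \<in> U" "\<And>y. y \<in> U \<Longrightarrow> F y = G y"
  shows "dird G x v = dird F x v"
  using dird_cong(2)[OF assms(1,3) smooth_on_differentiable[OF assms(2,3)] assms(4)] by simp

definition second_dird :: "('a::euclidean_space \<Rightarrow> 'b::euclidean_space) \<Rightarrow> 'a \<Rightarrow> 'a \<Rightarrow> 'a \<Rightarrow> 'b" where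
  "second_dird F x v w = dird (\<lambda>y. dird F y w) x v"

lemma second_dird_linear_comp:
  assumes "bounded_linear L" "open U" "smooth_on U F" "x \<in> U"
  shows "second_dird (\<lambda>y. L (F y)) x v w = L (second_dird F x v w)"
proof -
  have "dird (\<lambda>y. dird (\<lambda>y. L (F y)) y w) x v = dird (\<lambda>y. L (dird F y w)) x v"
    by (rule dird_transform[OF assms(2) smooth_on_linear_comp[OF assms(1,2) smooth_on_dird[OF assms(3)]] assms(4)])
      (rule dird_linear_comp[OF assms(1,3), symmetric])
  then show ?thesis
    unfolding second_dird_def
    using dird_linear_comp[OF assms(1) smooth_on_dird[OF assms(3)] assms(4)] by simp
qed

lemma second_dird_sym:
  assumes "open U" "smooth_on U F" "x \<in> U"
  shows "second_dird F x v w = second_dird F x w v"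
proof (rule euclidean_eqI)
  fix i
  have "second_dird F x v w \<bullet> i = second_dird (\<lambda>y. F y \<bullet> i) x v w" for v w
    using second_dird_linear_comp[OF bounded_linear_inner_left assms, of i] by simp
  moreover have "second_dird (\<lambda>y. F y \<bullet> i) x v w = second_dird (\<lambda>y. F y \<bullet> i) x w v"
    unfolding second_dird_def
    by (rule dird_commute[OF assms(1,3) smooth_on_linear_comp[OF bounded_linear_inner_left assms(1,2)]])
  ultimately show "second_dird F x v w \<bullet> i = second_dird F x w v \<bullet> i" by simp
qed

lemma second_dird_linear1: "smooth_on U F \<Longrightarrow> x \<in> U \<Longrightarrow> linear (\<lambda>v. second_dird F x v w)"
  unfolding second_dird_def by (rule dird_linear[OF smooth_on_dird])

lemma second_dird_linear2:
  assumes "open U" "smooth_on U F" "x \<in> U" shows "linear (second_dird F x v)"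
proof -
  have "second_dird F x v = (\<lambda>w. second_dird F x w v)"
    using second_dird_sym[OF assms] by blast
  then show ?thesis using second_dird_linear1[OF assms(2,3), of v] by simp
qed

lemma dird_dird_field:
  assumes "open U" "smooth_on U F" "smooth_on U Y" "x \<in> U"
  shows "dird (\<lambda>y. dird F y (Y y)) x v = second_dird F x v (Y x) + dird F x (dird Y x v)"
proof -
  have expand: "dird F y w = (\<Sum>i\<in>Basis. (w \<bullet> i) *\<^sub>R dird F y i)" if "y \<in> U" for y w
    by (rule linear_sum_Basis[OF dird_linear[OF assms(2) that]])
  have "((\<lambda>y. \<Sum>i\<in>Basis. (Y y \<bullet> i) *\<^sub>R dird F y i) has_derivative
     (\<lambda>v. \<Sum>i\<in>Basis. (Y x \<bullet> i) *\<^sub>R second_dird F x v i + (dird Y x v \<bullet> i) *\<^sub>R dird F x i)) (at x)"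
    unfolding second_dird_def
    by (intro has_derivative_sum bounded_bilinear.FDERIV[OF bounded_bilinear_scaleR]
        bounded_linear.has_derivative[OF bounded_linear_inner_left]
        smooth_on_has_derivative[OF assms(3,4)] smooth_on_has_derivative[OF smooth_on_dird[OF assms(2)] assms(4)])
  then have "((\<lambda>y. dird F y (Y y)) has_derivative
     (\<lambda>v. \<Sum>i\<in>Basis. (Y x \<bullet> i) *\<^sub>R second_dird F x v i + (dird Y x v \<bullet> i) *\<^sub>R dird F x i)) (at x)"
    by (rule has_derivative_transform_within_open[OF _ assms(1,4)]) (rule expand[symmetric])
  from dird_eq[OF this]
  have "dird (\<lambda>y. dird F y (Y y)) x v
      = (\<Sum>i\<in>Basis. (Y x \<bullet> i) *\<^sub>R second_dird F x v i) + (\<Sum>i\<in>Basis. (dird Y x v \<bullet> i) *\<^sub>R dird F x i)"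
    by (simp add: sum.distrib)
  then show ?thesis
    using linear_sum_Basis[OF second_dird_linear2[OF assms(1,2,4)], of v "Y x"]
      expand[OF assms(4), of "dird Y x v"] by simp
qed

lemma future_cone_scale: "x \<in> future_cone \<Longrightarrow> t > 0 \<Longrightarrow> t *\<^sub>R x \<in> future_cone"
  by (simp add: future_cone_def mink_algebra mult_pos_neg)

lemma dird_scale:
  assumes F: "smooth_on future_cone F" and x: "x \<in> future_cone" and t: "t > 0"
    and hom: "\<And>y. y \<in> future_cone \<Longrightarrow> F (t *\<^sub>R y) = c *\<^sub>R F y"
  shows "t *\<^sub>R dird F (t *\<^sub>R x) v = c *\<^sub>R dird F x v"
proof -
  have tx: "t *\<^sub>R x \<in> future_cone" using x t future_cone_scale by blast
  have "((\<lambda>y. t *\<^sub>R y) has_derivative (\<lambda>v. t *\<^sub>R v)) (at x)" by (auto intro!: derivative_eq_intros)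
  from diff_chain_at[OF this smooth_on_has_derivative[OF F tx]]
  have "((\<lambda>y. F (t *\<^sub>R y)) has_derivative (\<lambda>v. dird F (t *\<^sub>R x) (t *\<^sub>R v))) (at x)"
    by (simp add: comp_def)
  then have "((\<lambda>y. c *\<^sub>R F y) has_derivative (\<lambda>v. dird F (t *\<^sub>R x) (t *\<^sub>R v))) (at x)"
    by (rule has_derivative_transform_within_open[OF _ open_future_cone x]) (rule hom)
  moreover have "((\<lambda>y. c *\<^sub>R F y) has_derivative (\<lambda>v. c *\<^sub>R dird F x v)) (at x)"
    by (rule has_derivative_scaleR_right[OF smooth_on_has_derivative[OF F x]])
  ultimately have "dird F (t *\<^sub>R x) (t *\<^sub>R v) = c *\<^sub>R dird F x v"
    using has_derivative_unique by metis
  then show ?thesis by (simp add: linear_scale[OF dird_linear[OF F tx]])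
qed

text \<open>
  In degree one, first derivatives are constant along rays, and second derivatives vanish when
  one argument is the position vector. Hence second derivatives of a homogeneous extension
  need no correction term for the curvature of the hyperboloid.
\<close>

locale homogeneous =
  fixes F :: "real^3 \<Rightarrow> 'b::euclidean_space"
  assumes smooth: "smooth_on future_cone F"
    and homogeneous: "x \<in> future_cone \<Longrightarrow> t > 0 \<Longrightarrow> F (t *\<^sub>R x) = t *\<^sub>R F x"
begin

lemma dird_homogeneous:
  assumes "x \<in> future_cone" "t > 0" shows "dird F (t *\<^sub>R x) v = dird F x v"
  using dird_scale[OF smooth assms homogeneous[OF _ assms(2)], of v] assms(2) by simp

lemma second_dird_homogeneous:
  assumes "x \<in> future_cone" "t > 0" shows "t *\<^sub>R second_dird F (t *\<^sub>R x) v w = second_dird F x v w"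
  using dird_scale[OF smooth_on_dird[OF smooth] assms, of w 1 v] dird_homogeneous[OF _ assms(2)]
  by (simp add: second_dird_def)

lemma euler:
  assumes x: "x \<in> future_cone" shows "dird F x x = F x"
proof -
  have "((\<lambda>t. t *\<^sub>R x) has_derivative (\<lambda>t. t *\<^sub>R x)) (at (1::real))"
    by (auto intro!: derivative_eq_intros)
  moreover have "(F has_derivative dird F x) (at (1 *\<^sub>R x))"
    using smooth_on_has_derivative[OF smooth x] by simp
  ultimately have "((\<lambda>t. F (t *\<^sub>R x)) has_derivative (\<lambda>t. dird F x (t *\<^sub>R x))) (at 1)"
    using diff_chain_at[of "\<lambda>t. t *\<^sub>R x" _ 1 F] by (simp add: comp_def)
  then have "((\<lambda>t. t *\<^sub>R F x) has_derivative (\<lambda>t. dird F x (t *\<^sub>R x))) (at 1)"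
    by (rule has_derivative_transform_within_open[of _ _ _ _ "{0<..}"])
      (use homogeneous[OF x] in auto)
  moreover have "((\<lambda>t. t *\<^sub>R F x) has_derivative (\<lambda>t. t *\<^sub>R F x)) (at 1)"
    by (auto intro!: derivative_eq_intros)
  ultimately have "(\<lambda>t. dird F x (t *\<^sub>R x)) = (\<lambda>t. t *\<^sub>R F x)"
    by (rule has_derivative_unique)
  from fun_cong[OF this, of 1] show ?thesis by simp
qed

lemma second_euler:
  assumes x: "x \<in> future_cone" shows "second_dird F x v x = 0" "second_dird F x x v = 0"
proof -
  have "dird (\<lambda>y. dird F y y) x v = dird F x v"
    by (rule dird_transform[OF open_future_cone smooth x]) (rule euler[symmetric])
  then show "second_dird F x v x = 0"
    using dird_dird_field[OF open_future_cone smooth smooth_on_id x, of v] by simp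
  then show "second_dird F x x v = 0" using second_dird_sym[OF open_future_cone smooth x, of x v] by simp
qed

end

definition mink_norm :: "real^3 \<Rightarrow> real" where
  "mink_norm x = sqrt (- mink x x)"

definition hyp_retract :: "real^3 \<Rightarrow> real^3" where
  "hyp_retract x = inverse (mink_norm x) *\<^sub>R x"

definition homog_ext :: "(real^3 \<Rightarrow> 'b::euclidean_space) \<Rightarrow> real^3 \<Rightarrow> 'b" where
  "homog_ext W x = mink_norm x *\<^sub>R W (hyp_retract x)"

lemma mink_norm_pos: "x \<in> future_cone \<Longrightarrow> mink_norm x > 0"
  by (simp add: mink_norm_def future_cone_def)

lemma mink_norm_scale: "t > 0 \<Longrightarrow> mink_norm (t *\<^sub>R x) = t * mink_norm x"
proof -
  assume "t > 0"
  have eq: "- mink (t *\<^sub>R x) (t *\<^sub>R x) = t\<^sup>2 * (- mink x x)" by (simp add: mink_algebra power2_eq_square)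
  show ?thesis unfolding mink_norm_def eq real_sqrt_mult using \<open>t > 0\<close> by simp
qed

lemma mink_norm_hyp: "p \<in> hyp \<Longrightarrow> mink_norm p = 1"
  by (simp add: mink_norm_def hyp_mink_self)

lemma hyp_retract_hyp: "p \<in> hyp \<Longrightarrow> hyp_retract p = p"
  by (simp add: hyp_retract_def mink_norm_hyp)

lemma hyp_retract_scale: "x \<in> future_cone \<Longrightarrow> t > 0 \<Longrightarrow> hyp_retract (t *\<^sub>R x) = hyp_retract x"
  using mink_norm_pos[of x] by (simp add: hyp_retract_def mink_norm_scale)

lemma hyp_retract_in_hyp:
  assumes "x \<in> future_cone" shows "hyp_retract x \<in> hyp"
proof -
  have "(mink_norm x)\<^sup>2 = - mink x x" using assms by (simp add: mink_norm_def future_cone_def)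
  then show ?thesis using mink_norm_pos[OF assms] assms
    by (simp add: hyp_def hyp_retract_def mink_algebra future_cone_def field_simps power2_eq_square)
qed

lemma hyp_retract_decomp: "x \<in> future_cone \<Longrightarrow> x = mink_norm x *\<^sub>R hyp_retract x"
  using mink_norm_pos[of x] by (simp add: hyp_retract_def)

lemma smooth_on_mink_powr: "smooth_on future_cone (\<lambda>x. (- mink x x) powr a)"
proof (rule smooth_on_compose[OF open_future_cone open_greaterThan _ _ smooth_on_powr])
  show "smooth_on future_cone (\<lambda>x. - mink x x)"
    by (intro smooth_on_linear_comp[OF bounded_linear_minus[OF bounded_linear_ident]]
        smooth_on_bilinear[OF bounded_bilinear_mink] open_future_cone smooth_on_id)
qed (simp add: future_cone_def)

lemma smooth_on_mink_norm: "smooth_on future_cone mink_norm"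
  by (rule smooth_on_cong[OF open_future_cone smooth_on_mink_powr[of "1/2"]])
    (simp add: mink_norm_def future_cone_def powr_half_sqrt)

lemma smooth_on_hyp_retract: "smooth_on future_cone hyp_retract"
  by (rule smooth_on_cong[OF open_future_cone
      smooth_on_bilinear[OF bounded_bilinear_scaleR open_future_cone smooth_on_mink_powr[of "-1/2"] smooth_on_id]])
    (simp add: hyp_retract_def mink_norm_def future_cone_def powr_minus powr_half_sqrt)

lemma smooth_on_cone_imp_smooth_map: "smooth_on future_cone F \<Longrightarrow> smooth_map hyp F"
  by (rule smooth_mapI[OF open_future_cone hyp_subset_cone]) auto

text \<open>
  A smooth map on the hyperbolic plane has only local extensions by definition; composing with
  the radial retraction produces a canonical one on the whole cone.
\<close>

lemma smooth_on_homog_ext: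
  assumes "smooth_map hyp W" shows "smooth_on future_cone (homog_ext W)"
proof -
  have "smooth_map future_cone hyp_retract"
    by (rule smooth_mapI[OF open_future_cone subset_refl smooth_on_hyp_retract]) simp
  from smooth_map_compose[OF this assms hyp_retract_in_hyp]
  have W: "smooth_map future_cone (\<lambda>x. W (hyp_retract x))" .
  have "smooth_on future_cone (\<lambda>x. W (hyp_retract x))"
  proof (rule smooth_on_local)
    fix x assume x: "x \<in> future_cone"
    obtain U F where U: "open U" "x \<in> U" "smooth_on U F"
      "\<And>y. y \<in> future_cone \<inter> U \<Longrightarrow> F y = W (hyp_retract y)"
      using smooth_mapE[OF W x] by blast
    have "smooth_on (future_cone \<inter> U) (\<lambda>x. W (hyp_retract x))"
      by (rule smooth_on_cong[OF _ smooth_on_subset[OF U(3)]]) (use U open_future_cone in auto)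
    then show "\<exists>V. open V \<and> x \<in> V \<and> smooth_on V (\<lambda>x. W (hyp_retract x))"
      using U(1,2) x open_future_cone by (intro exI[of _ "future_cone \<inter> U"]) auto
  qed
  then show ?thesis
    unfolding homog_ext_def[abs_def]
    by (rule smooth_on_bilinear[OF bounded_bilinear_scaleR open_future_cone smooth_on_mink_norm])
qed

lemma homogeneous_homog_ext: "smooth_map hyp W \<Longrightarrow> homogeneous (homog_ext W)"
  by unfold_locales
    (auto simp: smooth_on_homog_ext homog_ext_def mink_norm_scale hyp_retract_scale)

lemma homog_ext_hyp: "p \<in> hyp \<Longrightarrow> homog_ext W p = W p"
  by (simp add: homog_ext_def mink_norm_hyp hyp_retract_hyp)

lemma (in homogeneous) homog_ext_restrict: "x \<in> future_cone \<Longrightarrow> homog_ext F x = F x"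
  unfolding homog_ext_def
  using homogeneous[of "hyp_retract x" "mink_norm x"] hyp_retract_in_hyp[of x] hyp_subset_cone
    mink_norm_pos[of x] hyp_retract_decomp[of x] by auto

lemma mderiv_cone_extension:
  assumes "smooth_on future_cone F" "p \<in> hyp" "v \<in> tangent_space hyp p" "\<And>q. q \<in> hyp \<Longrightarrow> f q = F q"
  shows "mderiv hyp f p v = dird F p v"
  by (rule mderiv_local_extension[OF open_future_cone _ assms(2,1) _ assms(3)])
    (use assms hyp_subset_cone in auto)

lemma mderiv_homog_ext:
  assumes "smooth_map hyp W" "p \<in> hyp" "v \<in> tangent_space hyp p"
  shows "mderiv hyp W p v = dird (homog_ext W) p v"
  by (rule mderiv_cone_extension[OF smooth_on_homog_ext[OF assms(1)] assms(2,3)]) (simp add: homog_ext_hyp)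

lemma mderiv_mderiv:
  assumes V: "smooth_map hyp V" and Y: "vector_field hyp Y" and p: "p \<in> hyp" "v \<in> tangent_space hyp p"
  shows "mderiv hyp (\<lambda>q. mderiv hyp V q (Y q)) p v
    = second_dird (homog_ext V) p v (Y p) + dird (homog_ext V) p (mderiv hyp Y p v)"
proof -
  note V' = smooth_on_homog_ext[OF V] and Y' = smooth_on_homog_ext[OF vector_fieldD(1)[OF Y]]
  have "mderiv hyp (\<lambda>q. mderiv hyp V q (Y q)) p v = dird (\<lambda>q. dird (homog_ext V) q (homog_ext Y q)) p v"
    by (rule mderiv_cone_extension[OF smooth_on_dird_field[OF open_future_cone V' Y'] p])
      (simp add: mderiv_homog_ext[OF V] vector_fieldD(2)[OF Y] homog_ext_hyp)
  also have "\<dots> = second_dird (homog_ext V) p v (homog_ext Y p) + dird (homog_ext V) p (dird (homog_ext Y) p v)"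
    by (rule dird_dird_field[OF open_future_cone V' Y']) (use p hyp_subset_cone in auto)
  finally show ?thesis by (simp add: homog_ext_hyp p mderiv_homog_ext[OF vector_fieldD(1)[OF Y]])
qed

lemma homog_ext_tangent:
  assumes "vector_field hyp V" "x \<in> future_cone"
  shows "mink x (homog_ext V x) = 0"
proof -
  have "mink (hyp_retract x) (V (hyp_retract x)) = 0"
    using vector_fieldD(2)[OF assms(1) hyp_retract_in_hyp[OF assms(2)]]
      tangent_space_hyp[OF hyp_retract_in_hyp[OF assms(2)]] by simp
  then show ?thesis
    using mink_norm_pos[OF assms(2)] by (simp add: homog_ext_def hyp_retract_def mink_algebra)
qed

lemma mink_dird_homog_ext:
  assumes V: "vector_field hyp V" and x: "x \<in> future_cone"
  shows "mink x (dird (homog_ext V) x v) = - mink v (homog_ext V x)"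
proof -
  have "dird (\<lambda>y. mink y (homog_ext V y)) x v = mink x (dird (homog_ext V) x v) + mink v (homog_ext V x)"
    using dird_bilinear[OF bounded_bilinear_mink smooth_on_id smooth_on_homog_ext[OF vector_fieldD(1)[OF V]] x]
    by simp
  moreover have "dird (\<lambda>y. mink y (homog_ext V y)) x v = 0"
    using dird_transform[OF open_future_cone smooth_on_const x, of 0 "\<lambda>y. mink y (homog_ext V y)" v]
      homog_ext_tangent[OF V] by simp
  ultimately show ?thesis by simp
qed


section \<open>Graphs in Half-Pipe space\<close>

definition mink_grad :: "(real^3 \<Rightarrow> real) \<Rightarrow> real^3 \<Rightarrow> real^3" where
  "mink_grad U x = dird U x (axis 2 1) *\<^sub>R axis 2 1 + dird U x (axis 3 1) *\<^sub>R axis 3 1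
     - dird U x (axis 1 1) *\<^sub>R axis 1 1"

lemma linear_minkowski_expand:
  fixes L :: "real^3 \<Rightarrow> 'b::real_vector"
  assumes "linear L"
  shows "L w = (w $ 1) *\<^sub>R L (axis 1 1) + (w $ 2) *\<^sub>R L (axis 2 1) + (w $ 3) *\<^sub>R L (axis 3 1)"
proof -
  have "w = (w $ 1) *\<^sub>R axis 1 1 + (w $ 2) *\<^sub>R axis 2 1 + (w $ 3) *\<^sub>R axis 3 1"
    by (simp add: vec_eq_iff forall_3 axis_def)
  then have "L w = L ((w $ 1) *\<^sub>R axis 1 1 + (w $ 2) *\<^sub>R axis 2 1 + (w $ 3) *\<^sub>R axis 3 1)" by simp
  then show ?thesis by (simp only: linear_add[OF assms] linear_scale[OF assms])
qed

lemma mink_mink_grad: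
  assumes "smooth_on future_cone U" "x \<in> future_cone"
  shows "mink (mink_grad U x) w = dird U x w"
  unfolding mink_grad_def mink_algebra mink_sym[of "axis _ _"] mink_axis
  by (subst linear_minkowski_expand[OF dird_linear[OF assms], of w]) (simp add: mult.commute)

lemma mink_grad_unique:
  assumes "smooth_on future_cone U" "x \<in> future_cone" "\<And>w. mink \<sigma> w = dird U x w"
  shows "mink_grad U x = \<sigma>"
  using mink_nondegenerate[of "mink_grad U x - \<sigma>"] mink_mink_grad[OF assms(1,2)] assms(3)
  by (simp add: mink_algebra)

lemma smooth_on_mink_grad:
  assumes "smooth_on future_cone U" shows "smooth_on future_cone (mink_grad U)"
proof -
  have t: "smooth_on future_cone (\<lambda>x. dird U x a *\<^sub>R b)" for a b :: "real^3"
    by (intro smooth_on_bilinear[OF bounded_bilinear_scaleR] open_future_cone smooth_on_dird assms smooth_on_const)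
  have "smooth_on future_cone (\<lambda>x. dird U x (axis 2 1) *\<^sub>R axis 2 1 + dird U x (axis 3 1) *\<^sub>R axis 3 1
     + dird U x (axis 1 1) *\<^sub>R (- axis 1 1 :: real^3))"
    by (intro smooth_on_add open_future_cone t)
  then show ?thesis by (simp add: mink_grad_def[abs_def])
qed

lemma mink_dird_mink_grad:
  assumes "smooth_on future_cone U" "x \<in> future_cone"
  shows "mink (dird (mink_grad U) x v) w = second_dird U x v w"
proof -
  have "dird (\<lambda>y. mink (mink_grad U y) w) x v = mink (dird (mink_grad U) x v) w"
    using dird_bilinear[OF bounded_bilinear_mink smooth_on_mink_grad[OF assms(1)] smooth_on_const assms(2)]
    by (simp add: mink_algebra)
  moreover have "dird (\<lambda>y. mink (mink_grad U y) w) x v = dird (\<lambda>y. dird U y w) x v"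
    by (rule dird_transform[OF open_future_cone smooth_on_dird[OF assms(1)] assms(2)])
      (rule mink_mink_grad[OF assms(1), symmetric])
  ultimately show ?thesis by (simp add: second_dird_def)
qed

text \<open>
  The gradient of the extension has tangential part \<open>grad u\<close>, and Euler's identity determines
  its normal part: \<open>mink_grad U p = grad u - u p\<close>.
\<close>

lemma gradient_hyp:
  assumes u: "smooth_map hyp u" and p: "p \<in> hyp"
  shows "gradient hyp hyp_metric u p = mink_grad (homog_ext u) p + u p *\<^sub>R p"
proof -
  interpret U: homogeneous "homog_ext u" by (rule homogeneous_homog_ext[OF u])
  have pc: "p \<in> future_cone" using p hyp_subset_cone by auto
  note grad = mink_mink_grad[OF U.smooth pc]
  let ?w = "mink_grad (homog_ext u) p + u p *\<^sub>R p"
  have pw: "mink p ?w = 0"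
    using grad[of p] U.euler[OF pc] by (simp add: mink_algebra hyp_mink_self[OF p] homog_ext_hyp[OF p] mink_sym[of p "mink_grad _ _"])
  have D: "mink ?w v = mderiv hyp u p v" if "v \<in> tangent_space hyp p" for v
    using that mderiv_homog_ext[OF u p that] grad by (simp add: mink_algebra tangent_space_hyp[OF p])
  show ?thesis
    unfolding gradient_def hyp_metric_def
  proof (rule the_equality)
    show "?w \<in> tangent_space hyp p \<and> (\<forall>v\<in>tangent_space hyp p. mink ?w v = mderiv hyp u p v)"
      using pw D by (simp add: tangent_space_hyp[OF p])
    fix w assume w: "w \<in> tangent_space hyp p \<and> (\<forall>v\<in>tangent_space hyp p. mink w v = mderiv hyp u p v)"
    have "w - ?w = 0"
    proof (rule hyp.tangent_nondegenerate[OF p])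
      show "w - ?w \<in> tangent_space hyp p" using w pw by (simp add: tangent_space_hyp[OF p] mink_algebra)
    qed (use w D in \<open>simp add: mink_algebra\<close>)
    then show "w = ?w" by simp
  qed
qed

text \<open>
  Differentiating \<open>grad u = mink_grad U + u p\<close> yields the additional tangential term \<open>u v\<close>, which
  the shape operator subtracts.
\<close>

lemma shape_operator_eq:
  assumes u: "smooth_map hyp u" and p: "p \<in> hyp" and v: "v \<in> tangent_space hyp p"
  shows "shape_operator u p v = dird (mink_grad (homog_ext u)) p v"
proof -
  interpret U: homogeneous "homog_ext u" by (rule homogeneous_homog_ext[OF u])
  have pc: "p \<in> future_cone" using p hyp_subset_cone by auto
  note G = smooth_on_mink_grad[OF U.smooth]
  have G': "smooth_map hyp (mink_grad (homog_ext u))" by (rule smooth_on_cone_imp_smooth_map[OF G])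
  let ?g = "\<lambda>q. mink_grad (homog_ext u) q + u q *\<^sub>R q"
  have uq: "smooth_map hyp (\<lambda>q. u q *\<^sub>R q)" by (rule smooth_map_scaleR[OF u smooth_map_id])
  have g: "smooth_map hyp ?g" by (rule smooth_map_add[OF G' uq])
  have field: "vector_field hyp (gradient hyp hyp_metric u)"
    unfolding vector_field_def section_along_def
  proof (intro conjI ballI)
    show "smooth_map hyp (gradient hyp hyp_metric u)"
      by (rule smooth_map_cong[OF g]) (simp add: gradient_hyp[OF u])
    fix q assume q: "q \<in> hyp"
    then show "gradient hyp hyp_metric u q \<in> tangent_space hyp q"
      using mink_mink_grad[OF U.smooth, of q q] U.euler[of q] hyp_subset_cone
      by (auto simp: gradient_hyp[OF u] tangent_space_hyp mink_algebra hyp_mink_self homog_ext_hyp mink_sym[of q "mink_grad _ _"])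
  qed
  have pv: "mink p v = 0" "mink v p = 0" using v tangent_space_hyp[OF p] mink_sym[of v p] by simp_all
  have "mderiv hyp (gradient hyp hyp_metric u) p v = mderiv hyp ?g p v"
    by (rule mderiv_cong[OF p gradient_hyp[OF u]])
  also have "\<dots> = dird (mink_grad (homog_ext u)) p v + (u p *\<^sub>R v + dird (homog_ext u) p v *\<^sub>R p)"
    using mderiv_add[OF G' uq p v] mderiv_scaleR[OF u smooth_map_id p v] mderiv_id[OF v]
      mderiv_cone_extension[OF G p v refl] mderiv_homog_ext[OF u p v] by simp
  finally have "hyp_nabla p v (gradient hyp hyp_metric u) = dird (mink_grad (homog_ext u)) p v + u p *\<^sub>R v"
    using mink_mink_grad[OF U.smooth pc, of v] pv
    by (simp add: hyp_nabla_eq[OF field p v] gradient_hyp[OF u p] mink_algebra mink_sym[of v "mink_grad _ _"])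
  then show ?thesis by (simp add: shape_operator_def hessian_def)
qed

text \<open>
  Mean surfaces correspond to the solutions of the wave equation that are homogeneous of degree one.
\<close>

lemma mean_surface_iff:
  assumes u: "smooth_map hyp u"
  shows "mean_surface u \<longleftrightarrow> (\<forall>p\<in>hyp. mink_trace (second_dird (homog_ext u) p) = 0)"
proof -
  interpret U: homogeneous "homog_ext u" by (rule homogeneous_homog_ext[OF u])
  have "endo_trace hyp hyp_metric p (shape_operator u p) = mink_trace (second_dird (homog_ext u) p)"
    if p: "p \<in> hyp" for p
  proof -
    have pc: "p \<in> future_cone" using p hyp_subset_cone by auto
    have "endo_trace hyp hyp_metric p (shape_operator u p)
        = mink_trace (second_dird (homog_ext u) p) + second_dird (homog_ext u) p p p"
      unfolding endo_trace_def
      by (rule metric_trace_hyp[OF p second_dird_linear1[OF U.smooth pc]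
            second_dird_linear2[OF open_future_cone U.smooth pc]])
        (simp add: hyp_metric_def shape_operator_eq[OF u p] mink_dird_mink_grad[OF U.smooth pc])
    then show ?thesis using U.second_euler(1)[OF pc] by simp
  qed
  then show ?thesis by (simp add: mean_surface_def)
qed


subsection \<open>The associated field\<close>

text \<open>
  The Klein model is the slice of the cone at height one; a function on the disk is compared with
  homogeneous functions on the cone through this slice.
\<close>

definition affine_lift :: "real^2 \<Rightarrow> real^3" where
  "affine_lift \<eta> = vector [1, \<eta> $ 1, \<eta> $ 2]"

definition linear_lift :: "real^2 \<Rightarrow> real^3" where
  "linear_lift a = vector [0, a $ 1, a $ 2]"

lemma affine_lift_add: "affine_lift (\<eta> + a) = affine_lift \<eta> + linear_lift a"
  by (simp add: affine_lift_def linear_lift_def vec_eq_iff forall_3 vector_3)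

lemma linear_linear_lift: "linear linear_lift"
  by (intro linearI) (simp_all add: linear_lift_def vec_eq_iff forall_3 vector_3)

lemma norm_square_2: "(norm (\<eta>::real^2))\<^sup>2 = (\<eta> $ 1)\<^sup>2 + (\<eta> $ 2)\<^sup>2"
  unfolding power2_norm_eq_inner by (simp add: inner_vec_def sum_2 power2_eq_square)

lemma mink_affine_lift: "mink (affine_lift \<eta>) (affine_lift \<eta>) = (norm \<eta>)\<^sup>2 - 1"
  unfolding norm_square_2 by (simp add: mink_def affine_lift_def vector_3 power2_eq_square)

lemma affine_lift_cone: "affine_lift \<eta> \<in> future_cone \<longleftrightarrow> \<eta> \<in> unit_disk"
proof -
  have "affine_lift \<eta> \<in> future_cone \<longleftrightarrow> (norm \<eta>)\<^sup>2 < 1"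
    by (simp add: future_cone_def mink_affine_lift) (simp add: affine_lift_def vector_3)
  also have "\<dots> \<longleftrightarrow> norm \<eta> < 1" by (simp add: power_less_one_iff abs_square_less_1)
  finally show ?thesis by simp
qed

lemma affine_lift_klein: "p \<in> hyp \<Longrightarrow> p = (p $ 1) *\<^sub>R affine_lift (klein p)"
  by (simp add: affine_lift_def klein_def vec_eq_iff forall_3 vector_3 hyp_def)

lemma klein_in_disk:
  assumes "p \<in> hyp" shows "klein p \<in> unit_disk"
proof -
  have p: "p $ 1 > 0" "p \<in> future_cone" using assms hyp_subset_cone by (auto simp: hyp_def)
  have "affine_lift (klein p) = inverse (p $ 1) *\<^sub>R p"
    using p(1) affine_lift_klein[OF assms]
    by (metis less_numeral_extra(3) scaleR_scaleR left_inverse scaleR_one)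
  then have "affine_lift (klein p) \<in> future_cone"
    using future_cone_scale[OF p(2), of "inverse (p $ 1)"] p(1) by simp
  then show ?thesis by (rule affine_lift_cone[THEN iffD1])
qed

lemma inv_klein:
  assumes "\<eta> \<in> unit_disk"
  shows "inv_into hyp klein \<eta> = hyp_retract (affine_lift \<eta>)"
proof -
  have c: "affine_lift \<eta> \<in> future_cone" using assms affine_lift_cone by simp
  have "inj_on klein hyp"
  proof (rule inj_onI)
    fix p q assume pq: "p \<in> hyp" "q \<in> hyp" "klein p = klein q"
    have "hyp_retract p = hyp_retract (affine_lift (klein p))" if "p \<in> hyp" for p
      using hyp_retract_scale[of "affine_lift (klein p)" "p $ 1", folded affine_lift_klein[OF that]]
        klein_in_disk[OF that] affine_lift_cone that unfolding hyp_def by blast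
    then show "p = q" using pq hyp_retract_hyp by metis
  qed
  moreover have "klein (hyp_retract (affine_lift \<eta>)) = \<eta>"
    using mink_norm_pos[OF c]
    by (simp add: klein_def hyp_retract_def affine_lift_def vec_eq_iff forall_2 vector_3 vector_2)
  ultimately show ?thesis using hyp_retract_in_hyp[OF c] by (intro inv_into_f_eq)
qed

text \<open>
  The factor in the Klein model is the Minkowski norm of the lift, as required by degree one.
\<close>

lemma klein_function_eq:
  assumes "\<eta> \<in> unit_disk"
  shows "klein_function u \<eta> = homog_ext u (affine_lift \<eta>)"
  by (simp add: klein_function_def inv_klein[OF assms] homog_ext_def mink_norm_def mink_affine_lift)

lemma has_derivative_affine_lift:
  assumes "smooth_on future_cone U" "\<eta> \<in> unit_disk"
  shows "((\<lambda>\<eta>. U (affine_lift \<eta>)) has_derivative (\<lambda>a. dird U (affine_lift \<eta>) (linear_lift a))) (at \<eta>)"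
proof -
  have e: "affine_lift 0 + linear_lift \<xi> = affine_lift \<xi>" for \<xi>
    using affine_lift_add[of 0 \<xi>] by (simp only: add_0)
  have "((\<lambda>\<eta>. affine_lift 0 + linear_lift \<eta>) has_derivative linear_lift) (at \<eta>)"
    using linear_imp_has_derivative[OF linear_linear_lift, of "at \<eta>"]
    by (auto intro!: derivative_eq_intros)
  then have "(affine_lift has_derivative linear_lift) (at \<eta>)"
    by (rule has_derivative_transform_within_open[OF _ open_UNIV UNIV_I]) (rule e)
  from diff_chain_at[OF this smooth_on_has_derivative[OF assms(1)]] show ?thesis
    using assms(2) affine_lift_cone by (simp add: comp_def)
qed

text \<open>
  The tangent space is defined by curves that stay in the surface for all times, hence the
  bounded reparametrisation by the sine.
\<close>

lemma tangent_space_klein_graph: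
  assumes u: "smooth_map hyp u" and \<eta>: "\<eta> \<in> unit_disk"
  defines "U \<equiv> homog_ext u"
  shows "tangent_space (klein_graph u) (\<eta>, klein_function u \<eta>)
    = {(a, dird U (affine_lift \<eta>) (linear_lift a)) | a. True}"
proof -
  have U: "smooth_on future_cone U" unfolding U_def by (rule smooth_on_homog_ext[OF u])
  note dU = has_derivative_affine_lift[OF U]
  have lin: "linear (\<lambda>a. dird U (affine_lift \<eta>) (linear_lift a))"
    using has_derivative_linear[OF dU[OF \<eta>]] .
  have graph: "klein_graph u = {(\<xi>, U (affine_lift \<xi>)) | \<xi>. \<xi> \<in> unit_disk}"
    unfolding klein_graph_def U_def using klein_function_eq by (metis (no_types, opaque_lifting))
  have along: "((\<lambda>t. U (affine_lift (c t))) has_vector_derivative dird U (affine_lift \<eta>) (linear_lift a)) (at 0)"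
    if "(c has_vector_derivative a) (at 0)" "c 0 = \<eta>" for c :: "real \<Rightarrow> real^2" and a
  proof -
    from diff_chain_at[OF that(1)[unfolded has_vector_derivative_def], of "\<lambda>\<eta>. U (affine_lift \<eta>)"] dU[OF \<eta>] that(2)
    have "((\<lambda>t. U (affine_lift (c t))) has_derivative (\<lambda>t. dird U (affine_lift \<eta>) (linear_lift (t *\<^sub>R a)))) (at 0)"
      by (simp add: comp_def)
    then show ?thesis using linear_scale[OF lin] by (simp add: has_vector_derivative_def)
  qed
  show ?thesis
  proof (intro equalityI subsetI)
    fix w assume "w \<in> tangent_space (klein_graph u) (\<eta>, klein_function u \<eta>)"
    then obtain \<gamma> :: "real \<Rightarrow> (real^2) \<times> real" where \<gamma>: "\<And>t. \<gamma> t \<in> klein_graph u"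
      "\<gamma> 0 = (\<eta>, klein_function u \<eta>)" "(\<gamma> has_vector_derivative w) (at 0)"
      unfolding tangent_space_def by blast
    have 1: "((\<lambda>t. fst (\<gamma> t)) has_vector_derivative fst w) (at 0)"
      and 2: "((\<lambda>t. snd (\<gamma> t)) has_vector_derivative snd w) (at 0)"
      using bounded_linear.has_vector_derivative[OF bounded_linear_fst \<gamma>(3)]
        bounded_linear.has_vector_derivative[OF bounded_linear_snd \<gamma>(3)] by auto
    have "snd (\<gamma> t) = U (affine_lift (fst (\<gamma> t)))" for t using \<gamma>(1)[of t] unfolding graph by auto
    then have "((\<lambda>t. snd (\<gamma> t)) has_vector_derivative dird U (affine_lift \<eta>) (linear_lift (fst w))) (at 0)"
      using along[OF 1] \<gamma>(2) by simp
    from vector_derivative_unique_at[OF 2 this]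
    show "w \<in> {(a, dird U (affine_lift \<eta>) (linear_lift a)) | a. True}" by (cases w) auto
  next
    fix w assume "w \<in> {(a, dird U (affine_lift \<eta>) (linear_lift a)) | a. True}"
    then obtain a where w: "w = (a, dird U (affine_lift \<eta>) (linear_lift a))" by blast
    obtain r where r: "r > 0" "ball \<eta> r \<subseteq> unit_disk" using \<eta> open_ball openE by blast
    define \<delta> where "\<delta> = r / (norm a + 1)"
    have na: "norm a + 1 > 0" by (smt (verit) norm_ge_zero)
    have \<delta>: "\<delta> > 0" "\<delta> * norm a < r" using r na by (auto simp: \<delta>_def field_simps)
    define c where "c t = \<eta> + (\<delta> * sin (t / \<delta>)) *\<^sub>R a" for t
    have "((\<lambda>t. \<delta> * sin (t / \<delta>)) has_real_derivative 1) (at 0)"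
      using \<delta>(1) by (auto intro!: derivative_eq_intros)
    then have "((\<lambda>t. (\<delta> * sin (t / \<delta>)) *\<^sub>R a) has_vector_derivative 1 *\<^sub>R a) (at 0)"
      using has_vector_derivative_scaleR[OF _ has_vector_derivative_const, of _ 1 0 UNIV a] by simp
    then have "((\<lambda>t. \<eta> + (\<delta> * sin (t / \<delta>)) *\<^sub>R a) has_vector_derivative 0 + 1 *\<^sub>R a) (at 0)"
      by (rule has_vector_derivative_add[OF has_vector_derivative_const])
    then have c: "(c has_vector_derivative a) (at 0)" "c 0 = \<eta>"
      by (simp_all add: c_def[abs_def])
    have disk: "c t \<in> unit_disk" for t
    proof -
      have "dist \<eta> (c t) = \<delta> * \<bar>sin (t / \<delta>)\<bar> * norm a" using \<delta>(1) by (simp add: c_def dist_norm abs_mult)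
      also have "\<dots> \<le> \<delta> * 1 * norm a" using \<delta>(1) by (intro mult_right_mono mult_left_mono) auto
      finally have "c t \<in> ball \<eta> r" using \<delta>(2) by simp
      then show ?thesis using r(2) by blast
    qed
    have "((\<lambda>t. (c t, U (affine_lift (c t)))) has_vector_derivative w) (at 0)"
      unfolding w by (rule has_vector_derivative_Pair[OF c(1) along[OF c]])
    moreover have "(c 0, U (affine_lift (c 0))) = (\<eta>, klein_function u \<eta>)"
      using klein_function_eq[OF \<eta>, of u] c(2) by (simp add: U_def)
    moreover have "(c t, U (affine_lift (c t))) \<in> klein_graph u" for t unfolding graph using disk by blast
    ultimately show "w \<in> tangent_space (klein_graph u) (\<eta>, klein_function u \<eta>)"
      by (intro tangent_spaceI[of "\<lambda>t. (c t, U (affine_lift (c t)))"])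
  qed
qed

text \<open>
  Restricted to the slice of height one, the affine approximation of \<open>U\<close> at a point is by Euler's
  identity the linear function given by its derivative, that is, the pairing with \<open>mink_grad U\<close>.
  This is the defining equation of a plane \<open>P\<^sub>\<sigma>\<close>. The gradient is constant along rays, so it may be
  taken at \<open>p\<close> instead of the point of the slice.
\<close>

lemma associated_field_eq:
  assumes u: "smooth_map hyp u" and p: "p \<in> hyp"
  shows "associated_field u p = p \<boxtimes> mink_grad (homog_ext u) p"
proof -
  interpret U: homogeneous "homog_ext u" by (rule homogeneous_homog_ext[OF u])
  let ?U = "homog_ext u" and ?\<eta> = "klein p"
  let ?x = "affine_lift ?\<eta>"
  have \<eta>: "?\<eta> \<in> unit_disk" by (rule klein_in_disk[OF p])
  then have x: "?x \<in> future_cone" using affine_lift_cone by simp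
  have pc: "p \<in> future_cone" using p hyp_subset_cone by auto
  have "dird ?U p w = dird ?U ?x w" for w
    using U.dird_homogeneous[OF x, of "p $ 1" w, folded affine_lift_klein[OF p]] p by (simp add: hyp_def)
  then have grad: "mink (mink_grad ?U p) w = dird ?U ?x w" for w
    using mink_mink_grad[OF U.smooth pc] by simp
  have tp: "tangent_plane (klein_graph u) (?\<eta>, klein_function u ?\<eta>)
      = {(\<xi>, dird ?U ?x (affine_lift \<xi>)) | \<xi>. \<xi> \<in> unit_disk}"
  proof -
    have "klein_function u ?\<eta> + dird ?U ?x (linear_lift a) = dird ?U ?x (affine_lift (?\<eta> + a))" for a
      by (simp add: klein_function_eq[OF \<eta>] affine_lift_add linear_add[OF dird_linear[OF U.smooth x]] U.euler[OF x])
    then have "tangent_plane (klein_graph u) (?\<eta>, klein_function u ?\<eta>)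
        = {(?\<eta> + a, dird ?U ?x (affine_lift (?\<eta> + a))) | a. ?\<eta> + a \<in> unit_disk}"
      unfolding tangent_plane_def tangent_space_klein_graph[OF u \<eta>] by auto
    also have "\<dots> = {(\<xi>, dird ?U ?x (affine_lift \<xi>)) | \<xi>. \<xi> \<in> unit_disk}"
      by (auto intro: exI[of _ "_ - ?\<eta>"])
    finally show ?thesis .
  qed
  have "(THE \<sigma>. plane \<sigma> = tangent_plane (klein_graph u) (?\<eta>, klein_function u ?\<eta>)) = mink_grad ?U p"
  proof (rule the_equality)
    show "plane (mink_grad ?U p) = tangent_plane (klein_graph u) (?\<eta>, klein_function u ?\<eta>)"
      unfolding tp plane_def affine_lift_def[symmetric] mink_sym[of "affine_lift _"] grad by auto
    fix \<sigma> assume "plane \<sigma> = tangent_plane (klein_graph u) (?\<eta>, klein_function u ?\<eta>)"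
    then have eq: "{(\<eta>, t). \<eta> \<in> unit_disk \<and> mink \<sigma> (affine_lift \<eta>) = t}
        = {(\<xi>, dird ?U ?x (affine_lift \<xi>)) | \<xi>. \<xi> \<in> unit_disk}"
      unfolding tp plane_def affine_lift_def[symmetric] mink_sym[of "affine_lift _"] .
    have "mink (mink_grad ?U p - \<sigma>) (affine_lift \<xi>) = 0" if "\<xi> \<in> unit_disk" for \<xi>
    proof -
      have "(\<xi>, dird ?U ?x (affine_lift \<xi>)) \<in> {(\<eta>, t). \<eta> \<in> unit_disk \<and> mink \<sigma> (affine_lift \<eta>) = t}"
        unfolding eq using that by blast
      then show ?thesis by (simp add: mink_algebra grad)
    qed
    moreover have "(1/2) *\<^sub>R axis i (1::real) \<in> unit_disk" for i :: 2 by simp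
    moreover have "0 \<in> unit_disk" by simp
    ultimately have "mink (mink_grad ?U p - \<sigma>) (affine_lift 0) = 0"
      "mink (mink_grad ?U p - \<sigma>) (affine_lift ((1/2) *\<^sub>R axis 1 1)) = 0"
      "mink (mink_grad ?U p - \<sigma>) (affine_lift ((1/2) *\<^sub>R axis 2 1)) = 0" by blast+
    then    have "mink_grad ?U p - \<sigma> = 0"
      by (simp add: mink_def affine_lift_def vector_3 vec_eq_iff forall_3 axis_def)
    then show "\<sigma> = mink_grad ?U p" by simp
  qed
  then show ?thesis by (simp add: associated_field_def)
qed


section \<open>The tangent bundle as a submanifold\<close>

text \<open>
  The tangent bundle sits in the space of pairs of Minkowski vectors. This constant form of
  signature \<open>(3, 3)\<close> induces the metric of the tangent bundle on it: the horizontal lift of \<open>w\<close>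
  at \<open>(x, v)\<close> differs from \<open>(w, 0)\<close> only by a multiple of \<open>(0, x)\<close>, which is orthogonal to all
  tangent vectors.
\<close>

definition bundle_form :: "(real^3) \<times> (real^3) \<Rightarrow> (real^3) \<times> (real^3) \<Rightarrow> real" where
  "bundle_form z z' = mink (fst z) (snd z') + mink (snd z) (fst z')"

lemma bounded_bilinear_bundle_form: "bounded_bilinear bundle_form"
  unfolding bilinear_conv_bounded_bilinear[symmetric] bilinear_def
  by (auto intro!: linearI simp: bundle_form_def mink_algebra algebra_simps)

lemma bundle_form_sym: "bundle_form z z' = bundle_form z' z"
  by (simp add: bundle_form_def mink_sym)

lemma bundle_form_nondegenerate:
  assumes "\<And>w. bundle_form v w = 0" shows "v = 0"
proof -
  have "mink (fst v) w = 0" "mink (snd v) w = 0" for w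
    using assms[of "(0, w)"] assms[of "(w, 0)"] by (auto simp: bundle_form_def mink_algebra)
  then show ?thesis using mink_nondegenerate by (metis prod_eq_iff fst_zero snd_zero)
qed

text \<open>The two normal directions at \<open>(x, v)\<close> are \<open>(0, x)\<close> and \<open>(x, v)\<close>; they are null with product \<open>-1\<close>.\<close>

definition bundle_proj :: "(real^3) \<times> (real^3) \<Rightarrow> (real^3) \<times> (real^3) \<Rightarrow> (real^3) \<times> (real^3)" where
  "bundle_proj q z = z + bundle_form z q *\<^sub>R (0, fst q) + bundle_form z (0, fst q) *\<^sub>R q"

lemma hyp_TB_iff: "(x, v) \<in> hyp_TB \<longleftrightarrow> x \<in> hyp \<and> mink x v = 0"
  by (auto simp: hyp_TB_def tangent_space_hyp)

lemma tangent_space_TB_subset: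
  assumes "(a, b) \<in> tangent_space hyp_TB (x, v)"
  shows "mink x a = 0 \<and> mink a v + mink x b = 0"
proof -
  obtain \<gamma> :: "real \<Rightarrow> (real^3) \<times> (real^3)" where \<gamma>: "\<And>t. \<gamma> t \<in> hyp_TB" "\<gamma> 0 = (x, v)" "(\<gamma> has_vector_derivative (a, b)) (at 0)"
    using assms unfolding tangent_space_def by blast
  have d: "((\<lambda>t. fst (\<gamma> t)) has_vector_derivative a) (at 0)" "((\<lambda>t. snd (\<gamma> t)) has_vector_derivative b) (at 0)"
    using bounded_linear.has_vector_derivative[OF bounded_linear_fst \<gamma>(3)]
      bounded_linear.has_vector_derivative[OF bounded_linear_snd \<gamma>(3)] by auto
  have \<gamma>': "fst (\<gamma> t) \<in> hyp" "mink (fst (\<gamma> t)) (snd (\<gamma> t)) = 0" for t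
    using \<gamma>(1)[of t] hyp_TB_iff[of "fst (\<gamma> t)" "snd (\<gamma> t)"] by auto
  show ?thesis
    using mink_tangent_derivative[OF d(1,1), of "-1"] mink_tangent_derivative[OF d, of 0] \<gamma>' \<gamma>(2)
      hyp_mink_self mink_sym[of a x] by simp
qed

text \<open>
  The base curve is lifted by projecting the straight line through \<open>v\<close> with direction \<open>b\<close> to the
  tangent planes along it.
\<close>

lemma tangent_space_TB_superset:
  assumes q: "(x, v) \<in> hyp_TB" and a: "mink x a = 0" and b: "mink a v + mink x b = 0"
  shows "(a, b) \<in> tangent_space hyp_TB (x, v)"
proof -
  have x: "x \<in> hyp" "mink x v = 0" using q hyp_TB_iff by auto
  define \<alpha> where "\<alpha> = (\<lambda>t. sqrt (1 + t\<^sup>2 * mink a a) *\<^sub>R x + t *\<^sub>R a)"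
  have \<alpha>: "\<And>t. \<alpha> t \<in> hyp" "\<alpha> 0 = x" "(\<alpha> has_vector_derivative a) (at 0)"
    unfolding \<alpha>_def by (rule hyp_tangent_curve[OF x(1) a])+
  define \<beta> where "\<beta> t = hyp_proj (\<alpha> t) (v + t *\<^sub>R b)" for t
  have w: "((\<lambda>t. v + t *\<^sub>R b) has_vector_derivative b) (at 0)"
    by (auto intro!: derivative_eq_intros)
  have "(\<beta> has_vector_derivative (b + (mink (\<alpha> 0) (v + 0 *\<^sub>R b) *\<^sub>R a
      + (mink (\<alpha> 0) b + mink a (v + 0 *\<^sub>R b)) *\<^sub>R \<alpha> 0))) (at 0)"
    unfolding \<beta>_def hyp_proj_def
    by (intro has_vector_derivative_add w bounded_bilinear.has_vector_derivative[OF bounded_bilinear_scaleR]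
        bounded_bilinear.has_vector_derivative[OF bounded_bilinear_mink] \<alpha>(3))
  then have \<beta>: "(\<beta> has_vector_derivative b) (at 0)" using \<alpha>(2) x(2) b by (simp add: add.commute)
  have "((\<lambda>t. (\<alpha> t, \<beta> t)) has_vector_derivative (a, b)) (at 0)"
    by (rule has_vector_derivative_Pair[OF \<alpha>(3) \<beta>])
  moreover have "(\<alpha> 0, \<beta> 0) = (x, v)" using \<alpha>(2) x(2) by (simp add: \<beta>_def hyp_proj_def)
  moreover have "(\<alpha> t, \<beta> t) \<in> hyp_TB" for t
    using \<alpha>(1)[of t] by (simp add: hyp_TB_iff \<beta>_def hyp_proj_def mink_algebra hyp_mink_self)
  ultimately show ?thesis by (intro tangent_spaceI[of "\<lambda>t. (\<alpha> t, \<beta> t)"])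
qed

lemma tangent_space_TB:
  assumes "q \<in> hyp_TB"
  shows "z \<in> tangent_space hyp_TB q \<longleftrightarrow> bundle_form z (0, fst q) = 0 \<and> bundle_form z q = 0"
  using tangent_space_TB_subset[of "fst z" "snd z" "fst q" "snd q"]
    tangent_space_TB_superset[of "fst q" "snd q" "fst z" "snd z"] assms
  by (auto simp: bundle_form_def mink_algebra mink_sym[of "fst z" "fst q"] mink_sym[of "snd z" "fst q"])

lemma bundle_normals:
  assumes "q \<in> hyp_TB"
  shows "bundle_form (0, fst q) (0, fst q) = 0" "bundle_form (0, fst q) q = -1"
    "bundle_form q (0, fst q) = -1" "bundle_form q q = 0"
  using assms hyp_TB_iff[of "fst q" "snd q"] mink_sym[of "snd q" "fst q"]
  by (auto simp: bundle_form_def mink_algebra hyp_mink_self)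

text \<open>
  The derivative of a field that is parallel in the direction \<open>w\<close> is normal, and its normal part
  is determined by the value of the field. The field \<open>q \<mapsto> hyp_proj q v\<close> is parallel at \<open>x\<close> in all
  directions.
\<close>

lemma horizontal_lift_eq:
  assumes x: "x \<in> hyp" and v: "v \<in> tangent_space hyp x" and w: "w \<in> tangent_space hyp x"
  shows "horizontal_lift (x, v) w = (w, mink v w *\<^sub>R x)"
proof -
  let ?P = "\<lambda>X. vector_field hyp X \<and> X x = v \<and> hyp_nabla x w X = 0"
  have "mderiv hyp (\<lambda>q. hyp_proj q v) x w = mink w v *\<^sub>R x"
  proof -
    have m: "smooth_map hyp (\<lambda>q. mink q v)" by (intro smooth_map_mink smooth_map_id smooth_map_const)
    have "mderiv hyp (\<lambda>q. mink q v) x w = mink w v"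
      using mderiv_bilinear[OF bounded_bilinear_mink smooth_map_id smooth_map_const x w]
      by (simp add: mderiv_const[OF x w] mderiv_id[OF w] mink_algebra)
    then show ?thesis
      unfolding hyp_proj_def
      using mderiv_add[OF smooth_map_const smooth_map_scaleR[OF m smooth_map_id] x w]
        mderiv_scaleR[OF m smooth_map_id x w] v
      by (simp add: mderiv_const[OF x w] mderiv_id[OF w] tangent_space_hyp[OF x])
  qed
  then have "?P (\<lambda>q. hyp_proj q v)"
    using hyp.vector_field_prj hyp.prj_id[OF x v] hyp_nabla_eq[OF hyp.vector_field_prj x w] by simp
  then have X: "?P (SOME X. ?P X)" by (rule someI[of ?P])
  define X where "X = (SOME X. ?P X)"
  have "mderiv hyp X x w = mink v w *\<^sub>R x"
    using X hyp_nabla_eq[of X x w] x w mink_sym[of w v] unfolding X_def[symmetric] by auto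
  then show ?thesis unfolding horizontal_lift_def fst_conv snd_conv X_def[symmetric] by simp
qed

lemma hv_components_eq:
  assumes q: "(x, v) \<in> hyp_TB" and z: "(a, b) \<in> tangent_space hyp_TB (x, v)"
  shows "hv_components (x, v) (a, b) = (a, b - mink v a *\<^sub>R x)"
proof -
  have x: "x \<in> hyp" "v \<in> tangent_space hyp x" using q by (auto simp: hyp_TB_def)
  have a: "a \<in> tangent_space hyp x" and b: "b - mink v a *\<^sub>R x \<in> tangent_space hyp x"
    using tangent_space_TB_subset[OF z] mink_sym[of v a]
    by (auto simp: tangent_space_hyp[OF x(1)] mink_algebra hyp_mink_self[OF x(1)])
  show ?thesis
    unfolding hv_components_def fst_conv
  proof (rule the_equality)
    show "fst (a, b - mink v a *\<^sub>R x) \<in> tangent_space hyp x \<and> snd (a, b - mink v a *\<^sub>R x) \<in> tangent_space hyp x \<and>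
        (a, b) = horizontal_lift (x, v) (fst (a, b - mink v a *\<^sub>R x)) + vertical_lift (x, v) (snd (a, b - mink v a *\<^sub>R x))"
      using a b by (simp add: horizontal_lift_eq[OF x a] vertical_lift_def)
    fix w assume w: "fst w \<in> tangent_space hyp x \<and> snd w \<in> tangent_space hyp x \<and>
        (a, b) = horizontal_lift (x, v) (fst w) + vertical_lift (x, v) (snd w)"
    then have "(a, b) = (fst w, mink v (fst w) *\<^sub>R x + snd w)"
      using horizontal_lift_eq[OF x, of "fst w"] by (simp add: vertical_lift_def)
    then show "w = (a, b - mink v a *\<^sub>R x)" by (cases w) auto
  qed
qed

lemma TB_metric_eq:
  assumes q: "q \<in> hyp_TB" and z: "z \<in> tangent_space hyp_TB q" and z': "z' \<in> tangent_space hyp_TB q"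
  shows "TB_metric q z z' = bundle_form z z'"
proof -
  obtain x v a b c d where e: "q = (x, v)" "z = (a, b)" "z' = (c, d)" by (cases q, cases z, cases z') auto
  have "mink x a = 0" "mink x c = 0" using tangent_space_TB_subset z z' e by auto
  then show ?thesis
    using hv_components_eq[of x v a b] hv_components_eq[of x v c d] q z z' mink_sym[of a x]
    by (simp add: e TB_metric_def hyp_metric_def bundle_form_def mink_algebra)
qed

lemma bundle_proj_tangent: "q \<in> hyp_TB \<Longrightarrow> bundle_proj q z \<in> tangent_space hyp_TB q"
  unfolding tangent_space_TB bundle_proj_def
    bounded_bilinear.add_left[OF bounded_bilinear_bundle_form]
    bounded_bilinear.scaleR_left[OF bounded_bilinear_bundle_form]
  by (simp add: bundle_normals)

lemma linear_bundle_proj: "linear (bundle_proj q)"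
  by (intro linearI) (simp_all add: bundle_proj_def algebra_simps
    bounded_bilinear.add_left[OF bounded_bilinear_bundle_form]
    bounded_bilinear.scaleR_left[OF bounded_bilinear_bundle_form])

text \<open>
  Differentiating the two equations that express tangency. The right-hand sides are symmetric in
  the field and the direction, so brackets of fields are tangent.
\<close>

lemma bundle_field_derivative:
  assumes X: "vector_field hyp_TB X" and q: "q \<in> hyp_TB" and w: "w \<in> tangent_space hyp_TB q"
  shows "bundle_form (mderiv hyp_TB X q w) (0, fst q) = - bundle_form (X q) (0, fst w)"
    and "bundle_form (mderiv hyp_TB X q w) q = - bundle_form (X q) w"
proof -
  have L: "bounded_linear (\<lambda>z::(real^3)\<times>(real^3). (0::real^3, fst z))"
    by (intro bounded_linear_Pair bounded_linear_zero bounded_linear_fst)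
  have d: "bundle_form (X q) (mderiv hyp_TB N q w) + bundle_form (mderiv hyp_TB X q w) (N q) = 0"
    if "smooth_map hyp_TB N" "\<And>q. q \<in> hyp_TB \<Longrightarrow> bundle_form (X q) (N q) = 0" for N
    using mderiv_bilinear[OF bounded_bilinear_bundle_form vector_fieldD(1)[OF X] that(1) q w]
      mderiv_cong[OF q, of "\<lambda>q. bundle_form (X q) (N q)" "\<lambda>q. 0"] that(2) mderiv_const[OF q w, of "0::real"]
    by simp
  note T = tangent_space_TB[THEN iffD1, OF _ vector_fieldD(2)[OF X]]
  show "bundle_form (mderiv hyp_TB X q w) (0, fst q) = - bundle_form (X q) (0, fst w)"
    using d[OF smooth_map_linear[OF L smooth_map_id]] T mderiv_linear_comp[OF L smooth_map_id q w]
    by (simp add: mderiv_id[OF w])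
  show "bundle_form (mderiv hyp_TB X q w) q = - bundle_form (X q) w"
    using d[OF smooth_map_id] T by (simp add: mderiv_id[OF w])
qed

interpretation TB: metric_submanifold hyp_TB bundle_form bundle_proj TB_metric
proof (rule metric_submanifold.intro)
  show "bounded_bilinear bundle_form" by (rule bounded_bilinear_bundle_form)
  show "smooth_map hyp_TB (\<lambda>p. bundle_proj p e)" for e
    unfolding bundle_proj_def
    by (intro smooth_map_add smooth_map_scaleR smooth_map_bilinear[OF bounded_bilinear_bundle_form]
        smooth_map_Pair smooth_map_linear[OF bounded_linear_fst] smooth_map_id smooth_map_const)
  show "q \<in> hyp_TB \<Longrightarrow> v \<in> tangent_space hyp_TB q \<Longrightarrow> bundle_proj q v = v" for q v
    by (simp add: bundle_proj_def tangent_space_TB zero_prod_def[symmetric])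
  show "q \<in> hyp_TB \<Longrightarrow> w \<in> tangent_space hyp_TB q \<Longrightarrow> bundle_form (bundle_proj q e) w = bundle_form e w" for q w e
    unfolding bundle_proj_def
      bounded_bilinear.add_left[OF bounded_bilinear_bundle_form]
      bounded_bilinear.scaleR_left[OF bounded_bilinear_bundle_form]
    by (simp add: tangent_space_TB bundle_form_sym[of "(0, fst q)" w] bundle_form_sym[of q w])
  fix X Y p assume X: "vector_field hyp_TB X" and Y: "vector_field hyp_TB Y" and p: "p \<in> hyp_TB"
  note T = vector_fieldD(2)[OF X p] vector_fieldD(2)[OF Y p]
  have "bundle_form (X p) (0, fst (Y p)) = bundle_form (Y p) (0, fst (X p))"
    by (simp add: bundle_form_def mink_algebra mink_sym)
  then show "lie_bracket hyp_TB X Y p \<in> tangent_space hyp_TB p"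
    unfolding lie_bracket_def tangent_space_TB[OF p]
      bounded_bilinear.diff_left[OF bounded_bilinear_bundle_form]
      bundle_field_derivative[OF X p T(2)] bundle_field_derivative[OF Y p T(1)]
    using bundle_form_sym[of "X p" "Y p"] by simp
qed (auto simp: bundle_form_sym bundle_form_nondegenerate bundle_proj_tangent linear_bundle_proj TB_metric_eq)


section \<open>Harmonic and Lagrangian vector fields\<close>

lemma smooth_map_section_map: "smooth_map hyp V \<Longrightarrow> smooth_map hyp (section_map V)"
  unfolding section_map_def[abs_def] by (rule smooth_map_Pair[OF smooth_map_id])

lemma section_map_TB: "vector_field hyp V \<Longrightarrow> p \<in> hyp \<Longrightarrow> section_map V p \<in> hyp_TB"
  using vector_fieldD(2) by (auto simp: section_map_def hyp_TB_def)

lemma mderiv_section_map: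
  assumes "smooth_map hyp V" "p \<in> hyp" "v \<in> tangent_space hyp p"
  shows "mderiv hyp (section_map V) p v = (v, mderiv hyp V p v)"
  unfolding section_map_def[abs_def]
  using mderiv_Pair[OF smooth_map_id assms] mderiv_id[OF assms(3)] by simp

text \<open>
  For a field \<open>Y\<close> with value \<open>w\<close> at \<open>p\<close>, the ambient derivative of the image of \<open>Y\<close> in the direction
  \<open>v\<close> is the image of \<open>\<nabla>\<^sub>v Y\<close>, plus a multiple of \<open>(p, V p)\<close>, which is normal, plus a second
  derivative of the extension in the second component. Only the tangential part of the last
  term remains.
\<close>

lemma second_derivative_section_map:
  assumes V: "vector_field hyp V" and p: "p \<in> hyp"
    and v: "v \<in> tangent_space hyp p" and w: "w \<in> tangent_space hyp p"
  shows "second_derivative hyp hyp_metric hyp_TB TB_metric (section_map V) p v w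
    = (0, hyp_proj p (second_dird (homog_ext V) p v w))"
proof -
  note Vs = vector_fieldD(1)[OF V]
  interpret H: homogeneous "homog_ext V" by (rule homogeneous_homog_ext[OF Vs])
  have pc: "p \<in> future_cone" using p hyp_subset_cone by auto
  define Y where "Y = (SOME Y. vector_field hyp Y \<and> Y p = w)"
  have "vector_field hyp (\<lambda>q. hyp_proj q w) \<and> hyp_proj p w = w"
    using hyp.vector_field_prj hyp.prj_id[OF p w] by simp
  then have Y: "vector_field hyp Y" "Y p = w"
    unfolding Y_def using someI[of "\<lambda>Y. vector_field hyp Y \<and> Y p = w"] by blast+
  note Ys = vector_fieldD(1)[OF Y(1)]
  let ?F = "section_map V" and ?q = "section_map V p" and ?S = "second_dird (homog_ext V) p v w"
    and ?D = "dird (homog_ext V) p"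
  note F = smooth_map_section_map[OF Vs] section_map_TB[OF V]
  have q: "?q \<in> hyp_TB" using F(2)[OF p] .
  define n where "n = hyp_nabla p v Y"
  have n: "mderiv hyp Y p v = n + mink v w *\<^sub>R p" unfolding n_def hyp_nabla_eq[OF Y(1) p v] Y(2) by simp
  have nT: "n \<in> tangent_space hyp p"
    unfolding n_def hyp.levi_civita_eq[OF Y(1) p v] by (rule hyp.prj_tangent[OF p])
  have dF: "mderiv hyp ?F p n = (n, ?D n)" using mderiv_section_map[OF Vs p nT] mderiv_homog_ext[OF Vs p nT] by simp
  have linD: "linear ?D" by (rule dird_linear[OF H.smooth pc])
  have "mderiv hyp (\<lambda>q. mderiv hyp ?F q (Y q)) p v = mderiv hyp (\<lambda>q. (Y q, mderiv hyp V q (Y q))) p v"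
    by (rule mderiv_cong[OF p]) (simp add: mderiv_section_map[OF Vs] vector_fieldD(2)[OF Y(1)])
  also have "\<dots> = (mderiv hyp Y p v, ?S + ?D (mderiv hyp Y p v))"
    using mderiv_Pair[OF Ys smooth_map_mderiv[OF Vs Y(1)] p v] mderiv_mderiv[OF Vs Y(1) p v] Y(2) by simp
  also have "\<dots> = (n, ?D n) + mink v w *\<^sub>R ?q + (0, ?S)"
    unfolding n section_map_def
    by (simp add: linear_add[OF linD] linear_scale[OF linD] H.euler[OF pc] homog_ext_hyp[OF p])
  finally have dd: "mderiv hyp (\<lambda>q. mderiv hyp ?F q (Y q)) p v = (n, ?D n) + mink v w *\<^sub>R ?q + (0, ?S)" .
  have sec: "section_along hyp hyp_TB ?F (\<lambda>q. mderiv hyp ?F q (Y q))"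
    unfolding section_along_def
    using smooth_map_mderiv[OF F(1) Y(1)] mderiv_tangent[OF F] vector_fieldD(2)[OF Y(1)] by blast
  have "bundle_proj ?q ?q = 0" by (simp add: bundle_proj_def bundle_normals[OF q] zero_prod_def)
  moreover have "bundle_proj ?q (n, ?D n) = (n, ?D n)"
    using TB.prj_id[OF q] mderiv_tangent[OF F p nT] dF by simp
  moreover have "bundle_proj ?q (0, ?S) = (0, hyp_proj p ?S)"
    by (simp add: bundle_proj_def bundle_form_def section_map_def hyp_proj_def mink_algebra mink_sym[of ?S p])
  ultimately have "pullback_connection hyp hyp_TB TB_metric ?F p v (\<lambda>q. mderiv hyp ?F q (Y q))
      = (n, ?D n) + (0, hyp_proj p ?S)"
    using TB.pullback_connection_eq[OF F hyp.subspace_tangent sec p v]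
    by (simp only: dd linear_add[OF linear_bundle_proj] linear_scale[OF linear_bundle_proj]) (simp add: zero_prod_def)
  then show ?thesis unfolding second_derivative_def Y_def[symmetric] Let_def n_def[symmetric] dF by simp
qed

lemma tension_field_section_map:
  assumes V: "vector_field hyp V" and p: "p \<in> hyp"
  shows "tension_field hyp hyp_metric hyp_TB TB_metric (section_map V) p
    = (0, hyp_proj p (mink_trace (second_dird (homog_ext V) p)))"
proof -
  interpret H: homogeneous "homog_ext V" by (rule homogeneous_homog_ext[OF vector_fieldD(1)[OF V]])
  have pc: "p \<in> future_cone" using p hyp_subset_cone by auto
  let ?h = "\<lambda>v w. (0::real^3, hyp_proj p (second_dird (homog_ext V) p v w))"
  note lin = hyp.prj_linear[OF p]
  note lin1 = second_dird_linear1[OF H.smooth pc]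
    and lin2 = second_dird_linear2[OF open_future_cone H.smooth pc]
  have l: "linear (\<lambda>v. ?h v w)" "linear (?h v)" for v w
    by (auto intro!: linearI simp: linear_add[OF lin] linear_scale[OF lin] linear_add[OF lin1]
        linear_scale[OF lin1] linear_add[OF lin2] linear_scale[OF lin2])
  have "tension_field hyp hyp_metric hyp_TB TB_metric (section_map V) p = mink_trace ?h + ?h p p"
    unfolding tension_field_def
    by (rule metric_trace_hyp[OF p l]) (rule second_derivative_section_map[OF V p])
  then show ?thesis
    by (simp add: H.second_euler[OF pc] mink_trace_def linear_add[OF lin] linear_diff[OF lin] linear_0[OF lin])
qed

lemma harmonic_iff:
  assumes V: "vector_field hyp V"
  shows "harmonic_map hyp hyp_metric hyp_TB TB_metric (section_map V)
    \<longleftrightarrow> (\<forall>p\<in>hyp. hyp_proj p (mink_trace (second_dird (homog_ext V) p)) = 0)"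
  by (simp add: harmonic_map_def tension_field_section_map[OF V] zero_prod_def)

definition divergence :: "(real^3 \<Rightarrow> real^3) \<Rightarrow> real^3 \<Rightarrow> real" where
  "divergence F x = mink_trace (\<lambda>v w. mink (dird F x v) w)"

text \<open>Three vectors in the tangent plane are linearly dependent.\<close>

lemma mcross_tangent_dependent:
  assumes "p \<in> hyp" "mink p a = 0" "mink p b = 0" "mink p c = 0"
  shows "mink (a \<boxtimes> b) c = 0"
proof -
  have "p $ 1 * mink (a \<boxtimes> b) c = 0"
    using assms(2-4) unfolding mink_def mcross_nth by algebra
  then show ?thesis using assms(1) by (simp add: hyp_def)
qed

text \<open>
  A linear map acts as a derivation on the determinant with the trace as its factor:
  \<open>det(D p, v, w) + det(p, D v, w) + det(p, v, D w) = tr D \<cdot> det(p, v, w)\<close>.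
\<close>

lemma lagrangian_defect:
  fixes D :: "real^3 \<Rightarrow> real^3"
  assumes "linear D"
  shows "mink (p \<boxtimes> v) (D w) - mink (D v) (p \<boxtimes> w)
    = mink_trace (\<lambda>v w. mink (D v) w) * mink (p \<boxtimes> v) w - mink (D p \<boxtimes> v) w"
  unfolding linear_minkowski_expand[OF assms, of v] linear_minkowski_expand[OF assms, of w]
    linear_minkowski_expand[OF assms, of p] mink_trace_def mink_axis
  unfolding mink_def mcross_nth
  by (simp add: algebra_simps)

text \<open>
  By Euler's identity the derivative of the extension maps \<open>p\<close> to \<open>V p\<close>, so the first determinant of
  the preceding identity involves three tangent vectors and vanishes.
\<close>

lemma TB_symplectic_section_map:
  assumes V: "vector_field hyp V" and p: "p \<in> hyp"
    and v: "v \<in> tangent_space hyp p" and w: "w \<in> tangent_space hyp p"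
  shows "TB_symplectic (section_map V p) (mderiv hyp (section_map V) p v) (mderiv hyp (section_map V) p w)
    = divergence (homog_ext V) p * mink (p \<boxtimes> v) w"
proof -
  note Vs = vector_fieldD(1)[OF V]
  interpret H: homogeneous "homog_ext V" by (rule homogeneous_homog_ext[OF Vs])
  have pc: "p \<in> future_cone" using p hyp_subset_cone by auto
  let ?D = "dird (homog_ext V) p"
  have q: "(p, V p) \<in> hyp_TB" using section_map_TB[OF V p] by (simp add: section_map_def)
  have T: "(v, ?D v) \<in> tangent_space hyp_TB (p, V p)" if "v \<in> tangent_space hyp p" for v
    using mderiv_tangent[OF smooth_map_section_map[OF Vs] section_map_TB[OF V] p that]
    unfolding mderiv_section_map[OF Vs p that] mderiv_homog_ext[OF Vs p that]
    by (simp add: section_map_def)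
  have orth: "mink (p \<boxtimes> v) p = 0" for v by (simp add: mink_def mcross_nth algebra_simps)
  have "TB_symplectic (section_map V p) (mderiv hyp (section_map V) p v) (mderiv hyp (section_map V) p w)
      = mink (p \<boxtimes> v) (?D w) - mink (?D v) (p \<boxtimes> w)"
    unfolding mderiv_section_map[OF Vs p v] mderiv_section_map[OF Vs p w] mderiv_homog_ext[OF Vs p v]
      mderiv_homog_ext[OF Vs p w] section_map_def TB_symplectic_def hv_components_eq[OF q T[OF v]]
      hv_components_eq[OF q T[OF w]]
    using mink_sym[of p "p \<boxtimes> w"] orth by (simp add: hyp_metric_def hyp_J_def mink_algebra)
  also have "\<dots> = divergence (homog_ext V) p * mink (p \<boxtimes> v) w - mink (V p \<boxtimes> v) w"
    unfolding lagrangian_defect[OF dird_linear[OF H.smooth pc]] H.euler[OF pc] homog_ext_hyp[OF p] divergence_def ..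
  also have "mink (V p \<boxtimes> v) w = 0"
    using mcross_tangent_dependent[OF p] vector_fieldD(2)[OF V p] v w by (simp add: tangent_space_hyp[OF p])
  finally show ?thesis by simp
qed

lemma lagrangian_iff:
  assumes V: "vector_field hyp V"
  shows "lagrangian_field V \<longleftrightarrow> (\<forall>p\<in>hyp. divergence (homog_ext V) p = 0)"
proof -
  have "\<exists>v\<in>tangent_space hyp p. \<exists>w\<in>tangent_space hyp p. mink (p \<boxtimes> v) w \<noteq> 0" if p: "p \<in> hyp" for p
  proof (intro bexI)
    have "mink (p \<boxtimes> hyp_proj p (axis 2 1)) (hyp_proj p (axis 3 1)) = p $ 1"
      by (simp add: mink_def mcross_nth hyp_proj_def axis_def algebra_simps)
    then show "mink (p \<boxtimes> hyp_proj p (axis 2 1)) (hyp_proj p (axis 3 1)) \<noteq> 0" using p by (simp add: hyp_def)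
  qed (rule hyp.prj_tangent[OF p])+
  then show ?thesis
    unfolding lagrangian_field_def using TB_symplectic_section_map[OF V]
    by (metis mult_eq_0_iff)
qed


section \<open>The Lie derivative of the metric\<close>

definition mink_adjoint :: "(real^3 \<Rightarrow> real^3) \<Rightarrow> real^3 \<Rightarrow> real^3" where
  "mink_adjoint D v = mink (D (axis 2 1)) v *\<^sub>R axis 2 1 + mink (D (axis 3 1)) v *\<^sub>R axis 3 1
     - mink (D (axis 1 1)) v *\<^sub>R axis 1 1"

lemma mink_mink_adjoint:
  assumes "linear D" shows "mink (mink_adjoint D v) w = mink v (D w)"
  unfolding linear_minkowski_expand[OF assms, of w] mink_adjoint_def mink_algebra
    mink_sym[of "axis _ _" w] mink_axis
  by (simp add: mink_sym[of v "D _"] mult.commute)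

lemma linear_mink_adjoint: "linear (mink_adjoint D)"
  by (intro linearI) (simp_all add: mink_adjoint_def mink_algebra algebra_simps)

text \<open>
  The symmetrised derivative of the extension. It annihilates \<open>p\<close>, which is why no projection is
  needed.
\<close>

definition killing_tensor :: "(real^3 \<Rightarrow> real^3) \<Rightarrow> real^3 \<Rightarrow> real^3 \<Rightarrow> real^3" where
  "killing_tensor V p v = (if p \<in> hyp \<and> v \<in> tangent_space hyp p
     then dird (homog_ext V) p v + mink_adjoint (dird (homog_ext V) p) v else 0)"

context
  fixes V :: "real^3 \<Rightarrow> real^3"
  assumes V: "vector_field hyp V"
begin

lemma homogeneous_field: "homogeneous (homog_ext V)"
  by (rule homogeneous_homog_ext[OF vector_fieldD(1)[OF V]])

lemma linear_dird_field: "p \<in> hyp \<Longrightarrow> linear (dird (homog_ext V) p)"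
  using dird_linear[OF homogeneous.smooth[OF homogeneous_field]] hyp_subset_cone by blast

lemma mink_killing_tensor:
  assumes "p \<in> hyp" "v \<in> tangent_space hyp p"
  shows "mink (killing_tensor V p v) w = mink (dird (homog_ext V) p v) w + mink v (dird (homog_ext V) p w)"
  using assms by (simp add: killing_tensor_def mink_algebra mink_mink_adjoint[OF linear_dird_field])

lemma killing_tensor_tangent:
  assumes p: "p \<in> hyp" and v: "v \<in> tangent_space hyp p"
  shows "killing_tensor V p v \<in> tangent_space hyp p"
proof -
  have pc: "p \<in> future_cone" using p hyp_subset_cone by auto
  have "mink (killing_tensor V p v) p = mink p (dird (homog_ext V) p v) + mink v (dird (homog_ext V) p p)"
    by (simp add: mink_killing_tensor[OF p v] mink_sym[of "dird _ _ v" p])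
  also have "\<dots> = 0"
    unfolding mink_dird_homog_ext[OF V pc] homogeneous.euler[OF homogeneous_field pc] by simp
  finally show ?thesis using mink_sym[of p "killing_tensor V p v"] by (simp add: tangent_space_hyp[OF p])
qed

lemma lie_derivative_metric_eq:
  assumes X: "vector_field hyp X" and Y: "vector_field hyp Y" and p: "p \<in> hyp"
  shows "lie_derivative_metric hyp hyp_metric V X Y p
    = mink (dird (homog_ext V) p (X p)) (Y p) + mink (X p) (dird (homog_ext V) p (Y p))"
proof -
  note T = vector_fieldD(2)[OF V p] vector_fieldD(2)[OF X p] vector_fieldD(2)[OF Y p]
  have "mderiv hyp (\<lambda>q. mink (X q) (Y q)) p (V p)
      = mink (X p) (mderiv hyp Y p (V p)) + mink (mderiv hyp X p (V p)) (Y p)"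
    by (rule mderiv_bilinear[OF bounded_bilinear_mink vector_fieldD(1)[OF X] vector_fieldD(1)[OF Y] p T(1)])
  then show ?thesis
    using mderiv_homog_ext[OF vector_fieldD(1)[OF V] p T(2)] mderiv_homog_ext[OF vector_fieldD(1)[OF V] p T(3)]
    by (simp add: lie_derivative_metric_def hyp_metric_def lie_bracket_def mink_algebra)
qed

lemma tensor11_killing_tensor: "tensor11 hyp (killing_tensor V)"
  unfolding tensor11_def
proof (intro conjI ballI allI impI)
  fix p v w c d assume p: "p \<in> hyp" and v: "v \<in> tangent_space hyp p" and w: "w \<in> tangent_space hyp p"
  have "c *\<^sub>R v + d *\<^sub>R w \<in> tangent_space hyp p"
    using v w hyp.subspace_tangent[OF p] by (simp add: subspace_add subspace_scale)
  then show "killing_tensor V p (c *\<^sub>R v + d *\<^sub>R w) = c *\<^sub>R killing_tensor V p v + d *\<^sub>R killing_tensor V p w"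
    using p v w linear_dird_field[OF p] linear_mink_adjoint[of "dird (homog_ext V) p"]
    by (simp add: killing_tensor_def linear_add linear_scale algebra_simps)
next
  fix X assume X: "vector_field hyp X"
  note Vs = vector_fieldD(1)[OF V] and Xs = vector_fieldD(1)[OF X]
  have col: "smooth_map hyp (\<lambda>q. dird (homog_ext V) q e)" for e
    by (rule smooth_on_cone_imp_smooth_map[OF smooth_on_dird[OF smooth_on_homog_ext[OF Vs]]])
  have "smooth_map hyp (\<lambda>q. mderiv hyp V q (X q) + mink_adjoint (dird (homog_ext V) q) (X q))"
    unfolding mink_adjoint_def
    by (intro smooth_map_add smooth_map_diff smooth_map_scaleR smooth_map_mink smooth_map_mderiv
        smooth_map_const col Vs Xs X)
  then have "smooth_map hyp (\<lambda>q. killing_tensor V q (X q))"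
    by (rule smooth_map_cong) (simp add: killing_tensor_def vector_fieldD(2)[OF X] mderiv_homog_ext[OF Vs])
  then show "vector_field hyp (\<lambda>q. killing_tensor V q (X q))"
    using killing_tensor_tangent vector_fieldD(2)[OF X] by (simp add: vector_field_def section_along_def)
next
  fix p v assume "\<not> (p \<in> hyp \<and> v \<in> tangent_space hyp p)"
  then show "killing_tensor V p v = 0" by (auto simp: killing_tensor_def)
qed

lemma lie_derivative_tensor_eq: "lie_derivative_tensor hyp hyp_metric V = killing_tensor V"
  unfolding lie_derivative_tensor_def
proof (rule the_equality)
  show "tensor11 hyp (killing_tensor V) \<and> self_adjoint hyp hyp_metric (killing_tensor V) \<and>
      (\<forall>X Y. vector_field hyp X \<longrightarrow> vector_field hyp Y \<longrightarrow> (\<forall>p\<in>hyp. lie_derivative_metric hyp hyp_metric V X Y p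
         = hyp_metric p (killing_tensor V p (X p)) (Y p)))"
  proof (intro conjI allI impI ballI)
    show "self_adjoint hyp hyp_metric (killing_tensor V)"
      unfolding self_adjoint_def hyp_metric_def
    proof (intro ballI)
      fix p v w assume p: "p \<in> hyp" "v \<in> tangent_space hyp p" "w \<in> tangent_space hyp p"
      show "mink (killing_tensor V p v) w = mink v (killing_tensor V p w)"
        unfolding mink_sym[of v "killing_tensor V p w"]
        using mink_killing_tensor p mink_sym[of w "dird (homog_ext V) p v"] mink_sym[of v "dird (homog_ext V) p w"]
        by simp
    qed
  qed (simp_all add: tensor11_killing_tensor lie_derivative_metric_eq hyp_metric_def mink_killing_tensor vector_fieldD(2))
next
  fix b assume b: "tensor11 hyp b \<and> self_adjoint hyp hyp_metric b \<and>
      (\<forall>X Y. vector_field hyp X \<longrightarrow> vector_field hyp Y \<longrightarrow>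
        (\<forall>p\<in>hyp. lie_derivative_metric hyp hyp_metric V X Y p = hyp_metric p (b p (X p)) (Y p)))"
  show "b = killing_tensor V"
  proof (intro ext)
    fix p v
    show "b p v = killing_tensor V p v"
    proof (cases "p \<in> hyp \<and> v \<in> tangent_space hyp p")
      case False
      then show ?thesis using b unfolding tensor11_def killing_tensor_def by metis
    next
      case True
      then have p: "p \<in> hyp" and v: "v \<in> tangent_space hyp p" by auto
      have ext: "vector_field hyp (\<lambda>q. hyp_proj q e)" "e \<in> tangent_space hyp p \<Longrightarrow> hyp_proj p e = e" for e
        using hyp.vector_field_prj hyp.prj_id[OF p] by auto
      have "vector_field hyp (\<lambda>q. b q (hyp_proj q v))" using b ext(1)[of v] unfolding tensor11_def by blast
      from vector_fieldD(2)[OF this p] have "b p v \<in> tangent_space hyp p" using ext(2)[OF v] by simp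
      moreover have "mink (b p v) w = mink (killing_tensor V p v) w" if w: "w \<in> tangent_space hyp p" for w
      proof -
        have "lie_derivative_metric hyp hyp_metric V (\<lambda>q. hyp_proj q v) (\<lambda>q. hyp_proj q w) p
            = hyp_metric p (b p (hyp_proj p v)) (hyp_proj p w)"
          using b ext(1)[of v] ext(1)[of w] p by blast
        then show ?thesis
          unfolding lie_derivative_metric_eq[OF ext(1) ext(1) p] ext(2)[OF v] ext(2)[OF w] hyp_metric_def
          using mink_killing_tensor[OF p v] by simp
      qed
      ultimately have "b p v - killing_tensor V p v = 0"
        using killing_tensor_tangent[OF p v] hyp.subspace_tangent[OF p]
        by (intro hyp.tangent_nondegenerate[OF p]) (auto simp: mink_algebra intro: subspace_diff)
      then show ?thesis by simp
    qed
  qed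
qed

lemma endo_trace_lie_derivative:
  assumes p: "p \<in> hyp"
  shows "endo_trace hyp hyp_metric p (lie_derivative_tensor hyp hyp_metric V p) = 2 * divergence (homog_ext V) p"
proof -
  have pc: "p \<in> future_cone" using p hyp_subset_cone by auto
  note lin = linear_dird_field[OF p]
  let ?D = "dird (homog_ext V) p"
  have "endo_trace hyp hyp_metric p (lie_derivative_tensor hyp hyp_metric V p)
      = mink_trace (\<lambda>v w. mink (?D v) w + mink v (?D w)) + (mink (?D p) p + mink p (?D p))"
    unfolding endo_trace_def lie_derivative_tensor_eq
  proof (rule metric_trace_hyp[OF p])
    show "linear (\<lambda>v. mink (?D v) w + mink v (?D w))" "linear (\<lambda>w. mink (?D v) w + mink v (?D w))" for v w
      by (auto intro!: linearI simp: linear_add[OF lin] linear_scale[OF lin] mink_algebra algebra_simps)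
  qed (simp add: hyp_metric_def mink_killing_tensor[OF p])
  also have "mink (?D p) p + mink p (?D p) = 0"
    using mink_sym[of "?D p" p] homog_ext_tangent[OF V pc] homogeneous.euler[OF homogeneous_field pc] by simp
  also have "mink_trace (\<lambda>v w. mink (?D v) w + mink v (?D w)) = 2 * divergence (homog_ext V) p"
    unfolding mink_trace_def divergence_def by (simp add: mink_sym[of _ "?D _"])
  finally show ?thesis by simp
qed

text \<open>
  The terms in the derivatives of \<open>X\<close> and \<open>Y\<close> cancel against the bracket, and the remaining terms
  are reduced by the symmetry of second derivatives to an antisymmetrised second derivative.
\<close>

lemma mink_ext_cov_deriv:
  assumes X: "vector_field hyp X" and Y: "vector_field hyp Y" and p: "p \<in> hyp" and z: "z \<in> tangent_space hyp p"
  shows "mink (ext_cov_deriv hyp hyp_metric (lie_derivative_tensor hyp hyp_metric V) X Y p) z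
    = mink (Y p) (second_dird (homog_ext V) p z (X p)) - mink (X p) (second_dird (homog_ext V) p z (Y p))"
proof -
  interpret H: homogeneous "homog_ext V" by (rule homogeneous_field)
  have pc: "p \<in> future_cone" using p hyp_subset_cone by auto
  note Vs = vector_fieldD(1)[OF V]
  let ?D = "dird (homog_ext V) p" and ?S = "second_dird (homog_ext V) p" and ?b = "killing_tensor V"
  note lin = linear_dird_field[OF p]
  have sym: "?S v w = ?S w v" for v w by (rule second_dird_sym[OF open_future_cone H.smooth pc])
  \<comment> \<open>Pairing with a constant vector \<open>z\<close> turns the tensor into derivatives of the extension.\<close>
  have half: "mink (hyp_nabla p (X p) (\<lambda>q. ?b q (Y q))) z
      = mink (?S (X p) (Y p)) z + mink (Y p) (?S (X p) z)
        + mink (?D (mderiv hyp Y p (X p))) z + mink (mderiv hyp Y p (X p)) (?D z)"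
    if X: "vector_field hyp X" and Y: "vector_field hyp Y" for X Y
  proof -
    note x = vector_fieldD(2)[OF X p] and Ys = vector_fieldD(1)[OF Y]
    have bY: "vector_field hyp (\<lambda>q. ?b q (Y q))" using tensor11_killing_tensor Y unfolding tensor11_def by blast
    have col: "smooth_map hyp (\<lambda>q. dird (homog_ext V) q z)"
      by (rule smooth_on_cone_imp_smooth_map[OF smooth_on_dird[OF H.smooth]])
    have colx: "mderiv hyp (\<lambda>q. dird (homog_ext V) q z) p (X p) = ?S (X p) z"
      unfolding second_dird_def by (rule mderiv_cone_extension[OF smooth_on_dird[OF H.smooth] p x refl])
    have "mink (hyp_nabla p (X p) (\<lambda>q. ?b q (Y q))) z = mink (mderiv hyp (\<lambda>q. ?b q (Y q)) p (X p)) z"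
      unfolding hyp.levi_civita_eq[OF bY p x] by (rule hyp.prj_orthogonal[OF p z])
    also have "\<dots> = mderiv hyp (\<lambda>q. mink (?b q (Y q)) z) p (X p)"
      using mderiv_bilinear[OF bounded_bilinear_mink vector_fieldD(1)[OF bY] smooth_map_const p x]
      by (simp add: mderiv_const[OF p x] mink_algebra)
    also have "\<dots> = mderiv hyp (\<lambda>q. mink (mderiv hyp V q (Y q)) z + mink (Y q) (dird (homog_ext V) q z)) p (X p)"
      by (rule mderiv_cong[OF p]) (simp add: mink_killing_tensor vector_fieldD(2)[OF Y] mderiv_homog_ext[OF Vs])
    also have "\<dots> = mderiv hyp (\<lambda>q. mink (mderiv hyp V q (Y q)) z) p (X p)
        + mderiv hyp (\<lambda>q. mink (Y q) (dird (homog_ext V) q z)) p (X p)"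
      by (intro mderiv_add smooth_map_mink smooth_map_mderiv smooth_map_const Vs Ys Y col p x)
    also have "mderiv hyp (\<lambda>q. mink (mderiv hyp V q (Y q)) z) p (X p)
        = mink (?S (X p) (Y p) + ?D (mderiv hyp Y p (X p))) z"
      using mderiv_bilinear[OF bounded_bilinear_mink smooth_map_mderiv[OF Vs Y] smooth_map_const p x]
        mderiv_mderiv[OF Vs Y p x]
      by (simp add: mderiv_const[OF p x] mink_algebra)
    also have "mderiv hyp (\<lambda>q. mink (Y q) (dird (homog_ext V) q z)) p (X p)
        = mink (Y p) (?S (X p) z) + mink (mderiv hyp Y p (X p)) (?D z)"
      using mderiv_bilinear[OF bounded_bilinear_mink Ys col p x] colx by simp
    finally show ?thesis by (simp add: mink_algebra)
  qed
  have "mink (?b p (lie_bracket hyp X Y p)) z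
      = mink (?D (lie_bracket hyp X Y p)) z + mink (lie_bracket hyp X Y p) (?D z)"
    by (rule mink_killing_tensor[OF p hyp.bracket_tangent[OF X Y p]])
  then have "mink (?b p (lie_bracket hyp X Y p)) z
      = mink (?D (mderiv hyp Y p (X p))) z - mink (?D (mderiv hyp X p (Y p))) z
        + (mink (mderiv hyp Y p (X p)) (?D z) - mink (mderiv hyp X p (Y p)) (?D z))"
    unfolding lie_bracket_def linear_diff[OF lin] mink_algebra .
  then show ?thesis
    unfolding ext_cov_deriv_def lie_derivative_tensor_eq mink_algebra half[OF X Y] half[OF Y X]
    using sym[of "Y p" "X p"] sym[of "X p" z] sym[of "Y p" z] by simp
qed

end


section \<open>The curl of a homogeneous field\<close>

text \<open>
  The curl is the vector \<open>c\<close> for which the antisymmetric part of a linear map \<open>D\<close>, lowered by the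
  Minkowski form, is the determinant \<open>det(c, v, w)\<close>. It is assembled from the images under \<open>D\<close> of
  the basis vectors, so that it can be differentiated termwise.
\<close>

definition curl1 :: "real^3 \<Rightarrow> real^3" where "curl1 a = vector [0, - (a $ 3), a $ 2]"
definition curl2 :: "real^3 \<Rightarrow> real^3" where "curl2 a = vector [a $ 3, 0, a $ 1]"
definition curl3 :: "real^3 \<Rightarrow> real^3" where "curl3 a = vector [- (a $ 2), - (a $ 1), 0]"

definition curl_vec :: "(real^3 \<Rightarrow> real^3) \<Rightarrow> real^3" where
  "curl_vec D = curl1 (D (axis 1 1)) + curl2 (D (axis 2 1)) + curl3 (D (axis 3 1))"

lemma curl_nth:
  "curl_vec D $ 1 = D (axis 2 1) $ 3 - D (axis 3 1) $ 2"
  "curl_vec D $ 2 = - (D (axis 3 1) $ 1) - D (axis 1 1) $ 3"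
  "curl_vec D $ 3 = D (axis 1 1) $ 2 + D (axis 2 1) $ 1"
  by (simp_all add: curl_vec_def curl1_def curl2_def curl3_def vector_3)

lemma bounded_linear_curl: "bounded_linear curl1" "bounded_linear curl2" "bounded_linear curl3"
  unfolding linear_conv_bounded_linear[symmetric]
  by (intro linearI; simp add: curl1_def curl2_def curl3_def vec_eq_iff forall_3 vector_3)+

lemma mcross_curl_vec:
  assumes "linear D"
  shows "mink (curl_vec D \<boxtimes> v) w = mink w (D v) - mink v (D w)"
  unfolding linear_minkowski_expand[OF assms, of v] linear_minkowski_expand[OF assms, of w]
  unfolding mink_def mcross_nth curl_nth
  by (simp add: algebra_simps)

lemma curl_vec_scale: "curl_vec (\<lambda>v. c *\<^sub>R D v) = c *\<^sub>R curl_vec D"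
  by (simp add: vec_eq_iff forall_3 curl_nth algebra_simps)

definition curl :: "(real^3 \<Rightarrow> real^3) \<Rightarrow> real^3 \<Rightarrow> real^3" where
  "curl F x = curl_vec (dird F x)"

lemma smooth_on_curl:
  assumes "smooth_on future_cone F" shows "smooth_on future_cone (curl F)"
  unfolding curl_def[abs_def] curl_vec_def
  by (intro smooth_on_add smooth_on_linear_comp[OF bounded_linear_curl(1)]
      smooth_on_linear_comp[OF bounded_linear_curl(2)] smooth_on_linear_comp[OF bounded_linear_curl(3)]
      open_future_cone smooth_on_dird assms)

lemma dird_curl:
  assumes F: "smooth_on future_cone F" and x: "x \<in> future_cone"
  shows "dird (curl F) x z = curl_vec (second_dird F x z)"
proof -
  have "(curl F has_derivative (\<lambda>z. curl1 (second_dird F x z (axis 1 1)) + curl2 (second_dird F x z (axis 2 1))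
      + curl3 (second_dird F x z (axis 3 1)))) (at x)"
    unfolding curl_def[abs_def] curl_vec_def second_dird_def
    by (intro has_derivative_add bounded_linear.has_derivative[OF bounded_linear_curl(1)]
        bounded_linear.has_derivative[OF bounded_linear_curl(2)]
        bounded_linear.has_derivative[OF bounded_linear_curl(3)]
        smooth_on_has_derivative[OF smooth_on_dird[OF F] x])
  from fun_cong[OF dird_eq[OF this], of z] show ?thesis by (simp add: curl_vec_def)
qed

text \<open>The derivative of the curl at a point of the hyperbolic plane is tangent to it.\<close>

definition curl_condition :: "(real^3 \<Rightarrow> real^3) \<Rightarrow> bool" where
  "curl_condition F \<longleftrightarrow> (\<forall>p\<in>hyp. \<forall>z. mink (curl_vec (second_dird F p z)) p = 0)"

text \<open>
  On the tangent plane the form \<open>det(c, v, w)\<close> is the area form scaled by the normal component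
  of \<open>c\<close>.
\<close>

lemma mcross_tangent_vanishes_iff:
  assumes p: "p \<in> hyp"
  shows "(\<forall>v\<in>tangent_space hyp p. \<forall>w\<in>tangent_space hyp p. mink (c \<boxtimes> v) w = 0) \<longleftrightarrow> mink c p = 0"
proof
  assume "mink c p = 0"
  then show "\<forall>v\<in>tangent_space hyp p. \<forall>w\<in>tangent_space hyp p. mink (c \<boxtimes> v) w = 0"
    using mcross_tangent_dependent[OF p, of c] mink_sym[of p c] by (simp add: tangent_space_hyp[OF p])
next
  assume *: "\<forall>v\<in>tangent_space hyp p. \<forall>w\<in>tangent_space hyp p. mink (c \<boxtimes> v) w = 0"
  have pp: "p $ 1 * p $ 1 = 1 + p $ 2 * p $ 2 + p $ 3 * p $ 3" and "p $ 1 > 0"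
    using p by (auto simp: hyp_def mink_def)
  have "mink (c \<boxtimes> hyp_proj p (axis 2 1)) (hyp_proj p (axis 3 1))
      = c $ 1 * (1 + p $ 2 * p $ 2 + p $ 3 * p $ 3) - p $ 1 * (c $ 2 * p $ 2 + c $ 3 * p $ 3)"
    by (simp add: mink_def mcross_nth hyp_proj_def axis_def algebra_simps)
  also have "\<dots> = - (p $ 1 * mink c p)" unfolding pp[symmetric] by (simp add: mink_def algebra_simps)
  finally have "p $ 1 * mink c p = 0" using * hyp.prj_tangent[OF p] by simp
  then show "mink c p = 0" using \<open>p $ 1 > 0\<close> by simp
qed

text \<open>
  The preceding formula for \<open>d\<^sup>\<nabla>b\<close> is the curl of the derivative in the direction \<open>z\<close>, evaluated
  on a pair of tangent vectors. Directions \<open>z\<close> that are not tangent add nothing, since second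
  derivatives vanish on \<open>p\<close>.
\<close>

lemma codazzi_iff:
  assumes V: "vector_field hyp V"
  shows "(\<forall>X Y. vector_field hyp X \<longrightarrow> vector_field hyp Y \<longrightarrow> (\<forall>p\<in>hyp.
      ext_cov_deriv hyp hyp_metric (lie_derivative_tensor hyp hyp_metric V) X Y p = 0))
    \<longleftrightarrow> curl_condition (homog_ext V)" (is "?L \<longleftrightarrow> ?R")
proof -
  interpret H: homogeneous "homog_ext V" by (rule homogeneous_field[OF V])
  let ?S = "second_dird (homog_ext V)"
  let ?d = "ext_cov_deriv hyp hyp_metric (lie_derivative_tensor hyp hyp_metric V)"
  have lin2: "linear (?S p z)" and lin1: "linear (\<lambda>z. ?S p z w)" and radial: "?S p p w = 0" if "p \<in> hyp" for p z w
    using that hyp_subset_cone second_dird_linear2[OF open_future_cone H.smooth]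
      second_dird_linear1[OF H.smooth] H.second_euler(2) by blast+
  note pair = mink_ext_cov_deriv[OF V]
  have curl: "mink (?d X Y p) z = mink (curl_vec (?S p z) \<boxtimes> X p) (Y p)"
    if "vector_field hyp X" "vector_field hyp Y" "p \<in> hyp" "z \<in> tangent_space hyp p" for X Y p z
    unfolding pair[OF that] mcross_curl_vec[OF lin2[OF that(3)]] ..
  show ?thesis
  proof
    assume L: ?L
    show ?R unfolding curl_condition_def
    proof (intro ballI allI)
      fix p z assume p: "p \<in> hyp"
      have tangential: "?S p (hyp_proj p z) = ?S p z"
        using linear_add[OF lin1[OF p]] linear_scale[OF lin1[OF p]] radial[OF p] by (simp add: hyp_proj_def fun_eq_iff)
      have "mink (curl_vec (?S p (hyp_proj p z)) \<boxtimes> v) w = 0"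
        if "v \<in> tangent_space hyp p" "w \<in> tangent_space hyp p" for v w
      proof -
        have "?d (\<lambda>q. hyp_proj q v) (\<lambda>q. hyp_proj q w) p = 0" using L hyp.vector_field_prj p by blast
        then show ?thesis
          using curl[OF hyp.vector_field_prj[of v] hyp.vector_field_prj[of w] p hyp.prj_tangent[OF p, of z]]
            hyp.prj_id[OF p] that by (simp add: mink_algebra)
      qed
      then show "mink (curl_vec (?S p z)) p = 0"
        unfolding tangential using mcross_tangent_vanishes_iff[OF p] by blast
    qed
  next
    assume R: ?R
    show ?L
    proof (intro allI impI ballI)
      fix X Y p assume X: "vector_field hyp X" and Y: "vector_field hyp Y" and p: "p \<in> hyp"
      have b: "tensor11 hyp (lie_derivative_tensor hyp hyp_metric V)"
        unfolding lie_derivative_tensor_eq[OF V] by (rule tensor11_killing_tensor[OF V])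
      have fields: "vector_field hyp (\<lambda>q. lie_derivative_tensor hyp hyp_metric V q (Z q))"
        if "vector_field hyp Z" for Z using b that unfolding tensor11_def by blast
      have nT: "hyp_nabla p (Z p) W \<in> tangent_space hyp p" if "vector_field hyp Z" "vector_field hyp W" for Z W
        unfolding hyp.levi_civita_eq[OF that(2) p vector_fieldD(2)[OF that(1) p]] by (rule hyp.prj_tangent[OF p])
      have "lie_derivative_tensor hyp hyp_metric V p (lie_bracket hyp X Y p) \<in> tangent_space hyp p"
        unfolding lie_derivative_tensor_eq[OF V]
        by (rule killing_tensor_tangent[OF V p hyp.bracket_tangent[OF X Y p]])
      then have T: "?d X Y p \<in> tangent_space hyp p"
        unfolding ext_cov_deriv_def using nT[OF X fields[OF Y]] nT[OF Y fields[OF X]] hyp.subspace_tangent[OF p]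
        by (intro subspace_diff)
      show "?d X Y p = 0"
      proof (rule hyp.tangent_nondegenerate[OF p T])
        fix z assume z: "z \<in> tangent_space hyp p"
        show "mink (?d X Y p) z = 0"
          unfolding curl[OF X Y p z]
          using R mcross_tangent_vanishes_iff[OF p] vector_fieldD(2)[OF X p] vector_fieldD(2)[OF Y p] p
          unfolding curl_condition_def by blast
      qed
    qed
  qed
qed


section \<open>Equivalence of the three conditions\<close>

subsection \<open>Harmonicity and the curl\<close>

lemma dird_divergence:
  assumes F: "smooth_on future_cone F" and x: "x \<in> future_cone"
  shows "dird (divergence F) x z = mink_trace (\<lambda>v w. mink (second_dird F x z v) w)"
proof -
  have "(divergence F has_derivative (\<lambda>z. mink_trace (\<lambda>v w. mink (second_dird F x z v) w))) (at x)"
    unfolding divergence_def[abs_def] mink_trace_def second_dird_def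
    by (intro has_derivative_add has_derivative_diff
        bounded_linear.has_derivative[OF bounded_bilinear.bounded_linear_left[OF bounded_bilinear_mink]]
        smooth_on_has_derivative[OF smooth_on_dird[OF F] x])
  from fun_cong[OF dird_eq[OF this], of z] show ?thesis .
qed

text \<open>
  The divergence is constant along rays, so it vanishes on the whole cone and may be
  differentiated in all directions.
\<close>

lemma divergence_derivative:
  fixes G :: "real^3 \<Rightarrow> real^3"
  assumes G: "homogeneous G" and "\<forall>p\<in>hyp. divergence G p = 0" and x: "x \<in> future_cone"
  shows "mink_trace (\<lambda>v w. mink (second_dird G x z v) w) = 0"
proof -
  have "divergence G y = 0" if y: "y \<in> future_cone" for y
  proof -
    let ?p = "hyp_retract y"
    have p: "?p \<in> hyp" "?p \<in> future_cone" using hyp_retract_in_hyp[OF y] hyp_subset_cone by auto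
    have "dird G y v = dird G ?p v" for v
      using homogeneous.dird_homogeneous[OF G p(2) mink_norm_pos[OF y], of v, folded hyp_retract_decomp[OF y]] .
    then show ?thesis using assms(2) p(1) by (simp add: divergence_def)
  qed
  then have "dird (divergence G) x z = 0"
    using dird_transform[OF open_future_cone smooth_on_const x, of 0 "divergence G" z] by simp
  then show ?thesis using dird_divergence[OF homogeneous.smooth[OF G] x] by simp
qed

text \<open>
  The identity \<open>curl curl F = grad div F - Box F\<close> for a divergence-free field \<open>F\<close> with second
  derivative \<open>S\<close> at \<open>p\<close>, multiplied by \<open>p\<close>. The derivative of the curl along \<open>p\<close> drops out because
  \<open>S\<close> annihilates \<open>p\<close>.
\<close>

lemma curl_contraction:
  fixes S :: "real^3 \<Rightarrow> real^3 \<Rightarrow> real^3"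
  assumes l1: "\<And>w. linear (\<lambda>v. S v w)" and l2: "\<And>v. linear (S v)" and sym: "\<And>v w. S v w = S w v"
    and radial: "\<And>v. S v p = 0" and trace: "\<And>z. mink_trace (\<lambda>v w. mink (S z v) w) = 0"
  shows "mink (curl_vec (S z)) p = mink (p \<boxtimes> mink_trace S) z"
proof -
  let ?e1 = "axis 1 1 :: real^3" and ?e2 = "axis 2 1 :: real^3" and ?e3 = "axis 3 1 :: real^3"
  have s: "S ?e2 ?e1 = S ?e1 ?e2" "S ?e3 ?e1 = S ?e1 ?e3" "S ?e3 ?e2 = S ?e2 ?e3" using sym by auto
  have r: "p $ 1 * S v ?e1 $ i + p $ 2 * S v ?e2 $ i + p $ 3 * S v ?e3 $ i = 0" for v i
    using radial[of v] linear_minkowski_expand[OF l2, of v p] by (simp add: vec_eq_iff)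
  have t: "S z ?e2 $ 2 + S z ?e3 $ 3 + S z ?e1 $ 1 = 0" for z
    using trace[of z] by (simp add: mink_trace_def mink_axis)
  have b: "mink_trace S $ i = S ?e2 ?e2 $ i + S ?e3 ?e3 $ i - S ?e1 ?e1 $ i" for i
    by (simp add: mink_trace_def)
  have ax: "?e1 $ 1 = 1" "?e1 $ 2 = 0" "?e1 $ 3 = 0" "?e2 $ 1 = 0" "?e2 $ 2 = 1" "?e2 $ 3 = 0"
    "?e3 $ 1 = 0" "?e3 $ 2 = 0" "?e3 $ 3 = 1" by (simp_all add: axis_def)
  note eqs = r[of ?e1, unfolded s] r[of ?e2, unfolded s] r[of ?e3, unfolded s]
    t[of ?e1, unfolded s] t[of ?e2, unfolded s] t[of ?e3, unfolded s]
  have 1: "mink (curl_vec (S ?e1)) p = mink (p \<boxtimes> mink_trace S) ?e1"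
    unfolding mink_def curl_nth mcross_nth b ax s
    using eqs(2)[of 3] eqs(3)[of 2] eqs(5,6) by algebra
  have 2: "mink (curl_vec (S ?e2)) p = mink (p \<boxtimes> mink_trace S) ?e2"
    unfolding mink_def curl_nth mcross_nth b ax s
    using eqs(1)[of 3] eqs(3)[of 1] eqs(4,6) by algebra
  have 3: "mink (curl_vec (S ?e3)) p = mink (p \<boxtimes> mink_trace S) ?e3"
    unfolding mink_def curl_nth mcross_nth b ax s
    using eqs(1)[of 2] eqs(2)[of 1] eqs(4,5) by algebra
  have lin: "linear (\<lambda>z. mink (curl_vec (S z)) p)"
    by (intro linearI) (simp_all add: mink_def curl_nth linear_add[OF l1] linear_scale[OF l1] algebra_simps)
  have lin': "linear (\<lambda>z. mink (p \<boxtimes> mink_trace S) z)"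
    by (intro linearI) (simp_all add: mink_algebra)
  show ?thesis
    using linear_minkowski_expand[OF lin, of z] linear_minkowski_expand[OF lin', of z] 1 2 3 by simp
qed

lemma hyp_proj_eq_0_iff:
  assumes p: "p \<in> hyp" shows "hyp_proj p b = 0 \<longleftrightarrow> (\<forall>z. mink (p \<boxtimes> b) z = 0)"
proof
  assume "hyp_proj p b = 0"
  then have "b = (- mink p b) *\<^sub>R p" by (simp add: hyp_proj_def add_eq_0_iff2)
  then obtain c where "b = c *\<^sub>R p" by blast
  then show "\<forall>z. mink (p \<boxtimes> b) z = 0" by (simp add: mink_def mcross_nth)
next
  assume "\<forall>z. mink (p \<boxtimes> b) z = 0"
  then have "p \<boxtimes> b = 0" using mink_nondegenerate by blast
  then have c: "p $ 3 * b $ 2 = p $ 2 * b $ 3" "p $ 3 * b $ 1 = p $ 1 * b $ 3" "p $ 1 * b $ 2 = p $ 2 * b $ 1"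
    using mcross_nth[of p b] by simp_all
  have pp: "p $ 1 * p $ 1 = 1 + p $ 2 * p $ 2 + p $ 3 * p $ 3" using p by (simp add: hyp_def mink_def)
  show "hyp_proj p b = 0"
    unfolding vec_eq_iff forall_3 hyp_proj_def mink_def vector_add_component vector_scaleR_component
      zero_index real_scaleR_def
    using c pp by (intro conjI; algebra)
qed

text \<open>
  Once the divergence vanishes, the derivative of the curl in the direction \<open>z\<close>, paired with \<open>p\<close>, is
  \<open>p \<boxtimes> Box F\<close> paired with \<open>z\<close>; and \<open>p \<boxtimes> Box F\<close> vanishes iff \<open>Box F\<close> is normal.
\<close>

lemma harmonic_lagrangian_iff:
  assumes V: "vector_field hyp V"
  shows "harmonic_lagrangian V \<longleftrightarrow> (\<forall>p\<in>hyp. divergence (homog_ext V) p = 0) \<and> curl_condition (homog_ext V)"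
proof -
  interpret H: homogeneous "homog_ext V" by (rule homogeneous_field[OF V])
  have "hyp_proj p (mink_trace (second_dird (homog_ext V) p)) = 0
      \<longleftrightarrow> (\<forall>z. mink (curl_vec (second_dird (homog_ext V) p z)) p = 0)"
    if div: "\<forall>p\<in>hyp. divergence (homog_ext V) p = 0" and p: "p \<in> hyp" for p
  proof -
    have pc: "p \<in> future_cone" using p hyp_subset_cone by auto
    have "mink (curl_vec (second_dird (homog_ext V) p z)) p
        = mink (p \<boxtimes> mink_trace (second_dird (homog_ext V) p)) z" for z
      by (rule curl_contraction[OF second_dird_linear1[OF H.smooth pc]
            second_dird_linear2[OF open_future_cone H.smooth pc] second_dird_sym[OF open_future_cone H.smooth pc]
            H.second_euler(1)[OF pc] divergence_derivative[OF H.homogeneous_axioms div pc]])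
    then show ?thesis using hyp_proj_eq_0_iff[OF p] by simp
  qed
  then show ?thesis
    unfolding harmonic_lagrangian_def harmonic_iff[OF V] lagrangian_iff[OF V] curl_condition_def by blast
qed


subsection \<open>Fields associated with mean surfaces\<close>

lemma bounded_bilinear_mcross: "bounded_bilinear (\<boxtimes>)"
  unfolding bilinear_conv_bounded_bilinear[symmetric] bilinear_def
  by (intro conjI allI linearI) (simp_all add: vec_eq_iff forall_3 mcross_nth algebra_simps)

lemma mink_grad_homogeneous:
  assumes "homogeneous U" "x \<in> future_cone" "t > 0"
  shows "mink_grad U (t *\<^sub>R x) = mink_grad U x"
  using homogeneous.dird_homogeneous[OF assms] by (simp add: mink_grad_def)

lemma divergence_mcross:
  fixes A D :: "real^3 \<Rightarrow> real^3"
  assumes sym: "\<And>v w. mink (A v) w = mink (A w) v" and D: "\<And>v. D v = x \<boxtimes> A v + v \<boxtimes> g"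
  shows "mink_trace (\<lambda>v w. mink (D v) w) = 0"
proof -
  have "A (axis 1 1) $ 2 = - (A (axis 2 1) $ 1)" "A (axis 1 1) $ 3 = - (A (axis 3 1) $ 1)"
    "A (axis 2 1) $ 3 = A (axis 3 1) $ 2"
    using sym[of "axis 1 1" "axis 2 1"] sym[of "axis 1 1" "axis 3 1"] sym[of "axis 2 1" "axis 3 1"]
    by (simp_all add: mink_axis)
  then show ?thesis
    unfolding mink_trace_def mink_axis D vector_add_component mcross_nth by (simp add: axis_def)
qed

text \<open>
  The formula \<open>curl(x \<boxtimes> G) = x div G - G div x + D\<^sub>G x - D\<^sub>x G\<close> for \<open>div G = 0\<close> and \<open>D\<^sub>x G = 0\<close>; the
  divergence of \<open>x\<close> is \<open>3\<close>.
\<close>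

lemma curl_mcross:
  fixes A D :: "real^3 \<Rightarrow> real^3"
  assumes lin: "linear A" and sym: "\<And>v w. mink (A v) w = mink (A w) v" and radial: "A x = 0"
    and trace: "mink_trace (\<lambda>v w. mink (A v) w) = 0" and D: "\<And>v. D v = x \<boxtimes> A v + v \<boxtimes> g"
  shows "curl_vec D = (-2) *\<^sub>R g"
proof -
  let ?e1 = "axis 1 1 :: real^3" and ?e2 = "axis 2 1 :: real^3" and ?e3 = "axis 3 1 :: real^3"
  have s: "A ?e1 $ 2 = - (A ?e2 $ 1)" "A ?e1 $ 3 = - (A ?e3 $ 1)" "A ?e2 $ 3 = A ?e3 $ 2"
    using sym[of ?e1 ?e2] sym[of ?e1 ?e3] sym[of ?e2 ?e3] by (simp_all add: mink_axis)
  have r: "x $ 1 * A ?e1 $ i + x $ 2 * A ?e2 $ i + x $ 3 * A ?e3 $ i = 0" for i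
    using radial linear_minkowski_expand[OF lin, of x] by (simp add: vec_eq_iff)
  have t: "A ?e2 $ 2 + A ?e3 $ 3 + A ?e1 $ 1 = 0"
    using trace by (simp add: mink_trace_def mink_axis)
  have D': "D v $ 1 = x $ 3 * A v $ 2 - x $ 2 * A v $ 3 + (v $ 3 * g $ 2 - v $ 2 * g $ 3)"
    "D v $ 2 = x $ 3 * A v $ 1 - x $ 1 * A v $ 3 + (v $ 3 * g $ 1 - v $ 1 * g $ 3)"
    "D v $ 3 = x $ 1 * A v $ 2 - x $ 2 * A v $ 1 + (v $ 1 * g $ 2 - v $ 2 * g $ 1)" for v
    by (simp_all add: D mcross_nth)
  have ax: "?e1 $ 1 = 1" "?e1 $ 2 = 0" "?e1 $ 3 = 0" "?e2 $ 1 = 0" "?e2 $ 2 = 1" "?e2 $ 3 = 0"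
    "?e3 $ 1 = 0" "?e3 $ 2 = 0" "?e3 $ 3 = 1" by (simp_all add: axis_def)
  show ?thesis
    unfolding vec_eq_iff forall_3 curl_nth D' ax vector_scaleR_component real_scaleR_def
    using r[of 1] r[of 2] r[of 3] t s by (intro conjI; algebra)
qed

text \<open>
  On the hyperbolic plane the curl of \<open>F\<close> is \<open>-2 grad U\<close>. The derivative of \<open>grad U\<close> is tangent because
  second derivatives of \<open>U\<close> vanish on \<open>p\<close>.
\<close>

lemma mean_surface_imp_curl_condition:
  assumes V: "vector_field hyp V" and u: "smooth_map hyp u" and mean: "mean_surface u"
    and assoc: "\<And>p. p \<in> hyp \<Longrightarrow> V p = associated_field u p"
  shows "(\<forall>p\<in>hyp. divergence (homog_ext V) p = 0) \<and> curl_condition (homog_ext V)"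
proof -
  interpret U: homogeneous "homog_ext u" by (rule homogeneous_homog_ext[OF u])
  interpret F: homogeneous "homog_ext V" by (rule homogeneous_field[OF V])
  define G where "G = mink_grad (homog_ext u)"
  let ?F = "homog_ext V"
  note Gs = smooth_on_mink_grad[OF U.smooth, folded G_def]
  have FG: "?F x = x \<boxtimes> G x" if x: "x \<in> future_cone" for x
  proof -
    have p: "hyp_retract x \<in> hyp" "hyp_retract x \<in> future_cone" using hyp_retract_in_hyp[OF x] hyp_subset_cone by auto
    have "G x = G (hyp_retract x)"
      using mink_grad_homogeneous[OF U.homogeneous_axioms p(2) mink_norm_pos[OF x], folded hyp_retract_decomp[OF x]]
      by (simp add: G_def)
    moreover have "?F x = mink_norm x *\<^sub>R (hyp_retract x \<boxtimes> G (hyp_retract x))"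
      by (simp add: homog_ext_def[of V] assoc[OF p(1)] associated_field_eq[OF u p(1)] G_def)
    moreover have "\<dots> = (mink_norm x *\<^sub>R hyp_retract x) \<boxtimes> G (hyp_retract x)"
      by (simp add: bounded_bilinear.scaleR_left[OF bounded_bilinear_mcross])
    ultimately show ?thesis using hyp_retract_decomp[OF x] by simp
  qed
  have D: "dird ?F x v = x \<boxtimes> dird G x v + v \<boxtimes> G x" if x: "x \<in> future_cone" for x v
  proof -
    have "dird ?F x v = dird (\<lambda>y. y \<boxtimes> G y) x v"
      by (rule dird_transform[OF open_future_cone _ x])
        (auto intro: smooth_on_bilinear[OF bounded_bilinear_mcross open_future_cone smooth_on_id Gs] simp: FG)
    then show ?thesis using dird_bilinear[OF bounded_bilinear_mcross smooth_on_id Gs x] by simp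
  qed
  have G': "mink (dird G x v) w = second_dird (homog_ext u) x v w" if "x \<in> future_cone" for x v w
    unfolding G_def by (rule mink_dird_mink_grad[OF U.smooth that])
  have sym: "mink (dird G x v) w = mink (dird G x w) v" if "x \<in> future_cone" for x v w
    unfolding G'[OF that] by (rule second_dird_sym[OF open_future_cone U.smooth that])
  have curlF: "curl ?F q = (-2) *\<^sub>R G q" if q: "q \<in> hyp" for q
  proof -
    have qc: "q \<in> future_cone" using q hyp_subset_cone by auto
    have "dird G q q = 0"
      using mink_nondegenerate[of "dird G q q"] by (simp add: G'[OF qc] U.second_euler[OF qc])
    moreover have "mink_trace (\<lambda>v w. mink (dird G q v) w) = 0"
      using mean[unfolded mean_surface_iff[OF u]] q by (simp add: G'[OF qc])
    ultimately show ?thesis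
      unfolding curl_def by (intro curl_mcross[OF dird_linear[OF Gs qc] sym[OF qc] _ _ D[OF qc]])
  qed
  have "divergence ?F p = 0" if p: "p \<in> hyp" for p
  proof -
    have pc: "p \<in> future_cone" using p hyp_subset_cone by auto
    show ?thesis unfolding divergence_def by (rule divergence_mcross[OF sym[OF pc] D[OF pc]])
  qed
  moreover have "mink (curl_vec (second_dird ?F p z)) p = 0" if p: "p \<in> hyp" for p z
  proof -
    have pc: "p \<in> future_cone" using p hyp_subset_cone by auto
    let ?z = "hyp_proj p z"
    have z: "?z \<in> tangent_space hyp p" by (rule hyp.prj_tangent[OF p])
    \<comment> \<open>The formula for the curl is known on the hyperbolic plane only, so it can be differentiated in tangent directions only.\<close>
    have "second_dird ?F p z = second_dird ?F p ?z"
      using linear_add[OF second_dird_linear1[OF F.smooth pc]] linear_scale[OF second_dird_linear1[OF F.smooth pc]]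
      by (simp add: hyp_proj_def F.second_euler[OF pc] fun_eq_iff)
    then have "curl_vec (second_dird ?F p z) = dird (curl ?F) p ?z" by (simp add: dird_curl[OF F.smooth pc])
    also have "\<dots> = mderiv hyp (curl ?F) p ?z"
      using mderiv_cone_extension[OF smooth_on_curl[OF F.smooth] p z refl] by simp
    also have "\<dots> = mderiv hyp (\<lambda>q. (-2) *\<^sub>R G q) p ?z" by (rule mderiv_cong[OF p curlF])
    also have "\<dots> = (-2) *\<^sub>R dird G p ?z"
      unfolding mderiv_linear_comp[OF bounded_linear_scaleR_right smooth_on_cone_imp_smooth_map[OF Gs] p z]
        mderiv_cone_extension[OF Gs p z refl] ..
    finally show ?thesis by (simp add: mink_algebra G'[OF pc] U.second_euler[OF pc])
  qed
  ultimately show ?thesis by (simp add: curl_condition_def)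
qed


subsection \<open>The potential of a field with the curl condition\<close>

text \<open>
  If \<open>curl F = -2 grad U\<close>, then this is \<open>U\<close> itself, by Euler's identity.
\<close>

definition potential :: "(real^3 \<Rightarrow> real^3) \<Rightarrow> real^3 \<Rightarrow> real" where
  "potential F x = (- 1 / 2) * mink x (curl F x)"

text \<open>
  The curl condition says that differentiating \<open>\<langle>x, curl F\<rangle>\<close> only affects the first factor, so the
  gradient of the potential is \<open>-curl F / 2\<close>. It is divergence-free as any curl is, and its
  cross product with \<open>x\<close> is \<open>F\<close> by Euler's identity and tangency of \<open>V\<close>.
\<close>

lemma curl_condition_imp_mean_surface:
  assumes V: "vector_field hyp V" and curl: "curl_condition (homog_ext V)"
  shows "\<exists>u. smooth_map hyp u \<and> mean_surface u \<and> (\<forall>p\<in>hyp. V p = associated_field u p)"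
proof -
  interpret F: homogeneous "homog_ext V" by (rule homogeneous_field[OF V])
  let ?F = "homog_ext V"
  define c where "c = curl ?F"
  define U where "U = potential ?F"
  have U_eq: "U = (\<lambda>x. (- 1 / 2) * mink x (c x))" by (simp add: fun_eq_iff U_def c_def potential_def)
  have cs: "smooth_on future_cone c" unfolding c_def by (rule smooth_on_curl[OF F.smooth])
  have Us: "smooth_on future_cone U"
    unfolding U_eq
    by (intro smooth_on_linear_comp[OF bounded_linear_mult_right] open_future_cone
        smooth_on_bilinear[OF bounded_bilinear_mink] smooth_on_id cs)
  have ct: "c (t *\<^sub>R x) = c x" if "x \<in> future_cone" "t > 0" for x t
    unfolding c_def curl_def curl_vec_def F.dird_homogeneous[OF that] ..
  interpret U: homogeneous U
    by unfold_locales (simp_all add: Us, simp add: U_eq mink_algebra ct)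
  have radial: "mink x (dird c x z) = 0" if x: "x \<in> future_cone" for x z
  proof -
    let ?p = "hyp_retract x" and ?t = "mink_norm x"
    have p: "?p \<in> hyp" "?p \<in> future_cone" using hyp_retract_in_hyp[OF x] hyp_subset_cone by auto
    have "second_dird ?F ?p z = (\<lambda>w. ?t *\<^sub>R second_dird ?F x z w)"
      using F.second_dird_homogeneous[OF p(2) mink_norm_pos[OF x], folded hyp_retract_decomp[OF x]]
      by (simp add: fun_eq_iff)
    then have "?t *\<^sub>R dird c x z = dird c ?p z"
      by (simp add: c_def dird_curl[OF F.smooth x] dird_curl[OF F.smooth p(2)] curl_vec_scale)
    moreover have "mink ?p (dird c ?p z) = 0"
      using curl p(1) mink_sym[of ?p "dird c ?p z"]
      by (simp add: curl_condition_def c_def dird_curl[OF F.smooth p(2)])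
    ultimately have "mink ?p (?t *\<^sub>R dird c x z) = 0" by simp
    then have "mink (?t *\<^sub>R ?p) (dird c x z) = 0" by (simp add: mink_algebra)
    then show ?thesis unfolding hyp_retract_decomp[OF x, symmetric] .
  qed
  have dU: "dird U x z = (- 1 / 2) * mink z (c x)" if x: "x \<in> future_cone" for x z
  proof -
    have "smooth_on future_cone (\<lambda>y. mink y (c y))"
      by (rule smooth_on_bilinear[OF bounded_bilinear_mink open_future_cone smooth_on_id cs])
    from dird_linear_comp[OF bounded_linear_mult_right this x]
    have "dird U x z = (- 1 / 2) * dird (\<lambda>y. mink y (c y)) x z"
      unfolding U_eq .
    then show ?thesis using dird_bilinear[OF bounded_bilinear_mink smooth_on_id cs x] radial[OF x] by simp
  qed
  have grad: "mink_grad U x = (- 1 / 2) *\<^sub>R c x" if x: "x \<in> future_cone" for x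
    by (rule mink_grad_unique[OF Us x]) (simp add: mink_algebra dU[OF x] mink_sym)
  have ddU: "second_dird U x v w = (- 1 / 2) * mink w (dird c x v)" if x: "x \<in> future_cone" for x v w
  proof -
    have s: "smooth_on future_cone (\<lambda>y. (- 1 / 2) * mink w (c y))"
      by (intro smooth_on_linear_comp[OF bounded_linear_mult_right] open_future_cone
        smooth_on_bilinear[OF bounded_bilinear_mink] smooth_on_const cs)
    have "second_dird U x v w = dird (\<lambda>y. (- 1 / 2) * mink w (c y)) x v"
      unfolding second_dird_def by (rule dird_transform[OF open_future_cone s x]) (simp add: dU)
    also have "\<dots> = (- 1 / 2) * mink w (dird c x v)"
      by (rule dird_linear_comp[OF bounded_linear_compose[OF bounded_linear_mult_right
            bounded_bilinear.bounded_linear_right[OF bounded_bilinear_mink]] cs x])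
    finally show ?thesis .
  qed
  have restrict: "homog_ext U x = U x" if "x \<in> future_cone" for x
    by (rule U.homog_ext_restrict[OF that])
  have same: "dird (homog_ext U) x v = dird U x v" if "x \<in> future_cone" for x v
    by (rule dird_transform[OF open_future_cone Us that]) (simp add: restrict)
  have same2: "second_dird (homog_ext U) x v w = second_dird U x v w" if "x \<in> future_cone" for x v w
    unfolding second_dird_def
    by (rule dird_transform[OF open_future_cone smooth_on_dird[OF Us] that]) (simp add: same)
  have u: "smooth_map hyp U" by (rule smooth_on_cone_imp_smooth_map[OF Us])
  have "mink_trace (second_dird (homog_ext U) p) = 0" if p: "p \<in> hyp" for p
  proof -
    have pc: "p \<in> future_cone" using p hyp_subset_cone by auto
    let ?S = "second_dird ?F p"
    have "?S v w $ i = ?S w v $ i" for v w i using second_dird_sym[OF open_future_cone F.smooth pc, of v w] by simp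
    then have "mink_trace (\<lambda>v w. mink w (curl_vec (?S v))) = 0"
      unfolding mink_trace_def mink_sym[of "axis _ _" "curl_vec _"] mink_axis curl_nth by simp
    then show ?thesis
      by (simp add: same2[OF pc] ddU[OF pc] c_def dird_curl[OF F.smooth pc] mink_trace_def algebra_simps)
  qed
  then have "mean_surface U" by (simp add: mean_surface_iff[OF u])
  moreover have "V p = associated_field U p" if p: "p \<in> hyp" for p
  proof -
    have pc: "p \<in> future_cone" using p hyp_subset_cone by auto
    have "mink_grad (homog_ext U) p = mink_grad U p" by (simp add: mink_grad_def same[OF pc])
    then have a: "associated_field U p = p \<boxtimes> ((- 1 / 2) *\<^sub>R c p)"
      unfolding associated_field_eq[OF u p] by (simp add: grad[OF pc])
    have "mink (p \<boxtimes> c p) z = - 2 * mink (V p) z" for z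
    proof -
      have "mink (p \<boxtimes> c p) z = - mink (c p \<boxtimes> p) z" by (simp add: mink_def mcross_nth algebra_simps)
      also have "\<dots> = - (mink z (dird ?F p p) - mink p (dird ?F p z))"
        unfolding c_def curl_def mcross_curl_vec[OF dird_linear[OF F.smooth pc]] ..
      also have "\<dots> = - 2 * mink (V p) z"
        by (simp add: F.euler[OF pc] mink_dird_homog_ext[OF V pc] homog_ext_hyp[OF p] mink_sym[of z "V p"])
      finally show ?thesis .
    qed
    then have "mink (V p - associated_field U p) z = 0" for z
      unfolding a mink_algebra bounded_bilinear.scaleR_right[OF bounded_bilinear_mcross] by simp
    then have "V p - associated_field U p = 0" by (rule mink_nondegenerate)
    then show ?thesis by simp
  qed
  ultimately show ?thesis using u by blast
qed

theorem theorem1p3: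
  fixes V :: "real^3 \<Rightarrow> real^3"
  assumes "vector_field hyp V"
  shows "((\<exists>u :: real^3 \<Rightarrow> real. smooth_map hyp u \<and> mean_surface u \<and>
            (\<forall>p\<in>hyp. V p = associated_field u p))
          \<longleftrightarrow> harmonic_lagrangian V) \<and>
         (harmonic_lagrangian V
          \<longleftrightarrow> (\<forall>p\<in>hyp. endo_trace hyp hyp_metric p (lie_derivative_tensor hyp hyp_metric V p) = 0) \<and>
              (\<forall>X Y. vector_field hyp X \<longrightarrow> vector_field hyp Y \<longrightarrow>
                 (\<forall>p\<in>hyp. ext_cov_deriv hyp hyp_metric (lie_derivative_tensor hyp hyp_metric V) X Y p = 0)))"
proof -
  have "(\<exists>u. smooth_map hyp u \<and> mean_surface u \<and> (\<forall>p\<in>hyp. V p = associated_field u p))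
      \<longleftrightarrow> (\<forall>p\<in>hyp. divergence (homog_ext V) p = 0) \<and> curl_condition (homog_ext V)"
    using mean_surface_imp_curl_condition[OF assms] curl_condition_imp_mean_surface[OF assms] by blast
  then show ?thesis
    unfolding harmonic_lagrangian_iff[OF assms] codazzi_iff[OF assms]
    by (simp add: endo_trace_lie_derivative[OF assms])
qed

end
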